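(* Fix $\eta>1$. There exist a numerical constant $c$ and a constant $c_\eta$ depending only on $\eta$ such that the following holds for every $p\ge3$. Let $\theta^*\in\mathbb R^p$, $\sigma>0$, $\Sigma\in\mathcal U(\eta)$, $\delta\in(0,1)$ and $\mathbf a_1,\mathbf a_2,\mathbf a_3>0$ satisfy $c[\mathbf a_2\|\theta^*\|_0+\log(4/\delta)]\le m$, and let $S\subset\{1,\dots,p\}$ be a fixed set satisfying property $\mathbf S[\mathbf a_1,\mathbf a_2,\mathbf a_3]$. Let $\underline c_*\ge\sqrt2\,\mathbf a_1+11\eta^2(\mathbf a_3\vee1)\sqrt{\log(4e/\delta)}$. Then: if $\|\theta^*\|_0\le k_0$, $\mathbb P_{\theta^*,\Sigma,\sigma}[\phi^{(th)}[S;\underline c_*]=1]\le\delta$; if $\|\theta^*\|_0>k_0$ and $$d_2^2(\theta^*,\mathbb B_0[k_0])\ge c_\eta\Big[1+\mathbf a_3^2\|\theta^*\|_0\frac{\log p}{m}\Big]\Big[\mathbf a_3^2\sqrt{\log(4/\delta)}+\underline c_*^2\Big]\sigma^2\frac{(\|\theta^*\|_0-k_0)\log p}{m},$$ then $\mathbb P_{\theta^*,\Sigma,\sigma}[\phi^{(th)}[S;\underline c_*]=1]\ge1-\delta$.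
   Context: Data: a sample $(Y^{(0)},\mathbf X^{(0)})$ of size $m$ from the model $Y^{(0)}=\mathbf X^{(0)}\theta^*+\sigma\epsilon$, rows of $\mathbf X^{(0)}\in\mathbb R^{m\times p}$ i.i.d. $\mathcal N(0,\Sigma)$, $\epsilon\sim\mathcal N(0,I_m)$ independent. $\mathcal U(\eta)$ is the set of $p\times p$ covariance matrices with all eigenvalues in $[\eta^{-1},\eta]$. $\mathbb B_0[k]=\{\theta:\|\theta\|_0\le k\}$, $d_2(\theta,A)=\inf_{u\in A}\|\theta-u\|_2$. For $u\in\mathbb R^p$ and $S\subset\{1,\ldots,p\}$, $u_S=(u_i\mathbf 1_{i\in S})_i$ and $\bar S$ is the complement. For $\mathbf a>0$ and $v\in\mathbb R^p$, $M(\mathbf a,v)=|\{i:0<|v_i|\le\mathbf a\sqrt{\log(p)/m}\}|$. A set $S$ satisfies property $\mathbf S[\mathbf a_1,\mathbf a_2,\mathbf a_3]$ if $|S|\le\mathbf a_2\|\theta^*\|_0$ and $\|\theta^*_{\bar S}\|_2^2\le\mathbf a_3^2\sigma^2M(\mathbf a_1,\theta^*/\sigma)\log(p)/m$. Given $S$, $\hat\theta_{ls,S}\in\arg\min_{\theta:\,\mathrm{supp}(\theta)\subset S}\|Y^{(0)}-\mathbf X^{(0)}\theta\|_2^2$ and $\hat\sigma_S^2=\frac1m\|Y^{(0)}-\mathbf X^{(0)}\hat\theta_{ls,S}\|_2^2$. For $u\in\mathbb R^p$ and $c>0$, $N[c;u]=|\{i:|u_i|\ge c\sqrt{\log(p)/m}\}|$.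 The test $\phi^{(th)}[S;c]$ rejects (equals 1) iff $N[c;\hat\theta_{ls,S}/\hat\sigma_S]\ge k_0+1$. *)

theory Defs
  imports "HOL-Probability.Probability" "Jordan_Normal_Form.Determinant"
    "Jordan_Normal_Form.Char_Poly" "Jordan_Normal_Form.Gauss_Jordan_Elimination"
begin

text \<open>Vectors in R^p are functions nat => real; only coordinates i < p matter.
  Matrices X in R^(m x p) are functions nat => nat => real (row i, column j).\<close>

definition l0 :: "nat \<Rightarrow> (nat \<Rightarrow> real) \<Rightarrow> nat" where
  "l0 p u = card {i \<in> {..<p}. u i \<noteq> 0}"

definition d2_B0 :: "nat \<Rightarrow> nat \<Rightarrow> (nat \<Rightarrow> real) \<Rightarrow> real" where
  "d2_B0 p k \<theta> = Inf {sqrt (\<Sum>i<p. (\<theta> i - u i)^2) | u. l0 p u \<le> k}"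

definition Mcount :: "nat \<Rightarrow> nat \<Rightarrow> real \<Rightarrow> (nat \<Rightarrow> real) \<Rightarrow> nat" where
  "Mcount p m a v = card {i \<in> {..<p}. 0 < \<bar>v i\<bar> \<and> \<bar>v i\<bar> \<le> a * sqrt (ln (real p) / real m)}"

definition propS :: "nat \<Rightarrow> nat \<Rightarrow> (nat \<Rightarrow> real) \<Rightarrow> real \<Rightarrow> real \<Rightarrow> real \<Rightarrow> real
    \<Rightarrow> nat set \<Rightarrow> bool" where
  "propS p m \<theta> \<sigma> a1 a2 a3 S \<longleftrightarrow>
     S \<subseteq> {..<p} \<and> real (card S) \<le> a2 * real (l0 p \<theta>) \<and>
     (\<Sum>i\<in>{..<p} - S. (\<theta> i)^2)
        \<le> a3^2 * \<sigma>^2 * real (Mcount p m a1 (\<lambda>i. \<theta> i / \<sigma>)) * ln (real p) / real m"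

definition covU :: "nat \<Rightarrow> real \<Rightarrow> real mat \<Rightarrow> bool" where
  "covU p \<eta> \<Sigma> \<longleftrightarrow> \<Sigma> \<in> carrier_mat p p \<and> transpose_mat \<Sigma> = \<Sigma> \<and>
     (\<forall>ev. eigenvalue \<Sigma> ev \<longrightarrow> 1 / \<eta> \<le> ev \<and> ev \<le> \<eta>)"

definition gauss_density :: "nat \<Rightarrow> real mat \<Rightarrow> (nat \<Rightarrow> real) \<Rightarrow> real" where
  "gauss_density p \<Sigma> x =
     exp (- (\<Sum>i<p. \<Sum>j<p. x i * (the (mat_inverse \<Sigma>)) $$ (i, j) * x j) / 2)
     / sqrt ((2 * pi) ^ p * det \<Sigma>)"

definition gauss_vec :: "nat \<Rightarrow> real mat \<Rightarrow> (nat \<Rightarrow> real) measure" where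
  "gauss_vec p \<Sigma> = density (PiM {..<p} (\<lambda>_. lborel)) (\<lambda>x. ennreal (gauss_density p \<Sigma> x))"

definition std_gauss :: "real measure" where
  "std_gauss = density lborel std_normal_density"

definition data_law :: "nat \<Rightarrow> nat \<Rightarrow> real mat
    \<Rightarrow> ((nat \<Rightarrow> nat \<Rightarrow> real) \<times> (nat \<Rightarrow> real)) measure" where
  "data_law m p \<Sigma> = (PiM {..<m} (\<lambda>_. gauss_vec p \<Sigma>)) \<Otimes>\<^sub>M (PiM {..<m} (\<lambda>_. std_gauss))"

definition response :: "nat \<Rightarrow> (nat \<Rightarrow> real) \<Rightarrow> real \<Rightarrow> (nat \<Rightarrow> nat \<Rightarrow> real)
    \<Rightarrow> (nat \<Rightarrow> real) \<Rightarrow> (nat \<Rightarrow> real)" where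
  "response p \<theta> \<sigma> X \<epsilon> = (\<lambda>i. (\<Sum>j<p. X i j * \<theta> j) + \<sigma> * \<epsilon> i)"

definition RSS :: "nat \<Rightarrow> nat \<Rightarrow> (nat \<Rightarrow> real) \<Rightarrow> (nat \<Rightarrow> nat \<Rightarrow> real) \<Rightarrow> (nat \<Rightarrow> real) \<Rightarrow> real" where
  "RSS m p Y X \<theta> = (\<Sum>i<m. (Y i - (\<Sum>j<p. X i j * \<theta> j))^2)"

definition is_ls_S :: "nat \<Rightarrow> nat \<Rightarrow> nat set \<Rightarrow> (nat \<Rightarrow> real) \<Rightarrow> (nat \<Rightarrow> nat \<Rightarrow> real)
    \<Rightarrow> (nat \<Rightarrow> real) \<Rightarrow> bool" where
  "is_ls_S m p S Y X t \<longleftrightarrow> (\<forall>j. j \<notin> S \<longrightarrow> t j = 0) \<and>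
     (\<forall>t'. (\<forall>j. j \<notin> S \<longrightarrow> t' j = 0) \<longrightarrow> RSS m p Y X t \<le> RSS m p Y X t')"

definition Ncount :: "nat \<Rightarrow> nat \<Rightarrow> real \<Rightarrow> (nat \<Rightarrow> real) \<Rightarrow> nat" where
  "Ncount p m c u = card {i \<in> {..<p}. \<bar>u i\<bar> \<ge> c * sqrt (ln (real p) / real m)}"

definition test_th :: "nat \<Rightarrow> nat \<Rightarrow> nat \<Rightarrow> real
    \<Rightarrow> ((nat \<Rightarrow> real) \<Rightarrow> (nat \<Rightarrow> nat \<Rightarrow> real) \<Rightarrow> (nat \<Rightarrow> real))
    \<Rightarrow> (nat \<Rightarrow> real) \<Rightarrow> (nat \<Rightarrow> nat \<Rightarrow> real) \<Rightarrow> bool" where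
  "test_th m p k0 c est Y X \<longleftrightarrow>
     (let th = est Y X; sh = sqrt (RSS m p Y X th / real m)
      in Ncount p m c (\<lambda>i. th i / sh) \<ge> k0 + 1)"

text \<open>Outer / inner probability of a (possibly non-measurable) event.\<close>
definition prob_le :: "'a measure \<Rightarrow> ('a \<Rightarrow> bool) \<Rightarrow> real \<Rightarrow> bool" where
  "prob_le M P r \<longleftrightarrow> (\<exists>A \<in> sets M. {\<omega> \<in> space M. P \<omega>} \<subseteq> A \<and> measure M A \<le> r)"

definition prob_ge :: "'a measure \<Rightarrow> ('a \<Rightarrow> bool) \<Rightarrow> real \<Rightarrow> bool" where
  "prob_ge M P r \<longleftrightarrow> (\<exists>A \<in> sets M. A \<subseteq> {\<omega> \<in> space M. P \<omega>} \<and> measure M A \<ge> r)"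

end

theory Submission
  imports Defs
begin

text \<open>Order the coordinates of a row so that those in \<open>S\<close> come first and factor the Gaussian law
  triangularly: the columns in \<open>S\<close> then depend only on the Gaussians indexed by \<open>S\<close>, while the
  response is \<open>X\<^sub>S (\<theta>\<^sub>S + b) + y\<close> with a bias \<open>b\<close> controlled by \<open>\<theta>\<close> off \<open>S\<close> and a residual \<open>y\<close>
  built from the remaining Gaussians. A net argument for the Gaussian matrix with the columns \<open>S\<close>
  and \<open>y\<close> bounds the residual sum of squares and the Gram matrix of the columns, and conditionally
  on the columns each coordinate of the least squares error is Gaussian, so the error exceeds
  \<open>b\<close> by at most order $\sqrt{\log p/m}$ in every coordinate. False discoveries are thus forced by large
  coordinates of \<open>b\<close>, and its norm allows at most as many of them as there are small nonzero
  coordinates of \<open>\<theta>\<close>, which are not counted among the discoveries otherwise.\<close>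

section \<open>Triangular factorization of Gaussian integrals\<close>

text \<open>The constant in the sample size condition may not depend on \<eta>, so the random part
  of the argument must not see the covariance. Whitening achieves this: the unit vectors of the
  coordinates in \<open>S\<close> and the normalised residual direction are orthonormal, so the net
  is taken for a standard Gaussian matrix with \<open>card S + 1\<close> columns, whatever \<Sigma>
  is; \<eta> enters only afterwards, through deterministic comparisons of norms. The noise enters as
  one more column of the same Gaussian array. The factor \<open>sqrt 2\<close> in front of
  \<open>a1\<close> in the threshold pays for an estimated noise level as low as \<tau> /
  \<open>sqrt 2\<close>, where \<tau> is the residual deviation; the 11 leaves room for the noise
  and for the bias that is counted. The least squares solution is an arbitrary selection among
  minimisers, so the test may fail to be measurable. All estimates are therefore made on one
  measurable event of probability at least 1 - \<delta>, on which every minimiser behaves well; it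
  serves both error bounds.\<close>

lemma sets_std_gauss [simp, measurable_cong]: "sets std_gauss = sets borel"
  by (simp add: std_gauss_def)

lemma space_std_gauss [simp]: "space std_gauss = UNIV"
  by (simp add: std_gauss_def)

lemma prob_space_std_gauss: "prob_space std_gauss"
  unfolding std_gauss_def using prob_space_normal_density[of 1 0] by simp

lemma product_prob_space_std_gauss: "product_prob_space (\<lambda>_::'i. std_gauss)"
  by (rule product_prob_spaceI) (rule prob_space_std_gauss)

lemma product_sigma_finite_std_gauss: "product_sigma_finite (\<lambda>_::'i. std_gauss)"
  using prob_space_imp_sigma_finite prob_space_std_gauss product_sigma_finite_def by blast

lemma product_sigma_finite_lborel: "product_sigma_finite (\<lambda>_::'i. lborel :: real measure)"
  by (simp add: product_sigma_finite_def lborel.sigma_finite_measure_axioms)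

lemma nn_integral_std_gauss:
  assumes "f \<in> borel_measurable borel"
  shows "(\<integral>\<^sup>+x. f x \<partial>std_gauss) = (\<integral>\<^sup>+x. ennreal (std_normal_density x) * f x \<partial>lborel)"
  unfolding std_gauss_def by (subst nn_integral_density) (use assms in auto)

text \<open>The substitution \<open>y = g / sqrt \<beta> - c\<close> turns the weight into a
  standard normal one. This is the one-variable step of the factorization below and, with
  \<open>f = 1\<close>, also yields the Gaussian Laplace transforms behind the tail bounds.\<close>

lemma nn_integral_gaussian_affine:
  fixes f :: "real \<Rightarrow> ennreal"
  assumes f [measurable]: "f \<in> borel_measurable borel" and \<beta>: "\<beta> > 0"
  shows "(\<integral>\<^sup>+y. f y * ennreal (exp (- (\<beta> * (y + c)\<^sup>2) / 2)) \<partial>lborel)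
    = ennreal (sqrt (2 * pi) * (1 / sqrt \<beta>)) * (\<integral>\<^sup>+g. f (g / sqrt \<beta> - c) \<partial>std_gauss)"
proof -
  have "(\<integral>\<^sup>+y. f y * ennreal (exp (- (\<beta> * (y + c)\<^sup>2) / 2)) \<partial>lborel)
     = ennreal \<bar>1 / sqrt \<beta>\<bar> * (\<integral>\<^sup>+g. f (- c + 1 / sqrt \<beta> * g) *
          ennreal (exp (- (\<beta> * (- c + 1 / sqrt \<beta> * g + c)\<^sup>2) / 2)) \<partial>lborel)"
    using \<beta> by (intro nn_integral_real_affine) auto
  also have "(\<integral>\<^sup>+g. f (- c + 1 / sqrt \<beta> * g) *
          ennreal (exp (- (\<beta> * (- c + 1 / sqrt \<beta> * g + c)\<^sup>2) / 2)) \<partial>lborel)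
     = (\<integral>\<^sup>+g. ennreal (sqrt (2 * pi)) * (ennreal (std_normal_density g) * f (g / sqrt \<beta> - c)) \<partial>lborel)"
  proof (rule nn_integral_cong)
    fix g :: real
    have "exp (- (\<beta> * (- c + 1 / sqrt \<beta> * g + c)\<^sup>2) / 2) = sqrt (2 * pi) * std_normal_density g"
      using \<beta> by (simp add: std_normal_density_def power_divide)
    thus "f (- c + 1 / sqrt \<beta> * g) * ennreal (exp (- (\<beta> * (- c + 1 / sqrt \<beta> * g + c)\<^sup>2) / 2))
       = ennreal (sqrt (2 * pi)) * (ennreal (std_normal_density g) * f (g / sqrt \<beta> - c))"
      by (simp add: ennreal_mult' mult_ac)
  qed
  also have "(\<integral>\<^sup>+g. ennreal (sqrt (2 * pi)) * (ennreal (std_normal_density g) * f (g / sqrt \<beta> - c)) \<partial>lborel)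
     = ennreal (sqrt (2 * pi)) * (\<integral>\<^sup>+g. f (g / sqrt \<beta> - c) \<partial>std_gauss)"
    by (simp add: nn_integral_std_gauss nn_integral_cmult)
  also have "ennreal \<bar>1 / sqrt \<beta>\<bar> * (ennreal (sqrt (2 * pi)) * (\<integral>\<^sup>+g. f (g / sqrt \<beta> - c) \<partial>std_gauss))
     = ennreal (sqrt (2 * pi) * (1 / sqrt \<beta>)) * (\<integral>\<^sup>+g. f (g / sqrt \<beta> - c) \<partial>std_gauss)"
    using \<beta> by (subst ennreal_mult) (auto simp: mult_ac)
  finally show ?thesis .
qed

definition qform :: "'i set \<Rightarrow> ('i \<Rightarrow> 'i \<Rightarrow> real) \<Rightarrow> ('i \<Rightarrow> real) \<Rightarrow> real" where
  "qform I B x = (\<Sum>i\<in>I. \<Sum>j\<in>I. x i * B i j * x j)"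

text \<open>The result is cut off outside \<open>I\<close> because the points of
  \<open>PiM I\<close> are extensional functions.\<close>

definition lmap :: "'i set \<Rightarrow> ('i \<Rightarrow> 'i \<Rightarrow> real) \<Rightarrow> ('i \<Rightarrow> real) \<Rightarrow> 'i \<Rightarrow> real" where
  "lmap I L g = (\<lambda>i\<in>I. \<Sum>j\<in>I. L i j * g j)"

lemma qform_cong: "(\<And>i. i \<in> I \<Longrightarrow> x i = y i) \<Longrightarrow> qform I B x = qform I B y"
  unfolding qform_def by (auto intro!: sum.cong)

text \<open>Completing the square in \<open>x i\<close>; the remaining form is the Schur complement
  of the pivot \<open>B i i\<close>.\<close>

lemma qform_insert_schur:
  fixes B :: "'i \<Rightarrow> 'i \<Rightarrow> real"
  assumes I: "finite I" "i \<notin> I" and sym: "\<And>k. k \<in> I \<Longrightarrow> B k i = B i k" and \<beta>: "B i i > 0"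
  shows "qform (insert i I) B x = B i i * (x i + (\<Sum>k\<in>I. B i k / B i i * x k))\<^sup>2
     + qform I (\<lambda>j k. B j k - B j i * B i k / B i i) x"
proof -
  define b where "b = (\<Sum>k\<in>I. B i k * x k)"
  have C: "(\<Sum>k\<in>I. B i k / B i i * x k) = b / B i i"
    by (simp add: b_def sum_divide_distrib)
  have b1: "(\<Sum>k\<in>I. x i * B i k * x k) = x i * b"
    by (simp add: b_def sum_distrib_left mult_ac)
  have b2: "(\<Sum>k\<in>I. x k * B k i * x i) = x i * b"
    by (simp add: b_def sum_distrib_left mult_ac sym)
  have "qform I (\<lambda>j k. B j k - B j i * B i k / B i i) x
      = qform I B x - (\<Sum>j\<in>I. \<Sum>k\<in>I. (B i j * x j) * (B i k * x k) / B i i)"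
    unfolding qform_def by (simp add: sum_subtractf[symmetric] sym algebra_simps)
  also have "(\<Sum>j\<in>I. \<Sum>k\<in>I. (B i j * x j) * (B i k * x k) / B i i) = b * b / B i i"
    unfolding b_def sum_product sum_divide_distrib ..
  finally have q': "qform I (\<lambda>j k. B j k - B j i * B i k / B i i) x = qform I B x - b * b / B i i" .
  have "qform (insert i I) B x = x i * B i i * x i + x i * b + (x i * b + qform I B x)"
    unfolding qform_def using I b1 b2 by (simp add: sum.distrib)
  moreover have "B i i * (x i + b / B i i)\<^sup>2 = x i * B i i * x i + 2 * (x i * b) + b * b / B i i"
    using \<beta> by (simp add: power2_eq_square field_simps)
  ultimately show ?thesis unfolding C q' by simp
qed

lemma qform_indicator:
  assumes "finite I" "i \<in> I"
  shows "qform I B (\<lambda>k. if k = i then 1 else 0) = B i i"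
proof -
  have "qform I B (\<lambda>k. if k = i then 1 else 0) = (\<Sum>k\<in>I. \<Sum>j\<in>I. if k = i then (if j = i then B i i else 0) else 0)"
    unfolding qform_def by (intro sum.cong refl) auto
  also have "\<dots> = (\<Sum>k\<in>I. if k = i then B i i else 0)"
    using assms by (intro sum.cong refl) (auto simp: sum.delta)
  finally show ?thesis using assms by (simp add: sum.delta)
qed

text \<open>The variable of largest rank is integrated out first, so each coordinate of the
  transformed vector involves only Gaussians of at most its own rank.\<close>

lemma gaussian_cholesky:
  fixes B :: "'i \<Rightarrow> 'i \<Rightarrow> real" and \<rho> :: "'i \<Rightarrow> nat"
  assumes "finite I"
    and "\<And>i j. i \<in> I \<Longrightarrow> j \<in> I \<Longrightarrow> B i j = B j i"
    and "\<And>x. (\<exists>i\<in>I. x i \<noteq> 0) \<Longrightarrow> 0 < qform I B x"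
  shows "\<exists>L. (\<forall>i\<in>I. L i i > 0) \<and> (\<forall>i\<in>I. \<forall>j\<in>I. \<rho> i < \<rho> j \<longrightarrow> L i j = 0) \<and>
     (\<forall>g. qform I B (lmap I L g) = (\<Sum>i\<in>I. (g i)\<^sup>2)) \<and>
     (\<forall>f \<in> borel_measurable (PiM I (\<lambda>_. borel)).
        (\<integral>\<^sup>+x. f x * ennreal (exp (- qform I B x / 2)) \<partial>PiM I (\<lambda>_. lborel))
         = ennreal (sqrt (2 * pi) ^ card I * (\<Prod>i\<in>I. L i i)) *
           (\<integral>\<^sup>+g. f (lmap I L g) \<partial>PiM I (\<lambda>_. std_gauss)))"
  using assms
proof (induction I arbitrary: B rule: finite_ranking_induct[where f = \<rho>])
  case empty
  show ?case by (simp add: qform_def lmap_def PiM_empty nn_integral_count_space_finite)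
next
  case (insert i I B)
  show ?case
  \<comment> \<open>The ranking induction does not guarantee that the inserted index is new.\<close>
  proof (cases "i \<in> I")
    case True
    thus ?thesis using insert.IH[of B] insert.prems by (simp add: insert_absorb)
  next
    case False
    interpret pl: product_sigma_finite "\<lambda>_::'i. lborel :: real measure"
      by (rule product_sigma_finite_lborel)
    interpret ps: product_sigma_finite "\<lambda>_::'i. std_gauss"
      by (rule product_sigma_finite_std_gauss)
    define \<beta> where "\<beta> = B i i"
    define B' where "B' = (\<lambda>j k. B j k - B j i * B i k / B i i)"
    define C where "C = (\<lambda>x :: 'i \<Rightarrow> real. \<Sum>k\<in>I. B i k / B i i * x k)"
    have \<beta>: "\<beta> > 0"
      using insert.prems(2)[of "\<lambda>k. if k = i then 1 else 0"] qform_indicator[of "insert i I" i B] \<open>finite I\<close>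
      by (simp add: \<beta>_def)
    have schur: "qform (insert i I) B x = \<beta> * (x i + C x)\<^sup>2 + qform I B' x" for x
      unfolding \<beta>_def C_def B'_def using \<open>finite I\<close> False \<beta> insert.prems(1)
      by (intro qform_insert_schur) (auto simp: \<beta>_def)
    have C_upd: "C (x(i := t)) = C x" for x t
      unfolding C_def using False by (intro sum.cong) auto
    have q_upd: "qform I B' (x(i := t)) = qform I B' x" for x t
      using False by (intro qform_cong) auto
    have "\<exists>L. (\<forall>i\<in>I. L i i > 0) \<and> (\<forall>i\<in>I. \<forall>j\<in>I. \<rho> i < \<rho> j \<longrightarrow> L i j = 0) \<and>
     (\<forall>g. qform I B' (lmap I L g) = (\<Sum>i\<in>I. (g i)\<^sup>2)) \<and>
     (\<forall>f \<in> borel_measurable (PiM I (\<lambda>_. borel)).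
        (\<integral>\<^sup>+x. f x * ennreal (exp (- qform I B' x / 2)) \<partial>PiM I (\<lambda>_. lborel))
         = ennreal (sqrt (2 * pi) ^ card I * (\<Prod>i\<in>I. L i i)) *
           (\<integral>\<^sup>+g. f (lmap I L g) \<partial>PiM I (\<lambda>_. std_gauss)))"
    proof (rule insert.IH)
      show "B' j k = B' k j" if "j \<in> I" "k \<in> I" for j k
        using that insert.prems(1)[of j k] insert.prems(1)[of i k] insert.prems(1)[of i j] by (simp add: B'_def)
      show "0 < qform I B' x" if "\<exists>j\<in>I. x j \<noteq> 0" for x
      proof -
        \<comment> \<open>The value \<open>- C x\<close> makes the completed square vanish, so
          positivity of the full form passes to the Schur complement.\<close>
        have "0 < qform (insert i I) B (x(i := - C x))"
          using that False by (intro insert.prems(2)) auto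
        thus ?thesis by (simp add: schur C_upd q_upd)
      qed
    qed
    then obtain L' where L': "\<forall>i\<in>I. L' i i > 0" "\<forall>i\<in>I. \<forall>j\<in>I. \<rho> i < \<rho> j \<longrightarrow> L' i j = 0"
       "\<And>g. qform I B' (lmap I L' g) = (\<Sum>i\<in>I. (g i)\<^sup>2)"
       "\<And>f. f \<in> borel_measurable (PiM I (\<lambda>_. borel)) \<Longrightarrow>
        (\<integral>\<^sup>+x. f x * ennreal (exp (- qform I B' x / 2)) \<partial>PiM I (\<lambda>_. lborel))
         = ennreal (sqrt (2 * pi) ^ card I * (\<Prod>i\<in>I. L' i i)) *
           (\<integral>\<^sup>+g. f (lmap I L' g) \<partial>PiM I (\<lambda>_. std_gauss))"
      by blast
    \<comment> \<open>The rows of \<open>I\<close> are kept and get a zero in column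
      \<open>i\<close>; row \<open>i\<close> solves for the last variable, whose conditional mean
      given the others is \<open>- C\<close> and whose conditional deviation is
      \<open>1 / sqrt \<beta>\<close>.\<close>
    define L where "L = (\<lambda>j k. if j = i then (if k = i then 1 / sqrt \<beta>
         else - (\<Sum>l\<in>I. B i l / B i i * L' l k)) else if k = i then 0 else L' j k)"
    have L_I: "lmap (insert i I) L g j = lmap I L' g j" if "j \<in> I" for j g
    proof -
      have "(\<Sum>k\<in>I. L j k * g k) = (\<Sum>k\<in>I. L' j k * g k)"
        using that False by (intro sum.cong) (auto simp: L_def)
      thus ?thesis using that False \<open>finite I\<close> by (auto simp: lmap_def L_def)
    qed
    have L_i: "lmap (insert i I) L g i = g i / sqrt \<beta> - C (lmap I L' g)" for g
    proof -
      have "(\<Sum>k\<in>I. L i k * g k) = (\<Sum>k\<in>I. - (\<Sum>l\<in>I. B i l / B i i * L' l k) * g k)"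
        using False by (intro sum.cong) (auto simp: L_def)
      also have "\<dots> = - (\<Sum>k\<in>I. \<Sum>l\<in>I. B i l / B i i * (L' l k * g k))"
        by (simp add: sum_distrib_right sum_negf mult.assoc)
      also have "(\<Sum>k\<in>I. \<Sum>l\<in>I. B i l / B i i * (L' l k * g k)) = (\<Sum>l\<in>I. \<Sum>k\<in>I. B i l / B i i * (L' l k * g k))"
        by (rule sum.swap)
      also have "\<dots> = C (lmap I L' g)"
        unfolding C_def lmap_def by (auto intro!: sum.cong simp: sum_distrib_left)
      finally have "(\<Sum>k\<in>I. L i k * g k) = - C (lmap I L' g)" .
      moreover have "lmap (insert i I) L g i = L i i * g i + (\<Sum>k\<in>I. L i k * g k)"
        using False \<open>finite I\<close> by (simp add: lmap_def)
      ultimately show ?thesis by (simp add: L_def)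
    qed
    have lmap_eq: "lmap (insert i I) L g = (lmap I L' g)(i := g i / sqrt \<beta> - C (lmap I L' g))" for g
    proof
      fix j show "lmap (insert i I) L g j = ((lmap I L' g)(i := g i / sqrt \<beta> - C (lmap I L' g))) j"
        using L_I[of j g] L_i[of g] False by (cases "j = i"; cases "j \<in> I") (auto simp: lmap_def)
    qed
    have lmap_upd: "lmap I L' (x(i := t)) = lmap I L' x" for x t
      unfolding lmap_def by (intro restrict_ext sum.cong) (use False in auto)
    have lmap_meas [measurable]: "lmap I L' \<in> PiM I (\<lambda>_. std_gauss) \<rightarrow>\<^sub>M PiM I (\<lambda>_. borel)"
      unfolding lmap_def by measurable
    have diag: "(\<Prod>j\<in>insert i I. L j j) = 1 / sqrt \<beta> * (\<Prod>j\<in>I. L' j j)"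
    proof -
      have "(\<Prod>j\<in>I. L j j) = (\<Prod>j\<in>I. L' j j)"
        using False by (intro prod.cong) (auto simp: L_def)
      thus ?thesis using False \<open>finite I\<close> by (simp add: L_def)
    qed
    show ?thesis
    proof (intro exI[of _ L] conjI ballI impI allI)
      show "L j j > 0" if "j \<in> insert i I" for j
        using that L'(1) False \<beta> by (auto simp: L_def)
      show "L j k = 0" if "j \<in> insert i I" "k \<in> insert i I" "\<rho> j < \<rho> k" for j k
        using that L'(2) insert.hyps(2)[of k] by (auto simp: L_def)
      show "qform (insert i I) B (lmap (insert i I) L g) = (\<Sum>j\<in>insert i I. (g j)\<^sup>2)" for g
        unfolding schur using False \<open>finite I\<close> \<beta> L'(3)[of g]
        by (simp add: lmap_eq C_upd q_upd power_divide)
    next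
      fix f :: "('i \<Rightarrow> real) \<Rightarrow> ennreal"
      assume f: "f \<in> borel_measurable (PiM (insert i I) (\<lambda>_. borel))"
      have upd_meas: "(\<lambda>z. (F z)(i := G z)) \<in> N \<rightarrow>\<^sub>M PiM (insert i I) (\<lambda>_. borel)"
        if "F \<in> N \<rightarrow>\<^sub>M PiM I (\<lambda>_. borel)" "G \<in> N \<rightarrow>\<^sub>M borel" for F G and N :: "'z measure"
        by (rule measurable_fun_upd[OF _ that(1)]) (use that(2) in auto)
      have upd_meas': "(\<lambda>z. f ((F z)(i := G z))) \<in> borel_measurable N"
        if "F \<in> N \<rightarrow>\<^sub>M PiM I (\<lambda>_. borel)" "G \<in> N \<rightarrow>\<^sub>M borel" for F G and N :: "'z measure"
        using measurable_compose[OF upd_meas[OF that] f] .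
      have sets_pl: "sets (PiM J (\<lambda>_::'i. lborel :: real measure)) = sets (PiM J (\<lambda>_. borel))" for J
        by (intro sets_PiM_cong) auto
      have fl: "f \<in> borel_measurable (PiM (insert i I) (\<lambda>_. lborel))"
        using f measurable_cong_sets[OF sets_pl refl] by blast
      have Cm [measurable]: "C \<in> borel_measurable (PiM I (\<lambda>_. borel))"
        unfolding C_def by measurable
      have qm [measurable]: "(\<lambda>x. qform (insert i I) B x) \<in> borel_measurable (PiM (insert i I) (\<lambda>_. lborel))"
        unfolding qform_def by measurable
      \<comment> \<open>The integral over coordinate \<open>i\<close> given the others, after the
        one-variable step; the induction hypothesis is applied to this function in place of
        \<open>f\<close>.\<close>
      define f' where "f' = (\<lambda>x. \<integral>\<^sup>+y. f (x(i := y / sqrt \<beta> - C x)) \<partial>std_gauss)"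
      have f'm: "f' \<in> borel_measurable (PiM I (\<lambda>_. borel))"
        unfolding f'_def
        by (rule sigma_finite_measure.borel_measurable_nn_integral
            [OF prob_space_imp_sigma_finite[OF prob_space_std_gauss]], unfold split_def, rule upd_meas') measurable
      have "(\<integral>\<^sup>+x. f x * ennreal (exp (- qform (insert i I) B x / 2)) \<partial>PiM (insert i I) (\<lambda>_. lborel))
        = (\<integral>\<^sup>+x. \<integral>\<^sup>+y. f (x(i := y)) * ennreal (exp (- qform (insert i I) B (x(i := y)) / 2)) \<partial>lborel \<partial>PiM I (\<lambda>_. lborel))"
        using False \<open>finite I\<close> fl by (intro pl.product_nn_integral_insert) auto
      also have "\<dots> = (\<integral>\<^sup>+x. ennreal (sqrt (2 * pi) * (1 / sqrt \<beta>)) * (f' x * ennreal (exp (- qform I B' x / 2))) \<partial>PiM I (\<lambda>_. lborel))"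
      proof (rule nn_integral_cong)
        fix x assume x: "x \<in> space (PiM I (\<lambda>_::'i. lborel :: real measure))"
        have fx: "(\<lambda>y. f (x(i := y))) \<in> borel_measurable borel"
          using x by (intro upd_meas') (auto simp: space_PiM)
        have "(\<integral>\<^sup>+y. f (x(i := y)) * ennreal (exp (- qform (insert i I) B (x(i := y)) / 2)) \<partial>lborel)
          = (\<integral>\<^sup>+y. ennreal (exp (- qform I B' x / 2)) * (f (x(i := y)) * ennreal (exp (- (\<beta> * (y + C x)\<^sup>2) / 2))) \<partial>lborel)"
        proof (rule nn_integral_cong)
          fix y
          have "exp (- qform (insert i I) B (x(i := y)) / 2)
            = exp (- qform I B' x / 2) * exp (- (\<beta> * (y + C x)\<^sup>2) / 2)"
            unfolding schur C_upd q_upd exp_add[symmetric] by (simp add: field_simps)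
          thus "f (x(i := y)) * ennreal (exp (- qform (insert i I) B (x(i := y)) / 2))
             = ennreal (exp (- qform I B' x / 2)) * (f (x(i := y)) * ennreal (exp (- (\<beta> * (y + C x)\<^sup>2) / 2)))"
            by (simp add: ennreal_mult' mult_ac)
        qed
        also have "\<dots> = ennreal (exp (- qform I B' x / 2)) * (\<integral>\<^sup>+y. f (x(i := y)) * ennreal (exp (- (\<beta> * (y + C x)\<^sup>2) / 2)) \<partial>lborel)"
          using fx by (intro nn_integral_cmult) auto
        also have "(\<integral>\<^sup>+y. f (x(i := y)) * ennreal (exp (- (\<beta> * (y + C x)\<^sup>2) / 2)) \<partial>lborel)
          = ennreal (sqrt (2 * pi) * (1 / sqrt \<beta>)) * f' x"
          unfolding f'_def by (rule nn_integral_gaussian_affine[OF fx \<beta>])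
        finally show "(\<integral>\<^sup>+y. f (x(i := y)) * ennreal (exp (- qform (insert i I) B (x(i := y)) / 2)) \<partial>lborel)
          = ennreal (sqrt (2 * pi) * (1 / sqrt \<beta>)) * (f' x * ennreal (exp (- qform I B' x / 2)))"
          by (simp only: mult_ac)
      qed
      also have "\<dots> = ennreal (sqrt (2 * pi) * (1 / sqrt \<beta>)) * (\<integral>\<^sup>+x. f' x * ennreal (exp (- qform I B' x / 2)) \<partial>PiM I (\<lambda>_. lborel))"
      proof (rule nn_integral_cmult)
        have "(\<lambda>x. qform I B' x) \<in> borel_measurable (PiM I (\<lambda>_. lborel))"
          unfolding qform_def by measurable
        moreover have "f' \<in> borel_measurable (PiM I (\<lambda>_. lborel))"
          using f'm measurable_cong_sets[OF sets_pl refl] by blast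
        ultimately show "(\<lambda>x. f' x * ennreal (exp (- qform I B' x / 2))) \<in> borel_measurable (PiM I (\<lambda>_. lborel))"
          by measurable
      qed
      also have "(\<integral>\<^sup>+x. f' x * ennreal (exp (- qform I B' x / 2)) \<partial>PiM I (\<lambda>_. lborel))
         = ennreal (sqrt (2 * pi) ^ card I * (\<Prod>i\<in>I. L' i i)) * (\<integral>\<^sup>+g. f' (lmap I L' g) \<partial>PiM I (\<lambda>_. std_gauss))"
        by (rule L'(4)[OF f'm])
      also have "(\<integral>\<^sup>+g. f' (lmap I L' g) \<partial>PiM I (\<lambda>_. std_gauss))
         = (\<integral>\<^sup>+g. \<integral>\<^sup>+y. f (lmap (insert i I) L (g(i := y))) \<partial>std_gauss \<partial>PiM I (\<lambda>_. std_gauss))"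
        by (simp add: f'_def lmap_eq lmap_upd)
      also have "\<dots> = (\<integral>\<^sup>+g. f (lmap (insert i I) L g) \<partial>PiM (insert i I) (\<lambda>_. std_gauss))"
      proof (rule ps.product_nn_integral_insert[symmetric])
        have "lmap (insert i I) L \<in> PiM (insert i I) (\<lambda>_. std_gauss) \<rightarrow>\<^sub>M PiM (insert i I) (\<lambda>_. borel)"
          unfolding lmap_def by measurable
        thus "(\<lambda>g. f (lmap (insert i I) L g)) \<in> borel_measurable (PiM (insert i I) (\<lambda>_. std_gauss))"
          using f by (rule measurable_compose)
      qed (use False \<open>finite I\<close> in auto)
      finally have "(\<integral>\<^sup>+x. f x * ennreal (exp (- qform (insert i I) B x / 2)) \<partial>PiM (insert i I) (\<lambda>_. lborel))
        = (ennreal (sqrt (2 * pi) * (1 / sqrt \<beta>)) * ennreal (sqrt (2 * pi) ^ card I * (\<Prod>i\<in>I. L' i i))) *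
          (\<integral>\<^sup>+g. f (lmap (insert i I) L g) \<partial>PiM (insert i I) (\<lambda>_. std_gauss))"
        by (simp add: mult.assoc)
      also have "ennreal (sqrt (2 * pi) * (1 / sqrt \<beta>)) * ennreal (sqrt (2 * pi) ^ card I * (\<Prod>i\<in>I. L' i i))
         = ennreal (sqrt (2 * pi) ^ card (insert i I) * (\<Prod>j\<in>insert i I. L j j))"
        unfolding diag using False \<open>finite I\<close> \<beta> L'(1)
        by (subst ennreal_mult[symmetric])
          (auto intro!: mult_nonneg_nonneg prod_nonneg prod_pos mult_pos_pos less_imp_le simp: mult_ac)
      finally show "(\<integral>\<^sup>+x. f x * ennreal (exp (- qform (insert i I) B x / 2)) \<partial>PiM (insert i I) (\<lambda>_. lborel))
        = ennreal (sqrt (2 * pi) ^ card (insert i I) * (\<Prod>j\<in>insert i I. L j j)) *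
          (\<integral>\<^sup>+g. f (lmap (insert i I) L g) \<partial>PiM (insert i I) (\<lambda>_. std_gauss))" .
    qed
  qed
qed

section \<open>Covariance matrices\<close>

lemma quadratic_nonneg_imp_linear_zero:
  fixes a b :: real
  assumes "\<And>t. 2 * t * a + t\<^sup>2 * b \<ge> 0"
  shows "a = 0"
proof (rule ccontr)
  assume a: "a \<noteq> 0"
  \<comment> \<open>A step \<open>- a / d\<close> with \<open>d > b\<close> is short enough for the
    linear term to beat the quadratic one.\<close>
  define d where "d = \<bar>b\<bar> + 1"
  have d: "d > 0" "b < d" by (auto simp: d_def)
  have "2 * (- a / d) * a + (- a / d)\<^sup>2 * b = a\<^sup>2 / d\<^sup>2 * (b - 2 * d)"
    using d(1) by (simp add: power2_eq_square field_simps)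
  also have "\<dots> < 0" using a d by (intro mult_pos_neg divide_pos_pos) auto
  finally show False using assms[of "- a / d"] by simp
qed

text \<open>A zero of a positive semidefinite form is a minimum of it, so the gradient
  \<open>2 A u\<close> vanishes there; the derivative is taken along the unit vector
  \<open>i\<close>.\<close>

lemma qform_psd_kernel:
  fixes A :: "'i \<Rightarrow> 'i \<Rightarrow> real"
  assumes I: "finite I" and sym: "\<And>i j. i \<in> I \<Longrightarrow> j \<in> I \<Longrightarrow> A i j = A j i"
    and psd: "\<And>x. qform I A x \<ge> 0" and u: "qform I A u = 0" and i: "i \<in> I"
  shows "(\<Sum>j\<in>I. A i j * u j) = 0"
proof -
  define a where "a = (\<Sum>j\<in>I. A i j * u j)"
  have expand: "qform I A (\<lambda>k. u k + t * (if k = i then 1 else 0)) = 2 * t * a + t\<^sup>2 * A i i" for t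
  proof -
    define w :: "'i \<Rightarrow> real" where "w = (\<lambda>k. if k = i then 1 else 0)"
    have wu: "(\<Sum>k\<in>I. \<Sum>l\<in>I. w k * A k l * u l) = a"
    proof -
      have "(\<Sum>k\<in>I. \<Sum>l\<in>I. w k * A k l * u l) = (\<Sum>k\<in>I. if k = i then (\<Sum>l\<in>I. A k l * u l) else 0)"
        unfolding w_def by (intro sum.cong) auto
      thus ?thesis using I i by (simp add: a_def)
    qed
    have uw: "(\<Sum>k\<in>I. \<Sum>l\<in>I. u k * A k l * w l) = a"
    proof -
      have "(\<Sum>k\<in>I. \<Sum>l\<in>I. u k * A k l * w l) = (\<Sum>l\<in>I. \<Sum>k\<in>I. w l * A l k * u k)"
        by (subst sum.swap) (auto intro!: sum.cong simp: sym)
      thus ?thesis using wu by simp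
    qed
    have ww: "qform I A w = A i i"
      unfolding w_def by (rule qform_indicator[OF I i])
    have "qform I A (\<lambda>k. u k + t * w k) = qform I A u + t * (\<Sum>k\<in>I. \<Sum>l\<in>I. w k * A k l * u l)
       + t * (\<Sum>k\<in>I. \<Sum>l\<in>I. u k * A k l * w l) + t\<^sup>2 * qform I A w"
      unfolding qform_def sum_distrib_left sum.distrib[symmetric]
      by (intro sum.cong refl) (simp add: algebra_simps power2_eq_square)
    also have "\<dots> = 2 * t * a + t\<^sup>2 * A i i"
      unfolding wu uw ww u by simp
    finally show ?thesis unfolding w_def .
  qed
  have nn: "2 * t * a + t\<^sup>2 * A i i \<ge> 0" for t
    using psd expand by metis
  have "a = 0" using nn by (rule quadratic_nonneg_imp_linear_zero)
  thus ?thesis by (simp add: a_def)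
qed

text \<open>A maximiser on the unit sphere is a zero of the positive semidefinite form of
  \<open>lam I - A\<close>, hence lies in its kernel and is an eigenvector. One extreme eigenvector
  is all the spectral theory required: applied to \<Sigma> and to \<open>- \<Sigma>\<close> it
  bounds the form from both sides.\<close>

lemma qform_max_eigenvector:
  fixes A :: "nat \<Rightarrow> nat \<Rightarrow> real"
  assumes p: "p > 0" and sym: "\<And>i j. i < p \<Longrightarrow> j < p \<Longrightarrow> A i j = A j i"
  shows "\<exists>lam u. (\<exists>i<p. u i \<noteq> 0) \<and> (\<forall>i<p. (\<Sum>j<p. A i j * u j) = lam * u i) \<and>
    (\<forall>x. qform {..<p} A x \<le> lam * (\<Sum>i<p. (x i)\<^sup>2))"
proof -
  define K :: "(nat \<Rightarrow> real) set" where "K = {u. (\<forall>i\<ge>p. u i = 0) \<and> (\<Sum>i<p. (u i)\<^sup>2) = 1}"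
  \<comment> \<open>The sphere lives in the space of all real sequences with the product topology;
    coordinates from \<open>p\<close> on are pinned to 0, so that Tychonoff's theorem gives
    compactness.\<close>
  define K0 :: "(nat \<Rightarrow> real) set" where "K0 = PiE UNIV (\<lambda>i. if i < p then {-1..1} else {0})"
  have "compactin (product_topology (\<lambda>i. euclidean) UNIV) K0"
    unfolding K0_def by (subst compactin_PiE) (auto simp: compactin_euclidean_iff)
  hence K0: "compact K0"
    by (simp add: euclidean_product_topology compactin_euclidean_iff)
  have coord: "continuous_on UNIV (\<lambda>u::nat \<Rightarrow> real. u i)" for i
    by (rule continuous_on_product_coordinates)
  have "closed {u::nat \<Rightarrow> real. (\<Sum>i<p. (u i)\<^sup>2) = 1}"
    by (intro closed_Collect_eq continuous_intros coord)
  moreover have "K = K0 \<inter> {u. (\<Sum>i<p. (u i)\<^sup>2) = 1}"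
  proof -
    have "\<bar>u i\<bar> \<le> 1" if "(\<Sum>i<p. (u i)\<^sup>2) = 1" "i < p" for u :: "nat \<Rightarrow> real" and i
    proof -
      have "(u i)\<^sup>2 \<le> (\<Sum>i<p. (u i)\<^sup>2)"
        using that by (intro member_le_sum) auto
      thus ?thesis using that by (simp add: abs_square_le_1)
    qed
    hence "K \<subseteq> K0 \<inter> {u. (\<Sum>i<p. (u i)\<^sup>2) = 1}"
      by (auto simp: K_def K0_def PiE_iff abs_le_iff minus_le_iff)
    moreover have "u i = 0" if "u \<in> K0" "i \<ge> p" for u i
      using that PiE_mem[of u UNIV "\<lambda>i. if i < p then {-1..1} else {0}" i] by (auto simp: K0_def)
    ultimately show ?thesis by (auto simp: K_def)
  qed
  ultimately have K: "compact K" using K0 by (simp add: compact_Int_closed)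
  have "(\<lambda>i. if i = 0 then 1 else 0) \<in> K"
    using p by (auto simp: K_def if_distrib[of "\<lambda>x. x\<^sup>2"] sum.delta cong: if_cong)
  hence "K \<noteq> {}" by auto
  moreover have "continuous_on K (qform {..<p} A)"
    unfolding qform_def by (intro continuous_intros continuous_on_subset[OF coord]) auto
  ultimately obtain u where u: "u \<in> K" "\<And>x. x \<in> K \<Longrightarrow> qform {..<p} A x \<le> qform {..<p} A u"
    using continuous_attains_sup[OF K] by blast
  define lam where "lam = qform {..<p} A u"
  have le: "qform {..<p} A x \<le> lam * (\<Sum>i<p. (x i)\<^sup>2)" for x
  proof (cases "(\<Sum>i<p. (x i)\<^sup>2) = 0")
    case True
    hence "x i = 0" if "i < p" for i
      using that by (simp add: sum_nonneg_eq_0_iff)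
    hence "qform {..<p} A x = 0" by (simp add: qform_def)
    thus ?thesis using True by simp
  next
    case False
    define n where "n = sqrt (\<Sum>i<p. (x i)\<^sup>2)"
    have n: "n > 0" "n\<^sup>2 = (\<Sum>i<p. (x i)\<^sup>2)"
      using False sum_nonneg[of "{..<p}" "\<lambda>i. (x i)\<^sup>2"] by (auto simp: n_def order.not_eq_order_implies_strict)
    have "(\<lambda>i. if i < p then x i / n else 0) \<in> K"
      using n by (auto simp: K_def power_divide sum_divide_distrib[symmetric])
    from u(2)[OF this] have "qform {..<p} A (\<lambda>i. x i / n) \<le> lam"
      unfolding lam_def by (subst (asm) qform_cong[where y = "\<lambda>i. x i / n"]) auto
    moreover have "qform {..<p} A (\<lambda>i. x i / n) = qform {..<p} A x / n\<^sup>2"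
      by (simp add: qform_def sum_divide_distrib power2_eq_square)
    ultimately have "qform {..<p} A x / n\<^sup>2 \<le> lam" by simp
    hence "qform {..<p} A x \<le> lam * n\<^sup>2" using n(1) by (simp add: pos_divide_le_eq)
    thus ?thesis using n(2) by simp
  qed
  define A' where "A' = (\<lambda>i j. (if i = j then lam else 0) - A i j)"
  have qA': "qform {..<p} A' x = lam * (\<Sum>i<p. (x i)\<^sup>2) - qform {..<p} A x" for x
  proof -
    have "qform {..<p} A' x = (\<Sum>i<p. \<Sum>j<p. (if i = j then lam * (x i)\<^sup>2 else 0) - x i * A i j * x j)"
      unfolding qform_def A'_def by (intro sum.cong refl) (auto simp: algebra_simps power2_eq_square)
    thus ?thesis by (simp add: qform_def sum_subtractf sum_distrib_left)
  qed
  have "(\<Sum>j<p. A i j * u j) = lam * u i" if i: "i < p" for i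
  proof -
    have "(\<Sum>j<p. A' i j * u j) = 0"
    proof (rule qform_psd_kernel)
      show "qform {..<p} A' x \<ge> 0" for x using le qA' by simp
      show "qform {..<p} A' u = 0" using u(1) by (simp add: qA' K_def lam_def)
    qed (use sym i in \<open>auto simp: A'_def\<close>)
    moreover have "(\<Sum>j<p. A' i j * u j) = (\<Sum>j<p. (if i = j then lam * u i else 0) - A i j * u j)"
      unfolding A'_def by (intro sum.cong) (auto simp: algebra_simps)
    ultimately show ?thesis using i by (simp add: sum_subtractf)
  qed
  moreover have "\<exists>i<p. u i \<noteq> 0"
  proof (rule ccontr)
    assume "\<not> ?thesis"
    hence "(\<Sum>i<p. (u i)\<^sup>2) = 0" by simp
    thus False using u(1) by (simp add: K_def)
  qed
  ultimately show ?thesis using le by blast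
qed

section \<open>Inverse and triangular factor of a covariance matrix\<close>

abbreviation mfun :: "real mat \<Rightarrow> nat \<Rightarrow> nat \<Rightarrow> real" where
  "mfun A \<equiv> (\<lambda>i j. A $$ (i, j))"

lemma mult_mat_vec_eq_sum:
  assumes "A \<in> carrier_mat p p" "i < p"
  shows "(A *\<^sub>v vec p x) $ i = (\<Sum>j<p. A $$ (i, j) * x j)"
  using assms by (auto simp: scalar_prod_def lessThan_atLeast0)

lemma qform_eq_scalar_prod:
  assumes "A \<in> carrier_mat p p"
  shows "qform {..<p} (mfun A) x = vec p x \<bullet> (A *\<^sub>v vec p x)"
proof -
  have "vec p x \<bullet> (A *\<^sub>v vec p x) = (\<Sum>i<p. x i * (A *\<^sub>v vec p x) $ i)"
    using assms by (simp add: scalar_prod_def lessThan_atLeast0)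
  also have "\<dots> = (\<Sum>i<p. x i * (\<Sum>j<p. A $$ (i, j) * x j))"
    using assms by (intro sum.cong refl) (simp add: mult_mat_vec_eq_sum del: index_mult_mat_vec)
  finally show ?thesis by (simp add: qform_def sum_distrib_left mult.assoc)
qed

lemma covU_sym:
  assumes "covU p \<eta> \<Sigma>" "i < p" "j < p"
  shows "\<Sigma> $$ (i, j) = \<Sigma> $$ (j, i)"
  using assms unfolding covU_def by (metis carrier_matD index_transpose_mat(1))

lemma eigenvalueI_mfun:
  assumes "A \<in> carrier_mat p p" "\<exists>i<p. u i \<noteq> 0" "\<And>i. i < p \<Longrightarrow> (\<Sum>j<p. A $$ (i, j) * u j) = lam * u i"
  shows "eigenvalue A (lam :: real)"
proof -
  have "vec p u \<noteq> 0\<^sub>v p" using assms(2) by (auto simp: vec_eq_iff)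
  moreover have "A *\<^sub>v vec p u = lam \<cdot>\<^sub>v vec p u"
    using assms(1,3) by (intro eq_vecI) (simp_all add: mult_mat_vec_eq_sum del: index_mult_mat_vec)
  ultimately show ?thesis
    using assms(1) unfolding eigenvalue_def eigenvector_def by (intro exI[of _ "vec p u"]) auto
qed

text \<open>The extreme values of the form are eigenvalues, to which \<open>covU\<close> applies:
  the largest one is found from \<Sigma>, the smallest from \<open>- \<Sigma>\<close>.\<close>

lemma covU_qform_bounds:
  assumes cov: "covU p \<eta> \<Sigma>" and \<eta>: "\<eta> > 1"
  shows "qform {..<p} (mfun \<Sigma>) x \<le> \<eta> * (\<Sum>i<p. (x i)\<^sup>2)"
    and "(\<Sum>i<p. (x i)\<^sup>2) \<le> \<eta> * qform {..<p} (mfun \<Sigma>) x"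
proof -
  have "qform {..<p} (mfun \<Sigma>) x \<le> \<eta> * (\<Sum>i<p. (x i)\<^sup>2) \<and> (\<Sum>i<p. (x i)\<^sup>2) \<le> \<eta> * qform {..<p} (mfun \<Sigma>) x"
  proof (cases "p = 0")
    case False
    have C: "\<Sigma> \<in> carrier_mat p p" using cov by (simp add: covU_def)
    obtain lam u where 1: "\<exists>i<p. u i \<noteq> 0" "\<forall>i<p. (\<Sum>j<p. \<Sigma> $$ (i, j) * u j) = lam * u i"
      "\<forall>x. qform {..<p} (mfun \<Sigma>) x \<le> lam * (\<Sum>i<p. (x i)\<^sup>2)"
      using qform_max_eigenvector[of p "mfun \<Sigma>"] False covU_sym[OF cov] by auto
    have "eigenvalue \<Sigma> lam" using eigenvalueI_mfun[OF C 1(1)] 1(2) by simp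
    hence "lam \<le> \<eta>" using cov by (auto simp: covU_def)
    hence A: "qform {..<p} (mfun \<Sigma>) x \<le> \<eta> * (\<Sum>i<p. (x i)\<^sup>2)"
      using 1(3) by (meson order_trans mult_right_mono sum_nonneg zero_le_power2)
    obtain \<mu> v where 2: "\<exists>i<p. v i \<noteq> 0" "\<forall>i<p. (\<Sum>j<p. - \<Sigma> $$ (i, j) * v j) = \<mu> * v i"
      "\<forall>x. qform {..<p} (\<lambda>i j. - \<Sigma> $$ (i, j)) x \<le> \<mu> * (\<Sum>i<p. (x i)\<^sup>2)"
      using qform_max_eigenvector[of p "\<lambda>i j. - \<Sigma> $$ (i, j)"] False covU_sym[OF cov] by auto
    have "eigenvalue \<Sigma> (- \<mu>)"
      by (rule eigenvalueI_mfun[OF C 2(1)]) (use 2(2) in \<open>auto simp: sum_negf\<close>)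
    hence \<mu>: "1 / \<eta> \<le> - \<mu>" using cov by (auto simp: covU_def)
    have "- qform {..<p} (mfun \<Sigma>) x \<le> \<mu> * (\<Sum>i<p. (x i)\<^sup>2)"
      using 2(3)[rule_format, of x] by (simp add: qform_def sum_negf)
    moreover have "1 / \<eta> * (\<Sum>i<p. (x i)\<^sup>2) \<le> - \<mu> * (\<Sum>i<p. (x i)\<^sup>2)"
      using \<mu> by (intro mult_right_mono sum_nonneg) auto
    ultimately have "1 / \<eta> * (\<Sum>i<p. (x i)\<^sup>2) \<le> qform {..<p} (mfun \<Sigma>) x" by linarith
    with A show ?thesis using \<eta> by (simp add: field_simps)
  qed (simp add: qform_def)
  thus "qform {..<p} (mfun \<Sigma>) x \<le> \<eta> * (\<Sum>i<p. (x i)\<^sup>2)"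
    and "(\<Sum>i<p. (x i)\<^sup>2) \<le> \<eta> * qform {..<p} (mfun \<Sigma>) x" by auto
qed

text \<open>The Gaussian density is defined through the option-valued \<open>mat_inverse\<close>.
  Zero is below \<open>1 / \<eta>\<close> and so not an eigenvalue, which makes the option a
  \<open>Some\<close>. The inverse is positive because its form at \<open>x\<close> is the form of
  \<Sigma> at \<open>w = B x\<close>.\<close>

lemma covU_mat_inverse:
  assumes cov: "covU p \<eta> \<Sigma>" and \<eta>: "\<eta> > 1"
  obtains B where "mat_inverse \<Sigma> = Some B" "B \<in> carrier_mat p p" "\<Sigma> * B = 1\<^sub>m p" "B * \<Sigma> = 1\<^sub>m p"
    "\<And>i j. i < p \<Longrightarrow> j < p \<Longrightarrow> B $$ (i, j) = B $$ (j, i)"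
    "\<And>x. (\<exists>i\<in>{..<p}. x i \<noteq> 0) \<Longrightarrow> 0 < qform {..<p} (mfun B) x"
proof -
  have C: "\<Sigma> \<in> carrier_mat p p" and T: "transpose_mat \<Sigma> = \<Sigma>" using cov by (auto simp: covU_def)
  have "det \<Sigma> \<noteq> 0"
  proof
    assume "det \<Sigma> = 0"
    then obtain v where v: "v \<in> carrier_vec p" "v \<noteq> 0\<^sub>v p" "\<Sigma> *\<^sub>v v = 0\<^sub>v p"
      using det_0_iff_vec_prod_zero[OF C] by blast
    hence "eigenvalue \<Sigma> 0"
      using C unfolding eigenvalue_def eigenvector_def by (intro exI[of _ v]) auto
    hence "1 / \<eta> \<le> 0" using cov by (auto simp: covU_def)
    thus False using \<eta> by auto
  qed
  hence "\<Sigma> \<in> Units (ring_mat TYPE(real) p ())" by (rule det_non_zero_imp_unit[OF C])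
  then obtain B where B: "mat_inverse \<Sigma> = Some B"
    using mat_inverse(1)[OF C, where b = "()"] by (cases "mat_inverse \<Sigma>") auto
  from mat_inverse(2)[OF C B] have B': "\<Sigma> * B = 1\<^sub>m p" "B * \<Sigma> = 1\<^sub>m p" "B \<in> carrier_mat p p" by auto
  have BT: "transpose_mat B = B"
  proof -
    have "transpose_mat B = transpose_mat B * (\<Sigma> * B)" using B' by simp
    also have "\<dots> = (transpose_mat B * \<Sigma>) * B" using B' C by (simp add: assoc_mult_mat[of _ p p _ p _ p])
    also have "transpose_mat B * \<Sigma> = transpose_mat (\<Sigma> * B)"
      using B' C by (subst transpose_mult[OF C B'(3)]) (simp add: T)
    finally show ?thesis using B' by simp
  qed
  show ?thesis
  proof (rule that[OF B B'(3,1,2)])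
    show "B $$ (i, j) = B $$ (j, i)" if "i < p" "j < p" for i j
      using that BT B'(3) by (metis carrier_matD index_transpose_mat(1))
    show "0 < qform {..<p} (mfun B) x" if "\<exists>i\<in>{..<p}. x i \<noteq> 0" for x
    proof -
      define w where "w = B *\<^sub>v vec p x"
      have w: "w \<in> carrier_vec p" using B'(3) by (simp add: w_def)
      have \<Sigma>w: "\<Sigma> *\<^sub>v w = vec p x"
        using B' C unfolding w_def by (subst assoc_mult_mat_vec[symmetric]) auto
      have wvec: "vec p (\<lambda>i. w $ i) = w" using w by auto
      have "qform {..<p} (mfun B) x = vec p x \<bullet> w"
        using B'(3) by (simp add: qform_eq_scalar_prod w_def)
      also have "\<dots> = w \<bullet> (\<Sigma> *\<^sub>v w)"
        unfolding \<Sigma>w using w by (simp add: comm_scalar_prod[of _ p])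
      also have "\<dots> = qform {..<p} (mfun \<Sigma>) (\<lambda>i. w $ i)"
        by (simp add: qform_eq_scalar_prod[OF C] wvec)
      finally have q: "qform {..<p} (mfun B) x = qform {..<p} (mfun \<Sigma>) (\<lambda>i. w $ i)" .
      have "\<exists>i<p. w $ i \<noteq> 0"
      proof (rule ccontr)
        assume "\<not> ?thesis"
        hence "w = 0\<^sub>v p" using w by auto
        moreover have "\<Sigma> *\<^sub>v 0\<^sub>v p = 0\<^sub>v p" using C by (intro eq_vecI) simp_all
        ultimately have "vec p x = 0\<^sub>v p" using \<Sigma>w by simp
        thus False using that by (auto simp: vec_eq_iff)
      qed
      then obtain i where "i < p" "w $ i \<noteq> 0" by blast
      hence "0 < (\<Sum>i<p. (w $ i)\<^sup>2)" by (intro sum_pos2[of _ i]) auto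
      also have "\<dots> \<le> \<eta> * qform {..<p} (mfun \<Sigma>) (\<lambda>i. w $ i)"
        by (rule covU_qform_bounds[OF cov \<eta>])
      finally show ?thesis unfolding q using \<eta> by (simp add: zero_less_mult_iff)
    qed
  qed
qed

text \<open>The triangular factor of the inverse \<open>B\<close> satisfies
  \<open>M\<^sup>T B M = 1\<close>; inverting this identity gives
  \<open>M M\<^sup>T = \<Sigma>\<close>.\<close>

lemma covU_cholesky:
  fixes \<rho> :: "nat \<Rightarrow> nat"
  assumes cov: "covU p \<eta> \<Sigma>" and \<eta>: "\<eta> > 1" and B: "mat_inverse \<Sigma> = Some B"
  shows "\<exists>L :: nat \<Rightarrow> nat \<Rightarrow> real. (\<forall>i<p. L i i > 0) \<and> (\<forall>i<p. \<forall>j<p. \<rho> i < \<rho> j \<longrightarrow> L i j = 0) \<and>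
    mat p p (\<lambda>(i, j). L i j) * transpose_mat (mat p p (\<lambda>(i, j). L i j)) = \<Sigma> \<and>
    (\<forall>f \<in> borel_measurable (PiM {..<p} (\<lambda>_. borel)).
        (\<integral>\<^sup>+x. f x * ennreal (exp (- qform {..<p} (mfun B) x / 2)) \<partial>PiM {..<p} (\<lambda>_. lborel))
         = ennreal (sqrt (2 * pi) ^ p * (\<Prod>i<p. L i i)) *
           (\<integral>\<^sup>+g. f (lmap {..<p} L g) \<partial>PiM {..<p} (\<lambda>_. std_gauss)))"
proof -
  have C: "\<Sigma> \<in> carrier_mat p p" using cov by (auto simp: covU_def)
  obtain B0 where B0: "mat_inverse \<Sigma> = Some B0" "B0 \<in> carrier_mat p p" "B0 * \<Sigma> = 1\<^sub>m p"
    "\<And>i j. i < p \<Longrightarrow> j < p \<Longrightarrow> B0 $$ (i, j) = B0 $$ (j, i)"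
    "\<And>x. (\<exists>i\<in>{..<p}. x i \<noteq> 0) \<Longrightarrow> 0 < qform {..<p} (mfun B0) x"
    by (rule covU_mat_inverse[OF cov \<eta>], rule that)
  have "B0 = B" using B0(1) B by simp
  note B' = B0(2-5)[unfolded this]
  obtain L where L: "\<forall>i\<in>{..<p}. L i i > 0" "\<forall>i\<in>{..<p}. \<forall>j\<in>{..<p}. \<rho> i < \<rho> j \<longrightarrow> L i j = 0"
     "\<forall>g. qform {..<p} (mfun B) (lmap {..<p} L g) = (\<Sum>i<p. (g i)\<^sup>2)"
     "\<forall>f \<in> borel_measurable (PiM {..<p} (\<lambda>_. borel)).
        (\<integral>\<^sup>+x. f x * ennreal (exp (- qform {..<p} (mfun B) x / 2)) \<partial>PiM {..<p} (\<lambda>_. lborel))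
         = ennreal (sqrt (2 * pi) ^ card {..<p} * (\<Prod>i<p. L i i)) *
           (\<integral>\<^sup>+g. f (lmap {..<p} L g) \<partial>PiM {..<p} (\<lambda>_. std_gauss))"
    using gaussian_cholesky[of "{..<p}" "mfun B" \<rho>] B' by auto
  define M where "M = mat p p (\<lambda>(i, j). L i j)"
  have M: "M \<in> carrier_mat p p" by (simp add: M_def)
  have MT: "transpose_mat M \<in> carrier_mat p p" by (simp add: M_def)
  define A where "A = transpose_mat M * (B * M)"
  have A: "A \<in> carrier_mat p p" using M B'(1) by (simp add: A_def)
  have AT: "transpose_mat A = A"
  proof -
    have BT: "transpose_mat B = B" using B'(1,3) by (intro eq_matI) auto
    have "transpose_mat A = transpose_mat (B * M) * M"
      unfolding A_def using M B'(1) by (subst transpose_mult[OF MT]) auto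
    also have "transpose_mat (B * M) = transpose_mat M * B"
      using M B'(1) by (subst transpose_mult[OF B'(1) M]) (simp add: BT)
    finally show ?thesis unfolding A_def using M B'(1) by (simp add: assoc_mult_mat[of _ p p _ p _ p])
  qed
  have qA: "qform {..<p} (mfun A) g = (\<Sum>i<p. (g i)\<^sup>2)" for g
  proof -
    have Mg: "M *\<^sub>v vec p g = vec p (lmap {..<p} L g)"
      by (intro eq_vecI) (auto simp: M_def lmap_def scalar_prod_def lessThan_atLeast0)
    have "qform {..<p} (mfun A) g = vec p g \<bullet> (transpose_mat M *\<^sub>v (B *\<^sub>v (M *\<^sub>v vec p g)))"
      unfolding qform_eq_scalar_prod[OF A] unfolding A_def using M MT B'(1)
      by (simp add: assoc_mult_mat_vec[of _ p p _ p])
    also have "\<dots> = (M *\<^sub>v vec p g) \<bullet> (B *\<^sub>v (M *\<^sub>v vec p g))"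
      using M B'(1) by (subst transpose_vec_mult_scalar[where nr = p and nc = p, symmetric]) auto
    also have "\<dots> = qform {..<p} (mfun B) (lmap {..<p} L g)"
      unfolding Mg by (simp add: qform_eq_scalar_prod[OF B'(1)])
    finally show ?thesis using L(3) by simp
  qed
  have A1: "A = 1\<^sub>m p"
  proof (intro eq_matI)
    fix i j assume ij: "i < dim_row (1\<^sub>m p :: real mat)" "j < dim_col (1\<^sub>m p :: real mat)"
    \<comment> \<open>The form of \<open>D\<close> vanishes identically, so every vector is in its
      kernel; the unit vector \<open>j\<close> reads off the entry \<open>D i j\<close>.\<close>
    define D where "D = (\<lambda>i j. A $$ (i, j) - (if i = j then 1 else 0 :: real))"
    have qD: "qform {..<p} D x = 0" for x
    proof -
      have "qform {..<p} D x = (\<Sum>i<p. \<Sum>j<p. x i * A $$ (i, j) * x j - (if i = j then (x i)\<^sup>2 else 0))"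
        unfolding qform_def D_def by (intro sum.cong refl) (auto simp: algebra_simps power2_eq_square)
      also have "\<dots> = qform {..<p} (mfun A) x - (\<Sum>i<p. (x i)\<^sup>2)"
        by (simp add: qform_def sum_subtractf)
      finally show ?thesis by (simp add: qA)
    qed
    have symA: "A $$ (i, j) = A $$ (j, i)" if "i < p" "j < p" for i j
      using that AT A by (metis carrier_matD index_transpose_mat(1))
    have "(\<Sum>k<p. D i k * (if k = j then 1 else 0)) = 0"
    proof (rule qform_psd_kernel)
      show "D k l = D l k" if "k \<in> {..<p}" "l \<in> {..<p}" for k l
        using that symA[of k l] by (simp add: D_def)
    qed (use ij qD in auto)
    moreover have "(\<Sum>k<p. D i k * (if k = j then 1 else 0)) = (\<Sum>k<p. if k = j then D i j else 0)"
      by (intro sum.cong) auto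
    ultimately have "D i j = 0" using ij by simp
    thus "A $$ (i, j) = 1\<^sub>m p $$ (i, j)" using ij by (auto simp: D_def)
  qed (simp_all add: carrier_matD[OF A])
  have MTB: "transpose_mat M * B \<in> carrier_mat p p" using MT B'(1) by auto
  have "(transpose_mat M * B) * M = 1\<^sub>m p"
    using assoc_mult_mat[OF MT B'(1) M] A1 unfolding A_def by (rule trans)
  hence "M * (transpose_mat M * B) = 1\<^sub>m p"
    by (rule mat_mult_left_right_inverse[OF MTB M])
  hence *: "(M * transpose_mat M) * B = 1\<^sub>m p"
    using assoc_mult_mat[OF M MT B'(1)] by (rule trans[rotated])
  have MM: "M * transpose_mat M \<in> carrier_mat p p" using M by auto
  have "M * transpose_mat M = (M * transpose_mat M) * (B * \<Sigma>)"
    unfolding B'(2) by (rule right_mult_one_mat[OF MM, symmetric])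
  also have "\<dots> = (M * transpose_mat M * B) * \<Sigma>"
    by (rule assoc_mult_mat[OF MM B'(1) C, symmetric])
  also have "\<dots> = \<Sigma>"
    unfolding * by (rule left_mult_one_mat[OF C])
  finally have M\<Sigma>: "M * transpose_mat M = \<Sigma>" .
  show ?thesis
  proof (intro exI[of _ L] conjI)
    show "mat p p (\<lambda>(i, j). L i j) * transpose_mat (mat p p (\<lambda>(i, j). L i j)) = \<Sigma>"
      using M\<Sigma> by (simp only: M_def)
  qed (use L in auto)
qed

section \<open>The law of the data\<close>

text \<open>The ranking \<rho> fixes which Gaussians a coordinate may depend on; \<open>L'\<close>
  inverts the map, so that events can later be carried to the sample space. The difficulty is the
  normalisation: \<open>gauss_density\<close> contains \<open>det \<Sigma>\<close>, but for a
  general ranking the factor is not triangular in the order of the indices.\<close>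

lemma gauss_vec_eq_distr:
  fixes \<rho> :: "nat \<Rightarrow> nat"
  assumes cov: "covU p \<eta> \<Sigma>" and \<eta>: "\<eta> > 1"
  obtains L L' :: "nat \<Rightarrow> nat \<Rightarrow> real" where
    "\<And>i j. i < p \<Longrightarrow> j < p \<Longrightarrow> \<rho> i < \<rho> j \<Longrightarrow> L i j = 0"
    "\<And>u. qform {..<p} (mfun \<Sigma>) u = (\<Sum>j<p. (\<Sum>i<p. L i j * u i)\<^sup>2)"
    "gauss_vec p \<Sigma> = distr (PiM {..<p} (\<lambda>_. std_gauss)) (PiM {..<p} (\<lambda>_. borel)) (lmap {..<p} L)"
    "\<And>x. lmap {..<p} L (lmap {..<p} L' x) = restrict x {..<p}"
    "\<And>x. lmap {..<p} L' (lmap {..<p} L x) = restrict x {..<p}"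
proof -
  obtain B where B: "mat_inverse \<Sigma> = Some B" and BC: "B \<in> carrier_mat p p" and \<Sigma>B: "\<Sigma> * B = 1\<^sub>m p"
    by (rule covU_mat_inverse[OF cov \<eta>])
  define q where "q = (\<lambda>x. qform {..<p} (mfun B) x)"
  define Ch where "Ch = (\<lambda>\<rho> :: nat \<Rightarrow> nat. \<lambda>L :: nat \<Rightarrow> nat \<Rightarrow> real. (\<forall>i<p. L i i > 0) \<and>
    (\<forall>i<p. \<forall>j<p. \<rho> i < \<rho> j \<longrightarrow> L i j = 0) \<and>
    mat p p (\<lambda>(i, j). L i j) * transpose_mat (mat p p (\<lambda>(i, j). L i j)) = \<Sigma> \<and>
    (\<forall>f \<in> borel_measurable (PiM {..<p} (\<lambda>_. borel)).
        (\<integral>\<^sup>+x. f x * ennreal (exp (- q x / 2)) \<partial>PiM {..<p} (\<lambda>_. lborel))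
         = ennreal (sqrt (2 * pi) ^ p * (\<Prod>i<p. L i i)) *
           (\<integral>\<^sup>+g. f (lmap {..<p} L g) \<partial>PiM {..<p} (\<lambda>_. std_gauss))))"
  have ex: "\<exists>L. Ch \<rho>' L" for \<rho>'
    unfolding Ch_def q_def by (rule covU_cholesky[OF cov \<eta> B])
  \<comment> \<open>A second factor, for the natural order, is lower triangular, so its determinant
    is the product of its diagonal.\<close>
  obtain L0 where "Ch (\<lambda>i. i) L0" using ex by blast
  hence L0: "\<forall>i<p. L0 i i > 0" "\<forall>i<p. \<forall>j<p. i < j \<longrightarrow> L0 i j = 0"
    "mat p p (\<lambda>(i, j). L0 i j) * transpose_mat (mat p p (\<lambda>(i, j). L0 i j)) = \<Sigma>"
    "\<forall>f \<in> borel_measurable (PiM {..<p} (\<lambda>_. borel)).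
        (\<integral>\<^sup>+x. f x * ennreal (exp (- q x / 2)) \<partial>PiM {..<p} (\<lambda>_. lborel))
         = ennreal (sqrt (2 * pi) ^ p * (\<Prod>i<p. L0 i i)) *
           (\<integral>\<^sup>+g. f (lmap {..<p} L0 g) \<partial>PiM {..<p} (\<lambda>_. std_gauss))"
    unfolding Ch_def by - (elim conjE, assumption)+
  obtain L where "Ch \<rho> L" using ex by blast
  hence L: "\<forall>i<p. L i i > 0" "\<forall>i<p. \<forall>j<p. \<rho> i < \<rho> j \<longrightarrow> L i j = 0"
    "mat p p (\<lambda>(i, j). L i j) * transpose_mat (mat p p (\<lambda>(i, j). L i j)) = \<Sigma>"
    "\<forall>f \<in> borel_measurable (PiM {..<p} (\<lambda>_. borel)).
        (\<integral>\<^sup>+x. f x * ennreal (exp (- q x / 2)) \<partial>PiM {..<p} (\<lambda>_. lborel))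
         = ennreal (sqrt (2 * pi) ^ p * (\<Prod>i<p. L i i)) *
           (\<integral>\<^sup>+g. f (lmap {..<p} L g) \<partial>PiM {..<p} (\<lambda>_. std_gauss))"
    unfolding Ch_def by - (elim conjE, assumption)+
  interpret P: prob_space "PiM {..<p} (\<lambda>_::nat. std_gauss)"
    by (rule prob_space_PiM) (rule prob_space_std_gauss)
  define c where "c = sqrt (2 * pi) ^ p * (\<Prod>i<p. L i i)"
  define c0 where "c0 = sqrt (2 * pi) ^ p * (\<Prod>i<p. L0 i i)"
  have c: "c > 0" unfolding c_def using L(1) by (intro mult_pos_pos prod_pos zero_less_power) auto
  have c0: "c0 > 0" unfolding c0_def using L0(1) by (intro mult_pos_pos prod_pos zero_less_power) auto
  \<comment> \<open>With \<open>f = 1\<close> both factorizations evaluate the same Gaussian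
    integral, so the two diagonal products coincide.\<close>
  have "ennreal c = ennreal c0"
    using L(4)[THEN bspec, of "\<lambda>_. 1"] L0(4)[THEN bspec, of "\<lambda>_. 1"] P.emeasure_space_1 by (simp add: c_def c0_def)
  hence cc0: "c = c0" using c c0 by (subst (asm) ennreal_inj) auto
  have "det \<Sigma> = (\<Prod>i<p. L0 i i)\<^sup>2"
  proof -
    define M where "M = mat p p (\<lambda>(i, j). L0 i j)"
    have M: "M \<in> carrier_mat p p" "transpose_mat M \<in> carrier_mat p p" by (auto simp: M_def)
    have "det M = prod_list (diag_mat M)"
      by (rule det_lower_triangular[OF _ M(1)]) (use L0(2) in \<open>auto simp: M_def\<close>)
    also have "\<dots> = (\<Prod>i<p. L0 i i)"
      unfolding prod_list_diag_prod by (auto simp: M_def lessThan_atLeast0 intro!: prod.cong)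
    finally have "det M = (\<Prod>i<p. L0 i i)" .
    moreover have "det \<Sigma> = det M * det M"
      using det_mult[OF M] det_transpose[OF M(1)] L0(3) by (simp add: M_def)
    ultimately show ?thesis by (simp add: power2_eq_square)
  qed
  moreover have "(\<Prod>i<p. L0 i i) \<ge> 0" using L0(1) by (intro prod_nonneg) (auto intro: less_imp_le)
  ultimately have "sqrt (det \<Sigma>) = (\<Prod>i<p. L0 i i)"
    by (simp only: real_sqrt_abs abs_of_nonneg)
  hence norm: "sqrt ((2 * pi) ^ p * det \<Sigma>) = c"
    unfolding cc0 c0_def by (simp only: real_sqrt_mult[of "_ ^ p"] real_sqrt_power)
  have dens: "gauss_density p \<Sigma> x = exp (- q x / 2) / c" for x
    unfolding gauss_density_def norm B q_def qform_def by simp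
  have ennreal_dens: "ennreal (gauss_density p \<Sigma> x) = ennreal (1 / c) * ennreal (exp (- q x / 2))" for x
    using c unfolding dens by (subst ennreal_mult[symmetric]) auto
  have sets_eq: "sets (PiM {..<p} (\<lambda>_::nat. lborel :: real measure)) = sets (PiM {..<p} (\<lambda>_. borel))"
    by (intro sets_PiM_cong) auto
  have qm: "q \<in> borel_measurable (PiM {..<p} (\<lambda>_. lborel))"
    unfolding q_def qform_def by measurable
  have lm: "lmap {..<p} L \<in> PiM {..<p} (\<lambda>_. std_gauss) \<rightarrow>\<^sub>M PiM {..<p} (\<lambda>_. borel)"
    unfolding lmap_def by measurable
  have "gauss_vec p \<Sigma> = distr (PiM {..<p} (\<lambda>_. std_gauss)) (PiM {..<p} (\<lambda>_. borel)) (lmap {..<p} L)"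
  proof (rule measure_eqI)
    show "sets (gauss_vec p \<Sigma>) = sets (distr (PiM {..<p} (\<lambda>_. std_gauss)) (PiM {..<p} (\<lambda>_. borel)) (lmap {..<p} L))"
      by (simp add: gauss_vec_def sets_eq)
    fix A assume "A \<in> sets (gauss_vec p \<Sigma>)"
    hence A: "A \<in> sets (PiM {..<p} (\<lambda>_::nat. lborel :: real measure))" by (simp add: gauss_vec_def)
    hence A': "A \<in> sets (PiM {..<p} (\<lambda>_::nat. borel :: real measure))" by (simp add: sets_eq)
    have "emeasure (gauss_vec p \<Sigma>) A = (\<integral>\<^sup>+x. ennreal (gauss_density p \<Sigma> x) * indicator A x \<partial>PiM {..<p} (\<lambda>_. lborel))"
      unfolding gauss_vec_def using A qm by (subst emeasure_density) (auto simp: dens)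
    also have "\<dots> = (\<integral>\<^sup>+x. ennreal (1 / c) * (indicator A x * ennreal (exp (- q x / 2))) \<partial>PiM {..<p} (\<lambda>_. lborel))"
      by (intro nn_integral_cong) (simp add: ennreal_dens mult_ac)
    also have "\<dots> = ennreal (1 / c) * (\<integral>\<^sup>+x. indicator A x * ennreal (exp (- q x / 2)) \<partial>PiM {..<p} (\<lambda>_. lborel))"
      using A qm by (intro nn_integral_cmult) auto
    also have "\<dots> = ennreal (1 / c) * (ennreal c * (\<integral>\<^sup>+g. indicator A (lmap {..<p} L g) \<partial>PiM {..<p} (\<lambda>_. std_gauss)))"
      using L(4)[THEN bspec, of "indicator A"] A' by (simp add: c_def)
    also have "\<dots> = (\<integral>\<^sup>+g. indicator A (lmap {..<p} L g) \<partial>PiM {..<p} (\<lambda>_. std_gauss))"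
      using c by (simp add: mult.assoc[symmetric] ennreal_mult'[symmetric])
    also have "\<dots> = (\<integral>\<^sup>+x. indicator A x \<partial>distr (PiM {..<p} (\<lambda>_. std_gauss)) (PiM {..<p} (\<lambda>_. borel)) (lmap {..<p} L))"
      using A' by (subst nn_integral_distr[OF lm]) auto
    finally show "emeasure (gauss_vec p \<Sigma>) A
       = emeasure (distr (PiM {..<p} (\<lambda>_. std_gauss)) (PiM {..<p} (\<lambda>_. borel)) (lmap {..<p} L)) A"
      using A' by simp
  qed
  moreover have "qform {..<p} (mfun \<Sigma>) u = (\<Sum>j<p. (\<Sum>i<p. L i j * u i)\<^sup>2)" for u
  proof -
    have \<Sigma>: "\<Sigma> $$ (i, j) = (\<Sum>k<p. L i k * L j k)" if "i < p" "j < p" for i j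
      unfolding L(3)[symmetric] using that by (simp add: scalar_prod_def lessThan_atLeast0)
    have "qform {..<p} (mfun \<Sigma>) u = (\<Sum>i<p. \<Sum>j<p. \<Sum>k<p. (L i k * u i) * (L j k * u j))"
      unfolding qform_def by (intro sum.cong refl) (simp add: \<Sigma> sum_distrib_left sum_distrib_right mult_ac)
    also have "\<dots> = (\<Sum>i<p. \<Sum>k<p. \<Sum>j<p. (L i k * u i) * (L j k * u j))"
      by (intro sum.cong refl sum.swap)
    also have "\<dots> = (\<Sum>k<p. \<Sum>i<p. \<Sum>j<p. (L i k * u i) * (L j k * u j))"
      by (rule sum.swap)
    also have "\<dots> = (\<Sum>k<p. (\<Sum>i<p. L i k * u i)\<^sup>2)"
      by (simp add: power2_eq_square sum_product)
    finally show ?thesis .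
  qed
  moreover have "L i j = 0" if "i < p" "j < p" "\<rho> i < \<rho> j" for i j using L(2) that by blast
  moreover obtain L' where "\<And>x. lmap {..<p} L (lmap {..<p} L' x) = restrict x {..<p}"
    "\<And>x. lmap {..<p} L' (lmap {..<p} L x) = restrict x {..<p}"
  proof -
    define M where "M = mat p p (\<lambda>(i, j). L i j)"
    have M: "M \<in> carrier_mat p p" and MT: "transpose_mat M \<in> carrier_mat p p" by (auto simp: M_def)
    \<comment> \<open>Since \<open>M M\<^sup>T = \<Sigma>\<close> and \<open>\<Sigma> B = 1\<close>,
      this is the inverse of \<open>M\<close>.\<close>
    define M' where "M' = transpose_mat M * B"
    have M': "M' \<in> carrier_mat p p" using MT BC by (simp add: M'_def)
    have 1: "M * M' = 1\<^sub>m p"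
      unfolding M'_def using assoc_mult_mat[OF M MT BC] L(3) \<Sigma>B by (simp add: M_def)
    have 2: "M' * M = 1\<^sub>m p" by (rule mat_mult_left_right_inverse[OF M M' 1])
    have lm: "vec p (lmap {..<p} (mfun A) x) = A *\<^sub>v vec p x" if "A \<in> carrier_mat p p" for A x
      using that by (intro eq_vecI) (auto simp: lmap_def scalar_prod_def lessThan_atLeast0)
    have inv: "lmap {..<p} (mfun A) (lmap {..<p} (mfun A') x) = restrict x {..<p}"
      if A: "A \<in> carrier_mat p p" "A' \<in> carrier_mat p p" "A * A' = 1\<^sub>m p" for A A' x
    proof -
      have "vec p (lmap {..<p} (mfun A) (lmap {..<p} (mfun A') x)) = (A * A') *\<^sub>v vec p x"
        unfolding lm[OF A(1)] lm[OF A(2)] by (rule assoc_mult_mat_vec[OF A(1,2), symmetric]) simp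
      also have "\<dots> = vec p x" unfolding A(3) by simp
      finally have "lmap {..<p} (mfun A) (lmap {..<p} (mfun A') x) i = x i" if "i < p" for i
        using that by (metis index_vec)
      thus ?thesis by (auto simp: lmap_def restrict_def)
    qed
    have LM: "lmap {..<p} (mfun M) x = lmap {..<p} L x" for x
      unfolding lmap_def by (intro restrict_ext sum.cong) (auto simp: M_def)
    show ?thesis
      by (rule that[of "mfun M'"]) (use inv[OF M M' 1] inv[OF M' M 2] in \<open>simp_all add: LM\<close>)
  qed
  ultimately show ?thesis by (intro that[of L L'])
qed

section \<open>Gaussian arrays as products over rows and columns\<close>

lemma PiM_curry:
  fixes A :: "'i set" and B :: "'j set"
  assumes N: "prob_space N" and A: "finite A" and B: "finite B"
  shows "distr (PiM (A \<times> B) (\<lambda>_. N)) (PiM A (\<lambda>_. PiM B (\<lambda>_. N))) (\<lambda>\<omega>. \<lambda>a\<in>A. \<lambda>b\<in>B. \<omega> (a, b))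
     = PiM A (\<lambda>_. PiM B (\<lambda>_. N))"
proof -
  let ?Q = "PiM A (\<lambda>_. PiM B (\<lambda>_. N))" and ?P = "PiM (A \<times> B) (\<lambda>_. N)"
  let ?U = "\<lambda>G. \<lambda>(a, b)\<in>A \<times> B. G a b" and ?C = "\<lambda>\<omega>. \<lambda>a\<in>A. \<lambda>b\<in>B. \<omega> (a, b)"
  interpret N: product_sigma_finite "\<lambda>_::'i \<times> 'j. N"
    using N by (simp add: product_sigma_finite_def prob_space_imp_sigma_finite)
  interpret N': product_sigma_finite "\<lambda>_::'j. N"
    using N by (simp add: product_sigma_finite_def prob_space_imp_sigma_finite)
  interpret R: product_sigma_finite "\<lambda>_::'i. PiM B (\<lambda>_. N)"
    using N by (simp add: product_sigma_finite_def prob_space_imp_sigma_finite prob_space_PiM)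
  have U: "?U \<in> ?Q \<rightarrow>\<^sub>M ?P"
    unfolding split_def by (rule measurable_restrict) (auto intro!: measurable_compose[OF measurable_component_singleton])
  have C: "?C \<in> ?P \<rightarrow>\<^sub>M ?Q"
    by (intro measurable_restrict) auto
  \<comment> \<open>Only uncurrying is checked on boxes, where the preimage of a box is a box of
    boxes; since \<open>?C\<close> undoes \<open>?U\<close>, the claim for \<open>?C\<close> follows
    by composition.\<close>
  have P: "distr ?Q ?P ?U = ?P"
  proof (rule N.PiM_eqI)
    fix E assume E: "\<And>i. i \<in> A \<times> B \<Longrightarrow> E i \<in> sets N"
    have sp: "E i \<subseteq> space N" if "i \<in> A \<times> B" for i
      using E[OF that] by (rule sets.sets_into_space)
    have "?U -` (Pi\<^sub>E (A \<times> B) E) \<inter> space ?Q = Pi\<^sub>E A (\<lambda>a. Pi\<^sub>E B (\<lambda>b. E (a, b)))"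
    proof (intro equalityI subsetI)
      fix G assume "G \<in> ?U -` (Pi\<^sub>E (A \<times> B) E) \<inter> space ?Q"
      thus "G \<in> Pi\<^sub>E A (\<lambda>a. Pi\<^sub>E B (\<lambda>b. E (a, b)))"
        by (fastforce simp: space_PiM PiE_iff extensional_def)
    next
      fix G assume "G \<in> Pi\<^sub>E A (\<lambda>a. Pi\<^sub>E B (\<lambda>b. E (a, b)))"
      thus "G \<in> ?U -` (Pi\<^sub>E (A \<times> B) E) \<inter> space ?Q"
        using sp by (fastforce simp: space_PiM PiE_iff)
    qed
    hence "emeasure (distr ?Q ?P ?U) (Pi\<^sub>E (A \<times> B) E) = emeasure ?Q (Pi\<^sub>E A (\<lambda>a. Pi\<^sub>E B (\<lambda>b. E (a, b))))"
      using U E A B by (subst emeasure_distr) (auto intro!: sets_PiM_I_finite)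
    also have "\<dots> = (\<Prod>a\<in>A. \<Prod>b\<in>B. emeasure N (E (a, b)))"
    proof (subst R.emeasure_PiM)
      show "(\<Prod>a\<in>A. emeasure (PiM B (\<lambda>_. N)) (Pi\<^sub>E B (\<lambda>b. E (a, b)))) = (\<Prod>a\<in>A. \<Prod>b\<in>B. emeasure N (E (a, b)))"
        using B E by (intro prod.cong refl N'.emeasure_PiM) auto
    qed (use A B E in \<open>auto intro!: sets_PiM_I_finite\<close>)
    also have "\<dots> = (\<Prod>i\<in>A \<times> B. emeasure N (E i))"
      by (simp add: prod.cartesian_product split_def)
    finally show "emeasure (distr ?Q ?P ?U) (Pi\<^sub>E (A \<times> B) E) = (\<Prod>i\<in>A \<times> B. emeasure N (E i))" .
  qed (use A B in auto)
  have "distr ?P ?Q ?C = distr (distr ?Q ?P ?U) ?Q ?C" unfolding P ..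
  also have "\<dots> = distr ?Q ?Q (?C \<circ> ?U)" by (rule distr_distr[OF C U])
  also have "\<dots> = distr ?Q ?Q (\<lambda>x. x)"
  proof (rule distr_cong[OF refl refl])
    fix G assume "G \<in> space ?Q"
    thus "(?C \<circ> ?U) G = G"
      by (intro ext) (auto simp: space_PiM PiE_iff extensional_def restrict_def)
  qed
  finally show ?thesis by (simp add: distr_id)
qed

text \<open>Column \<open>p\<close> of the array is the noise. Treating it as one more standard
  Gaussian coordinate makes the regression residual, which mixes design and noise, a linear form in
  the columns of one array.\<close>

lemma PiM_split_last:
  fixes m p :: nat
  assumes N: "prob_space N"
  shows "distr (PiM ({..<m} \<times> {..<Suc p}) (\<lambda>_. N))
      (PiM {..<m} (\<lambda>_. PiM {..<p} (\<lambda>_. N)) \<Otimes>\<^sub>M PiM {..<m} (\<lambda>_. N))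
      (\<lambda>\<omega>. (\<lambda>a\<in>{..<m}. \<lambda>b\<in>{..<p}. \<omega> (a, b), \<lambda>a\<in>{..<m}. \<omega> (a, p)))
     = PiM {..<m} (\<lambda>_. PiM {..<p} (\<lambda>_. N)) \<Otimes>\<^sub>M PiM {..<m} (\<lambda>_. N)"
proof -
  let ?Q1 = "PiM {..<m} (\<lambda>_. PiM {..<p} (\<lambda>_. N))" and ?Q2 = "PiM {..<m} (\<lambda>_. N)"
  let ?Q = "?Q1 \<Otimes>\<^sub>M ?Q2" and ?P = "PiM ({..<m} \<times> {..<Suc p}) (\<lambda>_. N)"
  let ?U = "\<lambda>z. \<lambda>i\<in>{..<m} \<times> {..<Suc p}. if snd i < p then fst z (fst i) (snd i) else snd z (fst i)"
  let ?C = "\<lambda>\<omega>. (\<lambda>a\<in>{..<m}. \<lambda>b\<in>{..<p}. \<omega> (a, b), \<lambda>a\<in>{..<m}. \<omega> (a, p))"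
  interpret N: product_sigma_finite "\<lambda>_::nat \<times> nat. N"
    using N by (simp add: product_sigma_finite_def prob_space_imp_sigma_finite)
  interpret N': product_sigma_finite "\<lambda>_::nat. N"
    using N by (simp add: product_sigma_finite_def prob_space_imp_sigma_finite)
  interpret R: product_sigma_finite "\<lambda>_::nat. PiM {..<p} (\<lambda>_. N)"
    using N by (simp add: product_sigma_finite_def prob_space_imp_sigma_finite prob_space_PiM)
  interpret Q2: prob_space ?Q2 by (rule prob_space_PiM) (rule N)
  have U: "?U \<in> ?Q \<rightarrow>\<^sub>M ?P"
  proof (rule measurable_restrict)
    fix i :: "nat \<times> nat" assume i: "i \<in> {..<m} \<times> {..<Suc p}"
    show "(\<lambda>z. if snd i < p then fst z (fst i) (snd i) else snd z (fst i)) \<in> ?Q \<rightarrow>\<^sub>M N"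
    proof (cases "snd i < p")
      case True
      have 1: "(\<lambda>G. G (fst i)) \<in> ?Q1 \<rightarrow>\<^sub>M PiM {..<p} (\<lambda>_. N)"
        using i by (intro measurable_component_singleton) auto
      have 2: "(\<lambda>g. g (snd i)) \<in> PiM {..<p} (\<lambda>_. N) \<rightarrow>\<^sub>M N"
        using True by (intro measurable_component_singleton) auto
      show ?thesis using True measurable_compose[OF measurable_fst measurable_compose[OF 1 2]] by simp
    next
      case False
      thus ?thesis using i by auto
    qed
  qed
  have C: "?C \<in> ?P \<rightarrow>\<^sub>M ?Q"
    by (intro measurable_Pair measurable_restrict) auto
  have P: "distr ?Q ?P ?U = ?P"
  proof (rule N.PiM_eqI)
    fix E assume E: "\<And>i. i \<in> {..<m} \<times> {..<Suc p} \<Longrightarrow> E i \<in> sets N"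
    have sp: "E i \<subseteq> space N" if "i \<in> {..<m} \<times> {..<Suc p}" for i
      using E[OF that] by (rule sets.sets_into_space)
    let ?E1 = "Pi\<^sub>E {..<m} (\<lambda>a. Pi\<^sub>E {..<p} (\<lambda>b. E (a, b)))" and ?E2 = "Pi\<^sub>E {..<m} (\<lambda>a. E (a, p))"
    have "?U -` (Pi\<^sub>E ({..<m} \<times> {..<Suc p}) E) \<inter> space ?Q = ?E1 \<times> ?E2"
    proof (intro equalityI subsetI)
      fix z assume z: "z \<in> ?U -` (Pi\<^sub>E ({..<m} \<times> {..<Suc p}) E) \<inter> space ?Q"
      obtain G e where ze: "z = (G, e)" by (cases z)
      have G: "G \<in> extensional {..<m}" "\<And>a. a < m \<Longrightarrow> G a \<in> extensional {..<p}" "e \<in> extensional {..<m}"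
        using z by (auto simp: ze space_pair_measure space_PiM PiE_iff)
      have mem: "(if b < p then G a b else e a) \<in> E (a, b)" if "a < m" "b < Suc p" for a b
      proof -
        have "?U z \<in> Pi\<^sub>E ({..<m} \<times> {..<Suc p}) E" using z by blast
        from PiE_mem[OF this, of "(a, b)"] show ?thesis using that by (auto simp: ze split: if_splits)
      qed
      have "G a b \<in> E (a, b)" if "a < m" "b < p" for a b using mem[of a b] that by simp
      moreover have "e a \<in> E (a, p)" if "a < m" for a using mem[of a p] that by simp
      ultimately show "z \<in> ?E1 \<times> ?E2" using G by (auto simp: ze PiE_iff)
    next
      fix z assume z: "z \<in> ?E1 \<times> ?E2"
      obtain G e where ze: "z = (G, e)" by (cases z)
      have G: "G \<in> extensional {..<m}" "\<And>a. a < m \<Longrightarrow> G a \<in> extensional {..<p}" "e \<in> extensional {..<m}"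
        "\<And>a b. a < m \<Longrightarrow> b < p \<Longrightarrow> G a b \<in> E (a, b)" "\<And>a. a < m \<Longrightarrow> e a \<in> E (a, p)"
        using z by (auto simp: ze PiE_iff)
      have "G a b \<in> space N" if "a < m" "b < p" for a b using G(4)[of a b] sp[of "(a, b)"] that by auto
      moreover have "e a \<in> space N" if "a < m" for a using G(5)[of a] sp[of "(a, p)"] that by auto
      ultimately have "z \<in> space ?Q" using G by (auto simp: ze space_pair_measure space_PiM PiE_iff)
      moreover have "?U z \<in> Pi\<^sub>E ({..<m} \<times> {..<Suc p}) E"
        using G by (auto simp: ze PiE_iff less_Suc_eq)
      ultimately show "z \<in> ?U -` (Pi\<^sub>E ({..<m} \<times> {..<Suc p}) E) \<inter> space ?Q" by simp
    qed
    hence "emeasure (distr ?Q ?P ?U) (Pi\<^sub>E ({..<m} \<times> {..<Suc p}) E) = emeasure ?Q (?E1 \<times> ?E2)"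
      using U E by (subst emeasure_distr) (auto intro!: sets_PiM_I_finite)
    also have "\<dots> = emeasure ?Q1 ?E1 * emeasure ?Q2 ?E2"
      using E by (intro Q2.emeasure_pair_measure_Times) (auto intro!: sets_PiM_I_finite)
    also have "emeasure ?Q1 ?E1 = (\<Prod>a<m. \<Prod>b<p. emeasure N (E (a, b)))"
    proof (subst R.emeasure_PiM)
      show "(\<Prod>a<m. emeasure (PiM {..<p} (\<lambda>_. N)) (Pi\<^sub>E {..<p} (\<lambda>b. E (a, b)))) = (\<Prod>a<m. \<Prod>b<p. emeasure N (E (a, b)))"
        using E by (intro prod.cong refl N'.emeasure_PiM) auto
    qed (use E in \<open>auto intro!: sets_PiM_I_finite\<close>)
    also have "emeasure ?Q2 ?E2 = (\<Prod>a<m. emeasure N (E (a, p)))"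
      using E by (intro N'.emeasure_PiM) auto
    also have "(\<Prod>a<m. \<Prod>b<p. emeasure N (E (a, b))) * (\<Prod>a<m. emeasure N (E (a, p)))
       = (\<Prod>a<m. \<Prod>b<Suc p. emeasure N (E (a, b)))"
      by (simp add: prod.distrib)
    also have "\<dots> = (\<Prod>i\<in>{..<m} \<times> {..<Suc p}. emeasure N (E i))"
      by (simp only: prod.cartesian_product split_def prod.collapse)
    finally show "emeasure (distr ?Q ?P ?U) (Pi\<^sub>E ({..<m} \<times> {..<Suc p}) E) = (\<Prod>i\<in>{..<m} \<times> {..<Suc p}. emeasure N (E i))" .
  qed auto
  have "distr ?P ?Q ?C = distr (distr ?Q ?P ?U) ?Q ?C" unfolding P ..
  also have "\<dots> = distr ?Q ?Q (?C \<circ> ?U)" by (rule distr_distr[OF C U])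
  also have "\<dots> = distr ?Q ?Q (\<lambda>x. x)"
  proof (rule distr_cong[OF refl refl])
    fix z assume z: "z \<in> space ?Q"
    obtain G e where ze: "z = (G, e)" by (cases z)
    have "G \<in> extensional {..<m}" "\<And>a. a < m \<Longrightarrow> G a \<in> extensional {..<p}" "e \<in> extensional {..<m}"
      using z by (auto simp: ze space_pair_measure space_PiM PiE_iff)
    thus "(?C \<circ> ?U) z = z"
      unfolding ze comp_def by (intro prod_eqI ext) (auto simp: extensional_def restrict_def)
  qed
  finally show ?thesis by (simp add: distr_id)
qed

definition data_map :: "nat \<Rightarrow> nat \<Rightarrow> (nat \<Rightarrow> nat \<Rightarrow> real) \<Rightarrow> (nat \<times> nat \<Rightarrow> real)
    \<Rightarrow> (nat \<Rightarrow> nat \<Rightarrow> real) \<times> (nat \<Rightarrow> real)" where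
  "data_map m p L \<omega> = (\<lambda>r\<in>{..<m}. lmap {..<p} L (\<lambda>j. \<omega> (r, j)), \<lambda>r\<in>{..<m}. \<omega> (r, p))"

abbreviation flat_law :: "nat \<Rightarrow> nat \<Rightarrow> (nat \<times> nat \<Rightarrow> real) measure" where
  "flat_law m k \<equiv> PiM ({..<m} \<times> {..<k}) (\<lambda>_. std_gauss)"

lemma data_map_measurable:
  "data_map m p L \<in> flat_law m (Suc p) \<rightarrow>\<^sub>M
      (PiM {..<m} (\<lambda>_. PiM {..<p} (\<lambda>_. borel)) \<Otimes>\<^sub>M PiM {..<m} (\<lambda>_. std_gauss))"
  unfolding data_map_def lmap_def
  by (intro measurable_Pair measurable_restrict borel_measurable_sum borel_measurable_times) auto

lemma data_law_eq_distr:
  assumes L: "gauss_vec p \<Sigma> = distr (PiM {..<p} (\<lambda>_. std_gauss)) (PiM {..<p} (\<lambda>_. borel)) (lmap {..<p} L)"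
  shows "data_law m p \<Sigma> = distr (flat_law m (Suc p))
     (PiM {..<m} (\<lambda>_. PiM {..<p} (\<lambda>_. borel)) \<Otimes>\<^sub>M PiM {..<m} (\<lambda>_. std_gauss)) (data_map m p L)"
proof -
  let ?G = "PiM {..<p} (\<lambda>_. std_gauss)" and ?B = "PiM {..<p} (\<lambda>_. borel :: real measure)" and ?E = "PiM {..<m} (\<lambda>_. std_gauss)"
  have pG: "prob_space ?G" by (rule prob_space_PiM) (rule prob_space_std_gauss)
  have pE: "prob_space ?E" by (rule prob_space_PiM) (rule prob_space_std_gauss)
  have lm: "lmap {..<p} L \<in> ?G \<rightarrow>\<^sub>M ?B"
    unfolding lmap_def by measurable
  define D where "D = distr ?G ?B (lmap {..<p} L)"
  have pD: "prob_space D" unfolding D_def by (rule prob_space.prob_space_distr[OF pG lm])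
  have cD: "distr ?G D (lmap {..<p} L) = D"
    unfolding D_def by (rule distr_cong) auto
  have lmD: "lmap {..<p} L \<in> ?G \<rightarrow>\<^sub>M D" using lm by (simp add: D_def)
  have row: "distr (PiM {..<m} (\<lambda>_. ?G)) (PiM {..<m} (\<lambda>_. D)) (compose {..<m} (lmap {..<p} L)) = PiM {..<m} (\<lambda>_. D)"
    using distr_PiM_finite_prob_space'[of "{..<m}" "\<lambda>_. ?G" "\<lambda>_. D" "lmap {..<p} L"] pG pD lmD by (simp add: cD)
  have compm: "compose {..<m} (lmap {..<p} L) \<in> PiM {..<m} (\<lambda>_. ?G) \<rightarrow>\<^sub>M PiM {..<m} (\<lambda>_. D)"
    unfolding compose_def by (intro measurable_restrict measurable_compose[OF _ lmD]) auto
  have sD: "sets (PiM {..<m} (\<lambda>_. D)) = sets (PiM {..<m} (\<lambda>_. ?B))"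
    by (intro sets_PiM_cong) (auto simp: D_def)
  have sDE: "sets (PiM {..<m} (\<lambda>_. D) \<Otimes>\<^sub>M ?E) = sets (PiM {..<m} (\<lambda>_. ?B) \<Otimes>\<^sub>M ?E)"
    by (intro sets_pair_measure_cong sD refl)
  have "data_law m p \<Sigma> = PiM {..<m} (\<lambda>_. D) \<Otimes>\<^sub>M ?E"
    unfolding data_law_def L D_def ..
  also have "\<dots> = distr (PiM {..<m} (\<lambda>_. ?G)) (PiM {..<m} (\<lambda>_. D)) (compose {..<m} (lmap {..<p} L)) \<Otimes>\<^sub>M distr ?E ?E (\<lambda>x. x)"
    unfolding row by (simp add: distr_id)
  also have "\<dots> = distr (PiM {..<m} (\<lambda>_. ?G) \<Otimes>\<^sub>M ?E) (PiM {..<m} (\<lambda>_. D) \<Otimes>\<^sub>M ?E)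
      (\<lambda>(x, y). (compose {..<m} (lmap {..<p} L) x, y))"
    by (rule pair_measure_distr[OF compm]) (auto simp: distr_id intro: prob_space_imp_sigma_finite pE)
  also have "\<dots> = distr (distr (flat_law m (Suc p)) (PiM {..<m} (\<lambda>_. ?G) \<Otimes>\<^sub>M ?E)
      (\<lambda>\<omega>. (\<lambda>a\<in>{..<m}. \<lambda>b\<in>{..<p}. \<omega> (a, b), \<lambda>a\<in>{..<m}. \<omega> (a, p)))) (PiM {..<m} (\<lambda>_. D) \<Otimes>\<^sub>M ?E)
      (\<lambda>(x, y). (compose {..<m} (lmap {..<p} L) x, y))"
    unfolding PiM_split_last[OF prob_space_std_gauss] ..
  also have "\<dots> = distr (flat_law m (Suc p)) (PiM {..<m} (\<lambda>_. D) \<Otimes>\<^sub>M ?E)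
     ((\<lambda>(x, y). (compose {..<m} (lmap {..<p} L) x, y)) \<circ> (\<lambda>\<omega>. (\<lambda>a\<in>{..<m}. \<lambda>b\<in>{..<p}. \<omega> (a, b), \<lambda>a\<in>{..<m}. \<omega> (a, p))))"
  proof (rule distr_distr)
    show "(\<lambda>(x, y). (compose {..<m} (lmap {..<p} L) x, y)) \<in> PiM {..<m} (\<lambda>_. ?G) \<Otimes>\<^sub>M ?E \<rightarrow>\<^sub>M PiM {..<m} (\<lambda>_. D) \<Otimes>\<^sub>M ?E"
      unfolding split_def by (intro measurable_Pair measurable_compose[OF measurable_fst compm]) auto
    show "(\<lambda>\<omega>. (\<lambda>a\<in>{..<m}. \<lambda>b\<in>{..<p}. \<omega> (a, b), \<lambda>a\<in>{..<m}. \<omega> (a, p)))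
       \<in> flat_law m (Suc p) \<rightarrow>\<^sub>M PiM {..<m} (\<lambda>_. ?G) \<Otimes>\<^sub>M ?E"
      by (intro measurable_Pair measurable_restrict) auto
  qed
  also have "\<dots> = distr (flat_law m (Suc p)) (PiM {..<m} (\<lambda>_. ?B) \<Otimes>\<^sub>M ?E) (data_map m p L)"
    by (rule distr_cong[OF refl sDE])
       (auto simp: data_map_def compose_def lmap_def intro!: restrict_ext sum.cong)
  finally show ?thesis .
qed

lemma distr_std_gauss_lincomb:
  fixes a :: "'i \<Rightarrow> real"
  assumes J: "finite J" and a: "(\<Sum>j\<in>J. (a j)\<^sup>2) = 1"
  shows "distr (PiM J (\<lambda>_. std_gauss)) borel (\<lambda>\<omega>. \<Sum>j\<in>J. a j * \<omega> j) = std_gauss"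
proof -
  let ?P = "PiM J (\<lambda>_. std_gauss)"
  \<comment> \<open>Vanishing coefficients are dropped because a normal density needs a positive
    deviation.\<close>
  define I where "I = {j \<in> J. a j \<noteq> 0}"
  have I: "finite I" "I \<subseteq> J" using J by (auto simp: I_def)
  have sumI: "(\<Sum>j\<in>J. f j) = (\<Sum>j\<in>I. f j)" if "\<And>j. a j = 0 \<Longrightarrow> f j = 0" for f :: "'i \<Rightarrow> real"
    using J that by (intro sum.mono_neutral_right) (auto simp: I_def)
  have aI: "(\<Sum>j\<in>I. (a j)\<^sup>2) = 1" using a sumI[of "\<lambda>j. (a j)\<^sup>2"] by simp
  hence Ine: "I \<noteq> {}" by auto
  interpret P: prob_space ?P by (rule prob_space_PiM) (rule prob_space_std_gauss)
  have comp: "distr ?P borel (\<lambda>\<omega>. \<omega> i) = std_gauss" if "i \<in> J" for i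
  proof -
    have "distr ?P borel (\<lambda>\<omega>. \<omega> i) = distr ?P std_gauss (\<lambda>\<omega>. \<omega> i)" by (rule distr_cong) auto
    also have "\<dots> = std_gauss" using that by (intro distr_PiM_component prob_space_std_gauss)
    finally show ?thesis .
  qed
  have rv: "(\<lambda>\<omega>. \<omega> i) \<in> borel_measurable ?P" if "i \<in> J" for i
    using that by measurable
  have ind: "P.indep_vars (\<lambda>_. borel) (\<lambda>i \<omega>. \<omega> i) I"
  proof (subst P.indep_vars_iff_distr_eq_PiM')
    have "distr ?P (PiM I (\<lambda>_. borel)) (\<lambda>x. \<lambda>i\<in>I. x i) = distr ?P (PiM I (\<lambda>_. std_gauss)) (\<lambda>x. restrict x I)"
      by (rule distr_cong) (auto intro!: sets_PiM_cong)
    also have "\<dots> = PiM I (\<lambda>_. std_gauss)"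
      using I by (intro product_prob_space.distr_PiM_restrict_finite product_prob_space_std_gauss)
    also have "\<dots> = PiM I (\<lambda>i. distr ?P borel (\<lambda>\<omega>. \<omega> i))"
      using I by (intro PiM_cong) (auto simp: comp)
    finally show "distr ?P (PiM I (\<lambda>_. borel)) (\<lambda>x. \<lambda>i\<in>I. x i) = PiM I (\<lambda>i. distr ?P borel (\<lambda>\<omega>. \<omega> i))" .
  qed (use Ine rv I in auto)
  have ind': "P.indep_vars (\<lambda>_. borel) (\<lambda>i \<omega>. a i * \<omega> i) I"
    using P.indep_vars_compose2[OF ind, of "\<lambda>i x. a i * x" "\<lambda>_. borel"] by simp
  have "distributed ?P lborel (\<lambda>\<omega>. \<Sum>i\<in>I. a i * \<omega> i)
      (normal_density (\<Sum>i\<in>I. 0) (sqrt (\<Sum>i\<in>I. \<bar>a i\<bar>\<^sup>2)))"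
  proof (rule P.sum_indep_normal[OF I(1) Ine ind'])
    fix i assume i: "i \<in> I"
    show "0 < \<bar>a i\<bar>" using i by (auto simp: I_def)
    have "distr ?P lborel (\<lambda>\<omega>. \<omega> i) = distr ?P borel (\<lambda>\<omega>. \<omega> i)" by (rule distr_cong) auto
    hence "distributed ?P lborel (\<lambda>\<omega>. \<omega> i) (normal_density 0 1)"
      using comp[of i] rv[of i] i I unfolding distributed_def std_gauss_def by auto
    from P.normal_density_affine[OF this, of "a i" 0]
    show "distributed ?P lborel (\<lambda>\<omega>. a i * \<omega> i) (normal_density 0 \<bar>a i\<bar>)"
      using i by (simp add: I_def)
  qed
  hence "distributed ?P lborel (\<lambda>\<omega>. \<Sum>i\<in>I. a i * \<omega> i) (normal_density 0 1)"
    using aI by simp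
  hence "distr ?P lborel (\<lambda>\<omega>. \<Sum>i\<in>I. a i * \<omega> i) = std_gauss"
    by (simp add: distributed_def std_gauss_def)
  moreover have "distr ?P lborel (\<lambda>\<omega>. \<Sum>i\<in>I. a i * \<omega> i) = distr ?P borel (\<lambda>\<omega>. \<Sum>i\<in>J. a i * \<omega> i)"
    by (rule distr_cong) (auto intro!: sumI[symmetric])
  ultimately show ?thesis by simp
qed

section \<open>Tail bounds\<close>

text \<open>Laplace transform of a squared standard normal; negative \<open>l\<close> is allowed
  because the upper tail of the chi-square law needs a positive exponential moment.\<close>

lemma nn_integral_std_gauss_exp_sq:
  assumes l: "l > - 1 / 2"
  shows "(\<integral>\<^sup>+w. ennreal (exp (- l * w\<^sup>2)) \<partial>std_gauss) = ennreal (1 / sqrt (1 + 2 * l))"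
proof -
  interpret S: prob_space std_gauss by (rule prob_space_std_gauss)
  have b: "1 + 2 * l > 0" using l by simp
  have "(\<integral>\<^sup>+w. ennreal (exp (- l * w\<^sup>2)) \<partial>std_gauss)
      = (\<integral>\<^sup>+w. ennreal (1 / sqrt (2 * pi)) * (1 * ennreal (exp (- ((1 + 2 * l) * (w + 0)\<^sup>2) / 2))) \<partial>lborel)"
  proof (subst nn_integral_std_gauss, simp, rule nn_integral_cong)
    fix w :: real
    have "std_normal_density w * exp (- l * w\<^sup>2) = 1 / sqrt (2 * pi) * exp (- ((1 + 2 * l) * (w + 0)\<^sup>2) / 2)"
      unfolding std_normal_density_def mult.assoc exp_add[symmetric] by (simp add: field_simps)
    thus "ennreal (std_normal_density w) * ennreal (exp (- l * w\<^sup>2))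
        = ennreal (1 / sqrt (2 * pi)) * (1 * ennreal (exp (- ((1 + 2 * l) * (w + 0)\<^sup>2) / 2)))"
      by (simp add: ennreal_mult'[symmetric])
  qed
  also have "\<dots> = ennreal (1 / sqrt (2 * pi)) * (\<integral>\<^sup>+w. 1 * ennreal (exp (- ((1 + 2 * l) * (w + 0)\<^sup>2) / 2)) \<partial>lborel)"
    by (rule nn_integral_cmult) measurable
  also have "(\<integral>\<^sup>+w. 1 * ennreal (exp (- ((1 + 2 * l) * (w + 0)\<^sup>2) / 2)) \<partial>lborel)
     = ennreal (sqrt (2 * pi) * (1 / sqrt (1 + 2 * l))) * (\<integral>\<^sup>+g. 1 \<partial>std_gauss)"
    by (rule nn_integral_gaussian_affine) (use b in auto)
  also have "(\<integral>\<^sup>+g. 1 \<partial>std_gauss) = 1" using S.emeasure_space_1 by simp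
  finally show ?thesis using b by (simp add: ennreal_mult'[symmetric])
qed

lemma nn_integral_std_gauss_exp_linear:
  "(\<integral>\<^sup>+w. ennreal (exp (s * w)) \<partial>std_gauss) = ennreal (exp (s\<^sup>2 / 2))"
proof -
  interpret S: prob_space std_gauss by (rule prob_space_std_gauss)
  have "(\<integral>\<^sup>+w. ennreal (exp (s * w)) \<partial>std_gauss)
      = (\<integral>\<^sup>+w. ennreal (exp (s\<^sup>2 / 2) / sqrt (2 * pi)) * (1 * ennreal (exp (- (1 * (w + (- s))\<^sup>2) / 2))) \<partial>lborel)"
  proof (subst nn_integral_std_gauss, simp, rule nn_integral_cong)
    fix w :: real
    have e: "- w\<^sup>2 / 2 + s * w = s\<^sup>2 / 2 + - (1 * (w + (- s))\<^sup>2) / 2"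
      by (simp add: power2_eq_square field_simps)
    have "std_normal_density w * exp (s * w) = 1 / sqrt (2 * pi) * exp (- w\<^sup>2 / 2 + s * w)"
      unfolding std_normal_density_def mult.assoc exp_add by simp
    also have "\<dots> = exp (s\<^sup>2 / 2) / sqrt (2 * pi) * exp (- (1 * (w + (- s))\<^sup>2) / 2)"
      unfolding e exp_add by simp
    finally show "ennreal (std_normal_density w) * ennreal (exp (s * w))
        = ennreal (exp (s\<^sup>2 / 2) / sqrt (2 * pi)) * (1 * ennreal (exp (- (1 * (w + (- s))\<^sup>2) / 2)))"
      by (simp add: ennreal_mult'[symmetric])
  qed
  also have "\<dots> = ennreal (exp (s\<^sup>2 / 2) / sqrt (2 * pi)) * (\<integral>\<^sup>+w. 1 * ennreal (exp (- (1 * (w + (- s))\<^sup>2) / 2)) \<partial>lborel)"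
    by (rule nn_integral_cmult) measurable
  also have "(\<integral>\<^sup>+w. 1 * ennreal (exp (- (1 * (w + (- s))\<^sup>2) / 2)) \<partial>lborel)
     = ennreal (sqrt (2 * pi) * (1 / sqrt 1)) * (\<integral>\<^sup>+g. 1 \<partial>std_gauss)"
    by (rule nn_integral_gaussian_affine) auto
  also have "(\<integral>\<^sup>+g. 1 \<partial>std_gauss) = 1" using S.emeasure_space_1 by simp
  finally show ?thesis by (simp add: ennreal_mult'[symmetric])
qed

text \<open>Exponential Markov at the optimal parameter \<open>t\<close>, with both signs added so
  that one bound covers both sides.\<close>

lemma std_gauss_tail:
  assumes t: "t \<ge> 0"
  shows "emeasure std_gauss {w. \<bar>w\<bar> > t} \<le> ennreal (2 * exp (- t\<^sup>2 / 2))"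
proof -
  have m: "{w :: real. \<bar>w\<bar> > t} \<in> sets borel" by measurable
  have "emeasure std_gauss {w. \<bar>w\<bar> > t} = (\<integral>\<^sup>+w. indicator {w. \<bar>w\<bar> > t} w \<partial>std_gauss)"
    using m by simp
  also have "\<dots> \<le> (\<integral>\<^sup>+w. ennreal (exp (- t\<^sup>2)) * (ennreal (exp (t * w)) + ennreal (exp ((- t) * w))) \<partial>std_gauss)"
  proof (rule nn_integral_mono)
    fix w :: real
    have "1 \<le> exp (- t\<^sup>2) * (exp (t * w) + exp ((- t) * w))" if w: "\<bar>w\<bar> > t"
    proof -
      have "t\<^sup>2 \<le> t * \<bar>w\<bar>" using w t by (simp add: power2_eq_square mult_left_mono)
      hence "1 \<le> exp (- t\<^sup>2) * exp (t * \<bar>w\<bar>)" by (simp add: exp_add[symmetric])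
      also have "\<dots> \<le> exp (- t\<^sup>2) * (exp (t * w) + exp ((- t) * w))"
        by (intro mult_left_mono) (auto simp: abs_if)
      finally show ?thesis .
    qed
    thus "indicator {w. \<bar>w\<bar> > t} w \<le> ennreal (exp (- t\<^sup>2)) * (ennreal (exp (t * w)) + ennreal (exp ((- t) * w)))"
      by (auto simp: indicator_def ennreal_plus[symmetric] ennreal_mult'[symmetric] simp del: ennreal_plus)
  qed
  also have "\<dots> = ennreal (exp (- t\<^sup>2)) * (ennreal (exp (t\<^sup>2 / 2)) + ennreal (exp ((- t)\<^sup>2 / 2)))"
    by (subst nn_integral_cmult, simp, subst nn_integral_add)
       (simp_all only: nn_integral_std_gauss_exp_linear, simp_all)
  also have "\<dots> = ennreal (2 * exp (- t\<^sup>2 / 2))"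
  proof -
    have "exp (- t\<^sup>2) * (exp (t\<^sup>2 / 2) + exp ((- t)\<^sup>2 / 2)) = 2 * (exp (- t\<^sup>2) * exp (t\<^sup>2 / 2))" by simp
    also have "exp (- t\<^sup>2) * exp (t\<^sup>2 / 2) = exp (- t\<^sup>2 / 2)" unfolding exp_add[symmetric] by simp
    finally show ?thesis
      by (simp add: ennreal_plus[symmetric] ennreal_mult'[symmetric] del: ennreal_plus)
  qed
  finally show ?thesis .
qed

lemma std_gauss_lincomb_tail:
  fixes c :: "'i \<Rightarrow> real"
  assumes J: "finite J" and t: "t \<ge> 0"
  shows "emeasure (PiM J (\<lambda>_. std_gauss)) {\<omega> \<in> space (PiM J (\<lambda>_. std_gauss)).
      \<bar>\<Sum>j\<in>J. c j * \<omega> j\<bar> > t * sqrt (\<Sum>j\<in>J. (c j)\<^sup>2)} \<le> ennreal (2 * exp (- t\<^sup>2 / 2))"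
proof (cases "(\<Sum>j\<in>J. (c j)\<^sup>2) = 0")
  \<comment> \<open>With all coefficients zero both sides are 0, and the strict inequality makes the
    event empty.\<close>
  case True
  hence "\<forall>j\<in>J. c j = 0" using J by (simp add: sum_nonneg_eq_0_iff)
  thus ?thesis using t by (simp add: not_less sum_nonneg)
next
  case False
  let ?P = "PiM J (\<lambda>_. std_gauss)"
  define s where "s = sqrt (\<Sum>j\<in>J. (c j)\<^sup>2)"
  have s: "s > 0" using False sum_nonneg[of J "\<lambda>j. (c j)\<^sup>2"] by (auto simp: s_def order.not_eq_order_implies_strict)
  have s2: "s\<^sup>2 = (\<Sum>j\<in>J. (c j)\<^sup>2)" unfolding s_def by (simp add: sum_nonneg)
  have "(\<Sum>j\<in>J. (c j / s)\<^sup>2) = 1"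
    using s by (simp add: power_divide sum_divide_distrib[symmetric] s2[symmetric])
  hence d: "distr ?P borel (\<lambda>\<omega>. \<Sum>j\<in>J. c j / s * \<omega> j) = std_gauss"
    by (rule distr_std_gauss_lincomb[OF J])
  have eq: "(\<Sum>j\<in>J. c j / s * \<omega> j) = (\<Sum>j\<in>J. c j * \<omega> j) / s" for \<omega>
    by (simp add: sum_divide_distrib)
  have "emeasure ?P {\<omega> \<in> space ?P. \<bar>\<Sum>j\<in>J. c j * \<omega> j\<bar> > t * s}
     = emeasure ?P ((\<lambda>\<omega>. \<Sum>j\<in>J. c j / s * \<omega> j) -` {w. \<bar>w\<bar> > t} \<inter> space ?P)"
    unfolding eq using s by (intro arg_cong2[where f = emeasure]) (auto simp: abs_divide less_divide_eq)
  also have "\<dots> = emeasure (distr ?P borel (\<lambda>\<omega>. \<Sum>j\<in>J. c j / s * \<omega> j)) {w. \<bar>w\<bar> > t}"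
    by (rule emeasure_distr[symmetric]) measurable
  also have "\<dots> \<le> ennreal (2 * exp (- t\<^sup>2 / 2))"
    unfolding d by (rule std_gauss_tail[OF t])
  finally show ?thesis unfolding s_def .
qed

text \<open>Distinct rows are independent, so the integral factors over rows; the unit vector
  \<open>v\<close> turns each row into a single standard normal.\<close>

lemma nn_integral_rows_lincomb:
  fixes v :: "nat \<Rightarrow> real"
  assumes v: "(\<Sum>j<k. (v j)\<^sup>2) = 1" and f: "f \<in> borel_measurable borel"
  shows "(\<integral>\<^sup>+\<omega>. (\<Prod>r<m. f (\<Sum>j<k. v j * \<omega> (r, j))) \<partial>flat_law m k) = (\<integral>\<^sup>+w. f w \<partial>std_gauss) ^ m"
proof -
  let ?R = "PiM {..<k} (\<lambda>_. std_gauss)" and ?C = "\<lambda>\<omega>. \<lambda>a\<in>{..<m}. \<lambda>b\<in>{..<k}. \<omega> (a, b)"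
  let ?g = "\<lambda>x. f (\<Sum>j<k. v j * x j)"
  interpret R: product_sigma_finite "\<lambda>_::nat. ?R"
    using prob_space_std_gauss by (simp add: product_sigma_finite_def prob_space_imp_sigma_finite prob_space_PiM)
  have lc: "(\<lambda>x. \<Sum>j<k. v j * x j) \<in> borel_measurable ?R" by measurable
  have g: "?g \<in> borel_measurable ?R"
    by (rule measurable_compose[OF lc f])
  have C: "?C \<in> flat_law m k \<rightarrow>\<^sub>M PiM {..<m} (\<lambda>_. ?R)"
    by (intro measurable_restrict) auto
  have gm: "(\<lambda>G. \<Prod>r<m. ?g (G r)) \<in> borel_measurable (PiM {..<m} (\<lambda>_. ?R))"
  proof (rule borel_measurable_prod_ennreal)
    fix r assume "r \<in> {..<m}"
    hence "(\<lambda>G. G r) \<in> PiM {..<m} (\<lambda>_. ?R) \<rightarrow>\<^sub>M ?R" by (rule measurable_component_singleton)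
    thus "(\<lambda>G. ?g (G r)) \<in> borel_measurable (PiM {..<m} (\<lambda>_. ?R))"
      by (rule measurable_compose[OF _ g])
  qed
  have "(\<integral>\<^sup>+\<omega>. (\<Prod>r<m. f (\<Sum>j<k. v j * \<omega> (r, j))) \<partial>flat_law m k)
     = (\<integral>\<^sup>+\<omega>. (\<Prod>r<m. ?g (?C \<omega> r)) \<partial>flat_law m k)"
    by (intro nn_integral_cong prod.cong refl) (auto intro!: arg_cong[where f = f] sum.cong)
  also have "\<dots> = (\<integral>\<^sup>+G. (\<Prod>r<m. ?g (G r)) \<partial>distr (flat_law m k) (PiM {..<m} (\<lambda>_. ?R)) ?C)"
    by (rule nn_integral_distr[OF C, symmetric]) (use gm in simp)
  also have "distr (flat_law m k) (PiM {..<m} (\<lambda>_. ?R)) ?C = PiM {..<m} (\<lambda>_. ?R)"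
    by (rule PiM_curry[OF prob_space_std_gauss]) auto
  also have "(\<integral>\<^sup>+G. (\<Prod>r<m. ?g (G r)) \<partial>PiM {..<m} (\<lambda>_. ?R)) = (\<Prod>r<m. \<integral>\<^sup>+x. ?g x \<partial>?R)"
    by (rule R.product_nn_integral_prod) (use g in auto)
  also have "\<dots> = (\<integral>\<^sup>+x. ?g x \<partial>?R) ^ m" by simp
  also have "(\<integral>\<^sup>+x. ?g x \<partial>?R) = (\<integral>\<^sup>+w. f w \<partial>distr ?R borel (\<lambda>x. \<Sum>j<k. v j * x j))"
    by (rule nn_integral_distr[symmetric]) (use lc f in auto)
  also have "distr ?R borel (\<lambda>x. \<Sum>j<k. v j * x j) = std_gauss"
    by (rule distr_std_gauss_lincomb) (use v in auto)
  finally show ?thesis .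
qed

lemma chi_square_laplace:
  fixes v :: "nat \<Rightarrow> real"
  assumes v: "(\<Sum>j<k. (v j)\<^sup>2) = 1" and l: "l > - 1 / 2"
  shows "(\<integral>\<^sup>+\<omega>. ennreal (exp (- l * (\<Sum>r<m. (\<Sum>j<k. v j * \<omega> (r, j))\<^sup>2))) \<partial>flat_law m k)
     = ennreal ((1 / sqrt (1 + 2 * l)) ^ m)"
proof -
  have "(\<integral>\<^sup>+\<omega>. ennreal (exp (- l * (\<Sum>r<m. (\<Sum>j<k. v j * \<omega> (r, j))\<^sup>2))) \<partial>flat_law m k)
     = (\<integral>\<^sup>+\<omega>. (\<Prod>r<m. ennreal (exp (- l * (\<Sum>j<k. v j * \<omega> (r, j))\<^sup>2))) \<partial>flat_law m k)"
    by (intro nn_integral_cong) (simp add: sum_distrib_left exp_sum prod_ennreal del: minus_mult_left)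
  also have "\<dots> = (\<integral>\<^sup>+w. ennreal (exp (- l * w\<^sup>2)) \<partial>std_gauss) ^ m"
    by (rule nn_integral_rows_lincomb[OF v]) measurable
  also have "\<dots> = ennreal ((1 / sqrt (1 + 2 * l)) ^ m)"
    unfolding nn_integral_std_gauss_exp_sq[OF l] using l by (intro ennreal_power) auto
  finally show ?thesis .
qed

lemma emeasure_exp_markov:
  fixes X :: "'a \<Rightarrow> real"
  assumes X: "X \<in> borel_measurable M"
  shows "emeasure M {\<omega> \<in> space M. X \<omega> \<ge> b} \<le> ennreal (exp (- b)) * (\<integral>\<^sup>+\<omega>. ennreal (exp (X \<omega>)) \<partial>M)"
proof -
  have m: "{\<omega> \<in> space M. X \<omega> \<ge> b} \<in> sets M" using X by measurable
  have "emeasure M {\<omega> \<in> space M. X \<omega> \<ge> b} = (\<integral>\<^sup>+\<omega>. indicator {\<omega> \<in> space M. X \<omega> \<ge> b} \<omega> \<partial>M)"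
    using m by simp
  also have "\<dots> \<le> (\<integral>\<^sup>+\<omega>. ennreal (exp (- b)) * ennreal (exp (X \<omega>)) \<partial>M)"
  proof (rule nn_integral_mono)
    fix \<omega>
    have "1 \<le> exp (- b) * exp (X \<omega>)" if "X \<omega> \<ge> b" using that by (simp add: exp_add[symmetric])
    thus "indicator {\<omega> \<in> space M. X \<omega> \<ge> b} \<omega> \<le> ennreal (exp (- b)) * ennreal (exp (X \<omega>))"
      by (auto simp: indicator_def ennreal_mult'[symmetric])
  qed
  also have "\<dots> = ennreal (exp (- b)) * (\<integral>\<^sup>+\<omega>. ennreal (exp (X \<omega>)) \<partial>M)"
    by (rule nn_integral_cmult) (use X in measurable)
  finally show ?thesis .
qed

text \<open>Exponential Markov with the Laplace parameters 1/8 for the lower and -1/4 for the upper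
  tail. The levels 4/5 and 4 are such that \<open>net_norm_bounds\<close> still reaches 1/2 and 5
  after the loss caused by the mesh of the net; 1/200 is a rate that both tails satisfy.\<close>

lemma chi_square_tails:
  fixes v :: "nat \<Rightarrow> real" and m k :: nat
  assumes v: "(\<Sum>j<k. (v j)\<^sup>2) = 1"
  defines "W \<equiv> (\<lambda>\<omega>. \<Sum>r<m. (\<Sum>j<k. v j * \<omega> (r, j))\<^sup>2)"
  shows "emeasure (flat_law m k) {\<omega> \<in> space (flat_law m k). \<not> (4/5 * real m \<le> W \<omega> \<and> W \<omega> \<le> 4 * real m)}
     \<le> ennreal (2 * exp (- real m / 200))"
proof -
  let ?P = "flat_law m k"
  have W: "W \<in> borel_measurable ?P" unfolding W_def by measurable
  have lo: "emeasure ?P {\<omega> \<in> space ?P. - (1/8) * W \<omega> \<ge> - (1/8) * (4/5 * real m)} \<le> ennreal (exp (- real m / 200))"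
  proof -
    have "emeasure ?P {\<omega> \<in> space ?P. - (1/8) * W \<omega> \<ge> - (1/8) * (4/5 * real m)}
       \<le> ennreal (exp (- (- (1/8) * (4/5 * real m)))) * (\<integral>\<^sup>+\<omega>. ennreal (exp (- (1/8) * W \<omega>)) \<partial>?P)"
      by (rule emeasure_exp_markov) (use W in measurable)
    also have "(\<integral>\<^sup>+\<omega>. ennreal (exp (- (1/8) * W \<omega>)) \<partial>?P) = ennreal ((1 / sqrt (1 + 2 * (1/8))) ^ m)"
      unfolding W_def by (rule chi_square_laplace[OF v]) simp
    also have "ennreal (exp (- (- (1/8) * (4/5 * real m)))) * ennreal ((1 / sqrt (1 + 2 * (1/8))) ^ m)
       = ennreal ((exp (1/10) / sqrt (5/4)) ^ m)"
      by (simp add: ennreal_mult'[symmetric] exp_of_nat_mult[symmetric] power_divide mult.commute)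
    also have "\<dots> \<le> ennreal (exp (- 1 / 200) ^ m)"
    proof (intro ennreal_leI power_mono)
      \<comment> \<open>Here \<open>21/200 = 1/10 + 1/200\<close>, and the quadratic bound on the
        exponential is just sharp enough.\<close>
      have "exp (21/200 :: real) \<le> 1 + 21/200 + (21/200)\<^sup>2" by (rule exp_bound) auto
      also have "\<dots> \<le> sqrt (5/4)" by (rule real_le_rsqrt) (simp add: power2_eq_square)
      finally have "exp (1/10) * exp (1/200 :: real) \<le> sqrt (5/4)" unfolding exp_add[symmetric] by simp
      thus "exp (1/10) / sqrt (5/4) \<le> exp (- 1 / 200 :: real)"
        by (simp add: exp_minus field_simps)
    qed auto
    also have "exp (- 1 / 200) ^ m = exp (- real m / 200)"
      by (simp add: exp_of_nat_mult[symmetric])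
    finally show ?thesis .
  qed
  have up: "emeasure ?P {\<omega> \<in> space ?P. - (- 1/4) * W \<omega> \<ge> real m} \<le> ennreal (exp (- real m / 200))"
  proof -
    have "emeasure ?P {\<omega> \<in> space ?P. - (- 1/4) * W \<omega> \<ge> real m}
       \<le> ennreal (exp (- real m)) * (\<integral>\<^sup>+\<omega>. ennreal (exp (- (- 1/4) * W \<omega>)) \<partial>?P)"
      by (rule emeasure_exp_markov) (use W in measurable)
    also have "(\<integral>\<^sup>+\<omega>. ennreal (exp (- (- 1/4) * W \<omega>)) \<partial>?P) = ennreal ((1 / sqrt (1 + 2 * (- 1/4))) ^ m)"
      unfolding W_def by (rule chi_square_laplace[OF v]) simp
    also have "ennreal (exp (- real m)) * ennreal ((1 / sqrt (1 + 2 * (- 1/4))) ^ m)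
       = ennreal ((exp (- 1) / sqrt (1/2)) ^ m)"
      by (simp add: ennreal_mult'[symmetric] exp_of_nat_mult[symmetric] power_divide mult.commute)
    also have "\<dots> \<le> ennreal (exp (- 1 / 200) ^ m)"
    proof (intro ennreal_leI power_mono)
      have "exp (- 1) / sqrt (1/2) = exp (- 1) * sqrt (2 :: real)" by (simp add: real_sqrt_divide)
      also have "\<dots> \<le> exp (- 1) * (3/2)" by (intro mult_left_mono real_le_lsqrt) (auto simp: power2_eq_square)
      also have "\<dots> \<le> exp (- 1) * exp (199/200 :: real)"
        using exp_ge_add_one_self[of "199/200 :: real"] by (intro mult_left_mono) auto
      also have "\<dots> = exp (- 1 / 200)" unfolding exp_add[symmetric] by simp
      finally show "exp (- 1) / sqrt (1/2) \<le> exp (- 1 / 200 :: real)" .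
    qed auto
    also have "exp (- 1 / 200) ^ m = exp (- real m / 200)"
      by (simp add: exp_of_nat_mult[symmetric])
    finally show ?thesis .
  qed
  have "emeasure ?P {\<omega> \<in> space ?P. \<not> (4/5 * real m \<le> W \<omega> \<and> W \<omega> \<le> 4 * real m)}
     \<le> emeasure ?P ({\<omega> \<in> space ?P. - (1/8) * W \<omega> \<ge> - (1/8) * (4/5 * real m)} \<union> {\<omega> \<in> space ?P. - (- 1/4) * W \<omega> \<ge> real m})"
    by (rule emeasure_mono) (use W in auto)
  also have "\<dots> \<le> emeasure ?P {\<omega> \<in> space ?P. - (1/8) * W \<omega> \<ge> - (1/8) * (4/5 * real m)}
     + emeasure ?P {\<omega> \<in> space ?P. - (- 1/4) * W \<omega> \<ge> real m}"
    by (rule emeasure_subadditive) (use W in measurable)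
  also have "\<dots> \<le> ennreal (exp (- real m / 200)) + ennreal (exp (- real m / 200))"
    by (rule add_mono[OF lo up])
  also have "\<dots> = ennreal (2 * exp (- real m / 200))"
    by (simp add: ennreal_plus[symmetric] del: ennreal_plus)
  finally show ?thesis .
qed

text \<open>The weights \<open>a\<close> are random but read only the columns in \<open>S\<close>.
  By Fubini those entries are fixed first; what remains is one linear combination of the other
  Gaussians with coefficients \<open>a r * h j\<close>, whose squared norm is the product under the
  root. The tail bound thus holds relative to a random scale.\<close>

lemma independent_direction_tail:
  fixes a :: "(nat \<times> nat \<Rightarrow> real) \<Rightarrow> nat \<Rightarrow> real" and h :: "nat \<Rightarrow> real"
  assumes S: "S \<subseteq> {..<k}" and t: "t \<ge> 0"
    and a: "\<And>r. r < m \<Longrightarrow> (\<lambda>\<omega>. a \<omega> r) \<in> borel_measurable (PiM ({..<m} \<times> S) (\<lambda>_. borel))"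
  defines "A \<equiv> {\<omega> \<in> space (flat_law m k). \<bar>\<Sum>r<m. a (restrict \<omega> ({..<m} \<times> S)) r * (\<Sum>j\<in>{..<k} - S. h j * \<omega> (r, j))\<bar>
       > t * sqrt ((\<Sum>j\<in>{..<k} - S. (h j)\<^sup>2) * (\<Sum>r<m. (a (restrict \<omega> ({..<m} \<times> S)) r)\<^sup>2))}"
  shows "A \<in> sets (flat_law m k)" and "emeasure (flat_law m k) A \<le> ennreal (2 * exp (- t\<^sup>2 / 2))"
proof -
  let ?J1 = "{..<m} \<times> S" and ?J2 = "{..<m} \<times> ({..<k} - S)" and ?P = "flat_law m k"
  have fS: "finite S" using S by (rule finite_subset) simp
  have un: "?J1 \<union> ?J2 = {..<m} \<times> {..<k}" using S by auto
  have disj: "?J1 \<inter> ?J2 = {}" by auto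
  have am: "(\<lambda>\<omega>. a (restrict \<omega> ?J1) r) \<in> borel_measurable ?P" if r: "r < m" for r
  proof -
    have "(\<lambda>\<omega>. restrict \<omega> ?J1) \<in> ?P \<rightarrow>\<^sub>M PiM ?J1 (\<lambda>_. borel)"
      using S by (intro measurable_restrict) auto
    thus ?thesis using a[OF r] by (rule measurable_compose)
  qed
  have hm: "(\<lambda>\<omega>. \<Sum>j\<in>{..<k} - S. h j * \<omega> (r, j)) \<in> borel_measurable ?P" if "r < m" for r
    using that by (intro borel_measurable_sum borel_measurable_times) auto
  define F where "F = (\<lambda>\<omega>. \<bar>\<Sum>r<m. a (restrict \<omega> ?J1) r * (\<Sum>j\<in>{..<k} - S. h j * \<omega> (r, j))\<bar>
      - t * sqrt ((\<Sum>j\<in>{..<k} - S. (h j)\<^sup>2) * (\<Sum>r<m. (a (restrict \<omega> ?J1) r)\<^sup>2)))"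
  have Fm: "F \<in> borel_measurable ?P"
    unfolding F_def
    by (intro borel_measurable_diff borel_measurable_abs borel_measurable_sum borel_measurable_times
        borel_measurable_const measurable_compose[OF _ borel_measurable_sqrt] borel_measurable_power am hm) auto
  have A_eq: "A = {\<omega> \<in> space ?P. F \<omega> > 0}" by (auto simp: A_def F_def)
  show As: "A \<in> sets ?P" unfolding A_eq using Fm by measurable
  interpret ps: product_sigma_finite "\<lambda>_::nat \<times> nat. std_gauss"
    by (rule product_sigma_finite_std_gauss)
  interpret P1: prob_space "PiM ?J1 (\<lambda>_. std_gauss)"
    by (rule prob_space_PiM) (rule prob_space_std_gauss)
  have ind: "(indicator A :: _ \<Rightarrow> ennreal) \<in> borel_measurable (PiM (?J1 \<union> ?J2) (\<lambda>_. std_gauss))"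
    unfolding un using As by simp
  have "emeasure ?P A = (\<integral>\<^sup>+\<omega>. indicator A \<omega> \<partial>PiM (?J1 \<union> ?J2) (\<lambda>_. std_gauss))"
    unfolding un using As by simp
  also have "\<dots> = (\<integral>\<^sup>+x. \<integral>\<^sup>+y. indicator A (merge ?J1 ?J2 (x, y)) \<partial>PiM ?J2 (\<lambda>_. std_gauss) \<partial>PiM ?J1 (\<lambda>_. std_gauss))"
    by (rule ps.product_nn_integral_fold[OF disj _ _ ind]) (use fS in auto)
  also have "\<dots> \<le> (\<integral>\<^sup>+x. ennreal (2 * exp (- t\<^sup>2 / 2)) \<partial>PiM ?J1 (\<lambda>_. std_gauss))"
  proof (rule nn_integral_mono)
    fix x assume x: "x \<in> space (PiM ?J1 (\<lambda>_::nat \<times> nat. std_gauss))"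
    define c where "c = (\<lambda>(r, j). a x r * h j)"
    have rx: "restrict (merge ?J1 ?J2 (x, y)) ?J1 = x" for y
      using x by (auto simp: restrict_def merge_def space_PiM PiE_iff extensional_def)
    have my: "merge ?J1 ?J2 (x, y) (r, j) = y (r, j)" if "r < m" "j \<in> {..<k} - S" for y r j
      using that by (auto simp: merge_def)
    have num: "(\<Sum>r<m. a x r * (\<Sum>j\<in>{..<k} - S. h j * merge ?J1 ?J2 (x, y) (r, j))) = (\<Sum>i\<in>?J2. c i * y i)" for y
    proof -
      have "(\<Sum>r<m. a x r * (\<Sum>j\<in>{..<k} - S. h j * merge ?J1 ?J2 (x, y) (r, j)))
         = (\<Sum>r<m. \<Sum>j\<in>{..<k} - S. c (r, j) * y (r, j))"
        by (auto intro!: sum.cong simp: my sum_distrib_left c_def mult.assoc)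
      thus ?thesis by (simp add: sum.cartesian_product split_def)
    qed
    have den: "(\<Sum>j\<in>{..<k} - S. (h j)\<^sup>2) * (\<Sum>r<m. (a x r)\<^sup>2) = (\<Sum>i\<in>?J2. (c i)\<^sup>2)"
    proof -
      have "(\<Sum>i\<in>?J2. (c i)\<^sup>2) = (\<Sum>r<m. \<Sum>j\<in>{..<k} - S. (a x r)\<^sup>2 * (h j)\<^sup>2)"
        by (simp add: sum.cartesian_product split_def c_def power_mult_distrib)
      thus ?thesis by (simp add: sum_product mult.commute)
    qed
    have "(\<integral>\<^sup>+y. indicator A (merge ?J1 ?J2 (x, y)) \<partial>PiM ?J2 (\<lambda>_. std_gauss))
       \<le> (\<integral>\<^sup>+y. indicator {y \<in> space (PiM ?J2 (\<lambda>_. std_gauss)). \<bar>\<Sum>i\<in>?J2. c i * y i\<bar> > t * sqrt (\<Sum>i\<in>?J2. (c i)\<^sup>2)} y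
             \<partial>PiM ?J2 (\<lambda>_. std_gauss))"
    proof (rule nn_integral_mono)
      fix y assume "y \<in> space (PiM ?J2 (\<lambda>_::nat \<times> nat. std_gauss))"
      thus "indicator A (merge ?J1 ?J2 (x, y))
        \<le> (indicator {y \<in> space (PiM ?J2 (\<lambda>_. std_gauss)). \<bar>\<Sum>i\<in>?J2. c i * y i\<bar> > t * sqrt (\<Sum>i\<in>?J2. (c i)\<^sup>2)} y :: ennreal)"
        unfolding A_def by (simp add: indicator_def rx num den)
    qed
    also have "\<dots> = emeasure (PiM ?J2 (\<lambda>_. std_gauss))
       {y \<in> space (PiM ?J2 (\<lambda>_. std_gauss)). \<bar>\<Sum>i\<in>?J2. c i * y i\<bar> > t * sqrt (\<Sum>i\<in>?J2. (c i)\<^sup>2)}"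
    proof (rule nn_integral_indicator)
      have "(\<lambda>y. \<Sum>i\<in>?J2. c i * y i) \<in> borel_measurable (PiM ?J2 (\<lambda>_. std_gauss))"
        by (intro borel_measurable_sum borel_measurable_times) auto
      thus "{y \<in> space (PiM ?J2 (\<lambda>_. std_gauss)). \<bar>\<Sum>i\<in>?J2. c i * y i\<bar> > t * sqrt (\<Sum>i\<in>?J2. (c i)\<^sup>2)}
         \<in> sets (PiM ?J2 (\<lambda>_. std_gauss))" by measurable
    qed
    also have "\<dots> \<le> ennreal (2 * exp (- t\<^sup>2 / 2))"
      by (rule std_gauss_lincomb_tail[OF _ t]) simp
    finally show "(\<integral>\<^sup>+y. indicator A (merge ?J1 ?J2 (x, y)) \<partial>PiM ?J2 (\<lambda>_. std_gauss)) \<le> ennreal (2 * exp (- t\<^sup>2 / 2))" .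
  qed
  also have "\<dots> = ennreal (2 * exp (- t\<^sup>2 / 2))"
    using P1.emeasure_space_1 by simp
  finally show "emeasure ?P A \<le> ennreal (2 * exp (- t\<^sup>2 / 2))" .
qed

section \<open>Singular values of Gaussian matrices\<close>

lemma sum_half_power_abs_le: "(\<Sum>k\<in>{- int M..int M}. (1/2::real) ^ nat \<bar>k\<bar>) \<le> 4"
proof -
  have geo: "(\<Sum>j\<le>M. (1/2::real) ^ j) \<le> 2"
    using geometric_sum[of "1/2 :: real" "Suc M"] by (simp add: lessThan_Suc_atMost)
  have "{- int M..int M} = int ` {..M} \<union> (\<lambda>j. - int j) ` {..M}"
  proof -
    have "k \<in> int ` {..M} \<union> (\<lambda>j. - int j) ` {..M}" if "k \<in> {- int M..int M}" for k
    proof (cases "k \<ge> 0")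
      case True
      thus ?thesis using that by (intro UnI1 image_eqI[of _ _ "nat k"]) auto
    next
      case False
      thus ?thesis using that by (intro UnI2 image_eqI[of _ _ "nat (- k)"]) auto
    qed
    thus ?thesis by (intro equalityI subsetI) auto
  qed
  \<comment> \<open>Zero is counted in both halves, which only makes the bound 4 instead of
    3.\<close>
  hence "(\<Sum>k\<in>{- int M..int M}. (1/2::real) ^ nat \<bar>k\<bar>)
     \<le> (\<Sum>k\<in>int ` {..M}. (1/2::real) ^ nat \<bar>k\<bar>) + (\<Sum>k\<in>(\<lambda>j. - int j) ` {..M}. (1/2::real) ^ nat \<bar>k\<bar>)"
    using sum.union_inter[of "int ` {..M}" "(\<lambda>j. - int j) ` {..M}" "\<lambda>k. (1/2::real) ^ nat \<bar>k\<bar>"]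
      sum_nonneg[of "int ` {..M} \<inter> (\<lambda>j. - int j) ` {..M}" "\<lambda>k. (1/2::real) ^ nat \<bar>k\<bar>"] by simp
  also have "\<dots> = (\<Sum>j\<le>M. (1/2::real) ^ j) + (\<Sum>j\<le>M. (1/2::real) ^ j)"
    by (subst (1 2) sum.reindex) (auto simp: inj_on_def)
  finally show ?thesis using geo by linarith
qed

text \<open>Counting by a generating function: under the product of the weights
  \<open>2 ^ (- |k t|)\<close> a vector of 1-norm at most \<open>M\<close> has weight at least
  \<open>2 ^ (- M)\<close>, while the total weight of a box factors over the coordinates, each
  contributing at most 4.\<close>

lemma card_int_vectors_le:
  fixes T :: "'t set" and M :: nat
  assumes T: "finite T"
  defines "KS \<equiv> {k \<in> PiE T (\<lambda>_. UNIV). (\<Sum>t\<in>T. \<bar>k t\<bar>) \<le> int M}"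
  shows "finite KS" and "card KS \<le> 4 ^ card T * 2 ^ M"
proof -
  let ?B = "PiE T (\<lambda>_. {- int M..int M})"
  have fB: "finite ?B" using T by (intro finite_PiE) auto
  have sub: "KS \<subseteq> ?B"
  proof
    fix k assume k: "k \<in> KS"
    have "\<bar>k t\<bar> \<le> int M" if "t \<in> T" for t
    proof -
      have "\<bar>k t\<bar> \<le> (\<Sum>t\<in>T. \<bar>k t\<bar>)" using that T by (intro member_le_sum) auto
      thus ?thesis using k by (simp add: KS_def)
    qed
    thus "k \<in> ?B" using k by (force simp: KS_def PiE_iff abs_le_iff)
  qed
  show fin: "finite KS" using finite_subset[OF sub fB] .
  have "real (card KS) * (1/2) ^ M = (\<Sum>k\<in>KS. (1/2::real) ^ M)" by simp
  also have "\<dots> \<le> (\<Sum>k\<in>KS. \<Prod>t\<in>T. (1/2::real) ^ nat \<bar>k t\<bar>)"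
  proof (rule sum_mono)
    fix k assume k: "k \<in> KS"
    have e: "int (\<Sum>t\<in>T. nat \<bar>k t\<bar>) = (\<Sum>t\<in>T. \<bar>k t\<bar>)" by simp
    have "int (\<Sum>t\<in>T. nat \<bar>k t\<bar>) \<le> int M" unfolding e using k by (simp add: KS_def)
    hence "(\<Sum>t\<in>T. nat \<bar>k t\<bar>) \<le> M" by (simp only: of_nat_le_iff)
    hence "(1/2::real) ^ M \<le> (1/2) ^ (\<Sum>t\<in>T. nat \<bar>k t\<bar>)" by (intro power_decreasing) auto
    thus "(1/2::real) ^ M \<le> (\<Prod>t\<in>T. (1/2::real) ^ nat \<bar>k t\<bar>)" by (simp add: power_sum)
  qed
  also have "\<dots> \<le> (\<Sum>k\<in>?B. \<Prod>t\<in>T. (1/2::real) ^ nat \<bar>k t\<bar>)"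
    by (rule sum_mono2[OF fB sub]) (auto intro!: prod_nonneg)
  also have "\<dots> = (\<Prod>t\<in>T. \<Sum>k\<in>{- int M..int M}. (1/2::real) ^ nat \<bar>k\<bar>)"
    using T by (rule prod_sum_PiE[symmetric]) auto
  also have "\<dots> \<le> (\<Prod>t\<in>T. 4)"
    by (rule prod_mono) (use sum_half_power_abs_le in \<open>auto intro!: sum_nonneg\<close>)
  finally have "real (card KS) * (1/2) ^ M \<le> 4 ^ card T" by simp
  hence "real (card KS) \<le> 4 ^ card T * 2 ^ M" by (simp add: field_simps power_one_over)
  hence "real (card KS) \<le> real (4 ^ card T * 2 ^ M)" by simp
  thus "card KS \<le> 4 ^ card T * 2 ^ M" by (simp only: of_nat_le_iff)
qed

text \<open>Rounding towards zero, so that rounded points stay in the unit ball.\<close>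

lemma trunc_int_exists:
  fixes x :: real
  shows "\<exists>k::int. \<bar>real_of_int k\<bar> \<le> \<bar>x\<bar> \<and> \<bar>x - real_of_int k\<bar> \<le> 1"
proof (cases "x \<ge> 0")
  case True
  moreover have "0 \<le> \<lfloor>x\<rfloor>" using True by simp
  ultimately show ?thesis
    by (intro exI[of _ "\<lfloor>x\<rfloor>"]) (simp add: abs_if; linarith)
next
  case False
  moreover have "\<lceil>x\<rceil> \<le> 0" using False by (simp add: ceiling_le_iff)
  hence "real_of_int \<lceil>x\<rceil> \<le> 0" by simp
  ultimately show ?thesis
    using ceiling_correct[of x] by (intro exI[of _ "\<lceil>x\<rceil>"]) linarith
qed

text \<open>The net consists of the points of a cubic grid of mesh $1/(20\sqrt d)$ in the unit ball;
  an integer vector of squared norm at most $400 d$ also has 1-norm at most $400 d$.\<close>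

lemma euclidean_net_exists:
  fixes T :: "'t set"
  assumes T: "finite T" "T \<noteq> {}"
  obtains N :: "('t \<Rightarrow> real) set" where "finite N" "card N \<le> 2 ^ (402 * card T)"
    "\<And>g. (\<Sum>t\<in>T. (g t)\<^sup>2) = 1 \<Longrightarrow> \<exists>n\<in>N. (\<Sum>t\<in>T. (n t)\<^sup>2) \<le> 1 \<and> (\<Sum>t\<in>T. (g t - n t)\<^sup>2) \<le> (1/20)\<^sup>2"
proof -
  define d where "d = card T"
  have d: "d > 0" using T by (simp add: d_def card_gt_0_iff)
  define h where "h = 1 / (20 * sqrt (real d))"
  have h: "h > 0" using d by (simp add: h_def)
  have h2: "h\<^sup>2 = 1 / (400 * real d)" by (simp add: h_def power_divide power_mult_distrib)
  define KS where "KS = {k \<in> PiE T (\<lambda>_. UNIV). (\<Sum>t\<in>T. \<bar>k t\<bar>) \<le> int (400 * d)}"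
  define N where "N = (\<lambda>k t. h * real_of_int (k t)) ` KS"
  have fKS: "finite KS" and cKS: "card KS \<le> 4 ^ d * 2 ^ (400 * d)"
    unfolding KS_def d_def by (rule card_int_vectors_le[OF T(1)])+
  show ?thesis
  proof (rule that[of N])
    show "finite N" using fKS by (simp add: N_def)
    have "card N \<le> card KS" unfolding N_def by (rule card_image_le[OF fKS])
    also note cKS
    \<comment> \<open>Origin of the exponent 402, which later enters the sample size
      constant.\<close>
    also have "(4::nat) ^ d * 2 ^ (400 * d) = 2 ^ (402 * d)"
    proof -
      have "(4::nat) ^ d = 2 ^ (2 * d)" by (simp add: power_mult)
      thus ?thesis by (simp add: power_add[symmetric])
    qed
    finally show "card N \<le> 2 ^ (402 * card T)" by (simp add: d_def)
  next
    fix g :: "'t \<Rightarrow> real" assume g: "(\<Sum>t\<in>T. (g t)\<^sup>2) = 1"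
    have "\<forall>t. \<exists>k::int. \<bar>real_of_int k\<bar> \<le> \<bar>g t / h\<bar> \<and> \<bar>g t / h - real_of_int k\<bar> \<le> 1"
      using trunc_int_exists by blast
    then obtain k0 :: "'t \<Rightarrow> int" where k0: "\<And>t. \<bar>real_of_int (k0 t)\<bar> \<le> \<bar>g t / h\<bar>" "\<And>t. \<bar>g t / h - real_of_int (k0 t)\<bar> \<le> 1"
      by metis
    define k where "k = restrict k0 T"
    have le: "(h * real_of_int (k t))\<^sup>2 \<le> (g t)\<^sup>2" if "t \<in> T" for t
    proof -
      have "h * \<bar>real_of_int (k0 t)\<bar> \<le> h * \<bar>g t / h\<bar>" using k0(1) h by (intro mult_left_mono) auto
      hence "\<bar>h * real_of_int (k0 t)\<bar> \<le> \<bar>g t\<bar>" using h by (simp add: abs_mult abs_divide)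
      thus ?thesis using that by (simp add: k_def abs_le_square_iff)
    qed
    have dist: "(g t - h * real_of_int (k t))\<^sup>2 \<le> h\<^sup>2" if "t \<in> T" for t
    proof -
      have "h * \<bar>g t / h - real_of_int (k0 t)\<bar> \<le> h * 1" using k0(2) h by (intro mult_left_mono) auto
      moreover have "h * \<bar>g t / h - real_of_int (k0 t)\<bar> = \<bar>g t - h * real_of_int (k0 t)\<bar>"
      proof -
        have "h * (g t / h - real_of_int (k0 t)) = g t - h * real_of_int (k0 t)"
          using h by (simp add: right_diff_distrib)
        thus ?thesis using h by (metis abs_mult abs_of_pos)
      qed
      ultimately have "\<bar>g t - h * real_of_int (k0 t)\<bar> \<le> \<bar>h\<bar>" using h by simp
      thus ?thesis using that by (simp add: k_def abs_le_square_iff)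
    qed
    have sq: "(\<Sum>t\<in>T. (h * real_of_int (k t))\<^sup>2) \<le> 1"
      using sum_mono[of T "\<lambda>t. (h * real_of_int (k t))\<^sup>2" "\<lambda>t. (g t)\<^sup>2"] le g by simp
    have "real_of_int (\<Sum>t\<in>T. \<bar>k t\<bar>) \<le> (\<Sum>t\<in>T. (real_of_int (k t))\<^sup>2)"
    proof -
      have "\<bar>x\<bar> \<le> x\<^sup>2" for x :: int
      proof -
        consider "x = 0" | "\<bar>x\<bar> \<ge> 1" by linarith
        thus ?thesis
        proof cases
          case 2
          hence "\<bar>x\<bar> * 1 \<le> \<bar>x\<bar> * \<bar>x\<bar>" by (intro mult_left_mono) auto
          thus ?thesis by (simp add: power2_eq_square)
        qed simp
      qed
      hence "(\<Sum>t\<in>T. \<bar>k t\<bar>) \<le> (\<Sum>t\<in>T. (k t)\<^sup>2)" by (intro sum_mono) auto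
      hence "real_of_int (\<Sum>t\<in>T. \<bar>k t\<bar>) \<le> real_of_int (\<Sum>t\<in>T. (k t)\<^sup>2)" by (simp only: of_int_le_iff)
      thus ?thesis by simp
    qed
    also have "\<dots> = (\<Sum>t\<in>T. (h * real_of_int (k t))\<^sup>2) / h\<^sup>2"
      using h by (simp add: power_mult_distrib sum_distrib_left[symmetric])
    also have "\<dots> \<le> 1 / h\<^sup>2" using sq h by (intro divide_right_mono) auto
    also have "\<dots> = real_of_int (int (400 * d))" by (simp add: h2)
    finally have "(\<Sum>t\<in>T. \<bar>k t\<bar>) \<le> int (400 * d)" by (simp only: of_int_le_iff)
    hence "k \<in> KS" by (auto simp: KS_def k_def)
    hence "(\<lambda>t. h * real_of_int (k t)) \<in> N" by (auto simp: N_def)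
    moreover have "(\<Sum>t\<in>T. (g t - h * real_of_int (k t))\<^sup>2) \<le> (1/20)\<^sup>2"
    proof -
      have "(\<Sum>t\<in>T. (g t - h * real_of_int (k t))\<^sup>2) \<le> (\<Sum>t\<in>T. h\<^sup>2)" by (rule sum_mono[OF dist])
      also have "\<dots> = (1/20)\<^sup>2" using d by (simp add: h2 d_def[symmetric] power_divide)
      finally show ?thesis .
    qed
    ultimately show "\<exists>n\<in>N. (\<Sum>t\<in>T. (n t)\<^sup>2) \<le> 1 \<and> (\<Sum>t\<in>T. (g t - n t)\<^sup>2) \<le> (1/20)\<^sup>2"
      using sq by (intro bexI[of _ "\<lambda>t. h * real_of_int (k t)"] conjI)
  qed
qed

text \<open>Let \<open>s = sqrt M\<close> and let \<open>D\<close> be the supremum of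
  \<open>F\<close> on the unit sphere. Replacing a unit vector by a net point costs at most
  \<open>D / 20\<close>. The upper bound is thus self-improving, \<open>D <= 2 s + D / 20\<close>,
  and with \<open>D\<close> under control the same replacement gives the lower bound.\<close>

lemma net_norm_bounds:
  fixes z :: "'r \<Rightarrow> 't \<Rightarrow> real" and T :: "'t set" and R :: "'r set"
  assumes T: "finite T" and R: "finite R" and M: "M \<ge> 0"
    and net: "\<And>g. (\<Sum>t\<in>T. (g t)\<^sup>2) = 1 \<Longrightarrow> \<exists>n\<in>N. (\<Sum>t\<in>T. (n t)\<^sup>2) \<le> 1 \<and> (\<Sum>t\<in>T. (g t - n t)\<^sup>2) \<le> (1/20)\<^sup>2"
    and N: "\<And>n. n \<in> N \<Longrightarrow> 4/5 * M * (\<Sum>t\<in>T. (n t)\<^sup>2) \<le> (\<Sum>r\<in>R. (\<Sum>t\<in>T. n t * z r t)\<^sup>2)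
       \<and> (\<Sum>r\<in>R. (\<Sum>t\<in>T. n t * z r t)\<^sup>2) \<le> 4 * M * (\<Sum>t\<in>T. (n t)\<^sup>2)"
  shows "M / 2 * (\<Sum>t\<in>T. (g t)\<^sup>2) \<le> (\<Sum>r\<in>R. (\<Sum>t\<in>T. g t * z r t)\<^sup>2)"
    and "(\<Sum>r\<in>R. (\<Sum>t\<in>T. g t * z r t)\<^sup>2) \<le> 5 * M * (\<Sum>t\<in>T. (g t)\<^sup>2)"
proof -
  define F where "F = (\<lambda>g :: 't \<Rightarrow> real. L2_set (\<lambda>r. \<Sum>t\<in>T. g t * z r t) R)"
  define nm where "nm = (\<lambda>g :: 't \<Rightarrow> real. L2_set g T)"
  have F2: "(F g)\<^sup>2 = (\<Sum>r\<in>R. (\<Sum>t\<in>T. g t * z r t)\<^sup>2)" for g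
    unfolding F_def L2_set_def by (simp add: sum_nonneg)
  have nm2: "(nm g)\<^sup>2 = (\<Sum>t\<in>T. (g t)\<^sup>2)" for g
    unfolding nm_def L2_set_def by (simp add: sum_nonneg)
  have F0: "F g \<ge> 0" for g by (simp add: F_def L2_set_nonneg)
  have nm0: "nm g \<ge> 0" for g by (simp add: nm_def L2_set_nonneg)
  have Fadd: "F (\<lambda>t. f t + g t) \<le> F f + F g" for f g
  proof -
    have "F (\<lambda>t. f t + g t) = L2_set (\<lambda>r. (\<Sum>t\<in>T. f t * z r t) + (\<Sum>t\<in>T. g t * z r t)) R"
      by (simp add: F_def sum.distrib distrib_right)
    also have "\<dots> \<le> F f + F g" unfolding F_def by (rule L2_set_triangle_ineq)
    finally show ?thesis .
  qed
  have nmadd: "nm (\<lambda>t. f t + g t) \<le> nm f + nm g" for f g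
    unfolding nm_def by (rule L2_set_triangle_ineq)
  have Fscale: "F (\<lambda>t. c * g t) = \<bar>c\<bar> * F g" for c g
  proof -
    have "F (\<lambda>t. c * g t) = L2_set (\<lambda>r. c * (\<Sum>t\<in>T. g t * z r t)) R"
      by (simp add: F_def sum_distrib_left mult.assoc)
    also have "\<dots> = \<bar>c\<bar> * F g"
      unfolding F_def L2_set_def by (simp add: power_mult_distrib sum_distrib_left[symmetric] real_sqrt_mult)
    finally show ?thesis .
  qed
  have nmscale: "nm (\<lambda>t. c * g t) = \<bar>c\<bar> * nm g" for c g
    unfolding nm_def L2_set_def by (simp add: power_mult_distrib sum_distrib_left[symmetric] real_sqrt_mult)
  have Fz: "F g = 0" if "nm g = 0" for g
  proof -
    have "\<forall>t\<in>T. g t = 0" using that T nm2[of g] by (simp add: sum_nonneg_eq_0_iff)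
    thus ?thesis by (simp add: F_def L2_set_def)
  qed
  define s where "s = sqrt M"
  have s: "s \<ge> 0" "s\<^sup>2 = M" using M by (auto simp: s_def)
  have Nup: "F n \<le> 2 * s * nm n" if "n \<in> N" for n
  proof (rule power2_le_imp_le)
    show "(F n)\<^sup>2 \<le> (2 * s * nm n)\<^sup>2" using N[OF that] by (simp add: F2 nm2 power_mult_distrib s)
  qed (use s nm0 in auto)
  \<comment> \<open>894/1000 is a rational lower bound for \<open>sqrt (4/5)\<close>.\<close>
  have Nlo: "894/1000 * s * nm n \<le> F n" if "n \<in> N" for n
  proof (rule power2_le_imp_le)
    have "(894/1000 * s * nm n)\<^sup>2 = (894/1000)\<^sup>2 * (M * (nm n)\<^sup>2)" by (simp only: power_mult_distrib s(2) mult.assoc)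
    also have "\<dots> \<le> 4/5 * (M * (nm n)\<^sup>2)" using M by (intro mult_right_mono) (auto simp: power2_eq_square)
    also have "\<dots> \<le> (F n)\<^sup>2" using N[OF that] by (simp add: F2 nm2)
    finally show "(894/1000 * s * nm n)\<^sup>2 \<le> (F n)\<^sup>2" .
  qed (rule F0)
  have net': "\<exists>n\<in>N. nm n \<le> 1 \<and> nm (\<lambda>t. g t - n t) \<le> 1/20" if "nm g = 1" for g
  proof -
    have "(\<Sum>t\<in>T. (g t)\<^sup>2) = 1" using nm2[of g] that by simp
    then obtain n where n: "n \<in> N" "(\<Sum>t\<in>T. (n t)\<^sup>2) \<le> 1" "(\<Sum>t\<in>T. (g t - n t)\<^sup>2) \<le> (1/20)\<^sup>2"
      using net by blast
    have "nm n \<le> 1" by (rule power2_le_imp_le) (use n(2) nm2 in simp_all)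
    moreover have "nm (\<lambda>t. g t - n t) \<le> 1/20" by (rule power2_le_imp_le) (use n(3) nm2 in simp_all)
    ultimately show ?thesis using n(1) by (intro bexI[of _ n] conjI)
  qed
  define A where "A = F ` {g. nm g = 1}"
  \<comment> \<open>The self-improving inequality is informative only for a finite supremum;
    Cauchy-Schwarz provides a crude bound.\<close>
  have bdd: "bdd_above A"
  proof -
    have "F g \<le> sqrt (\<Sum>r\<in>R. \<Sum>t\<in>T. (z r t)\<^sup>2)" if "nm g = 1" for g
    proof -
      have "(F g)\<^sup>2 \<le> (\<Sum>r\<in>R. (\<Sum>t\<in>T. (g t)\<^sup>2) * (\<Sum>t\<in>T. (z r t)\<^sup>2))"
        unfolding F2 by (intro sum_mono Cauchy_Schwarz_ineq_sum)
      also have "\<dots> = (\<Sum>r\<in>R. \<Sum>t\<in>T. (z r t)\<^sup>2)" using nm2[of g] that by simp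
      finally show ?thesis by (rule real_le_rsqrt)
    qed
    thus ?thesis unfolding A_def by (intro bdd_aboveI2) auto
  qed
  define D where "D = Sup A"
  have D: "F g \<le> D" if "nm g = 1" for g
    unfolding D_def by (rule cSup_upper[OF _ bdd]) (use that in \<open>auto simp: A_def\<close>)
  have D': "F g \<le> D * nm g" for g
  proof (cases "nm g = 0")
    case True thus ?thesis using Fz by simp
  next
    case False
    hence p: "nm g > 0" using nm0[of g] by simp
    have "nm (\<lambda>t. 1 / nm g * g t) = 1" using p nmscale[of "1 / nm g" g] by simp
    hence "F (\<lambda>t. 1 / nm g * g t) \<le> D" by (rule D)
    thus ?thesis using p unfolding Fscale by (simp add: field_simps)
  qed
  have step: "F g \<le> 2 * s + D / 20 \<and> 894/1000 * s * (19/20) - D / 20 \<le> F g" if g1: "nm g = 1" for g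
  proof -
    obtain n where n: "n \<in> N" "nm n \<le> 1" "nm (\<lambda>t. g t - n t) \<le> 1/20" using net'[OF g1] by blast
    have D0: "D \<ge> 0" using D[OF g1] F0[of g] by linarith
    have diff: "F (\<lambda>t. g t - n t) \<le> D / 20"
      using D'[of "\<lambda>t. g t - n t"] mult_left_mono[OF n(3) D0] by simp
    have neg: "F (\<lambda>t. n t - g t) = F (\<lambda>t. g t - n t)" using Fscale[of "-1" "\<lambda>t. g t - n t"] by simp
    have "F g \<le> F n + F (\<lambda>t. g t - n t)" using Fadd[of n "\<lambda>t. g t - n t"] by simp
    moreover have "F n \<le> 2 * s"
      using Nup[OF n(1)] mult_left_mono[OF n(2), of "2 * s"] s by simp
    moreover have "F n \<le> F g + F (\<lambda>t. n t - g t)" using Fadd[of g "\<lambda>t. n t - g t"] by simp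
    \<comment> \<open>Net points lie in the ball rather than on the sphere; being within 1/20 of a
      unit vector keeps their norm at least 19/20.\<close>
    moreover have "nm n \<ge> 19/20" using nmadd[of n "\<lambda>t. g t - n t"] n(3) g1 by simp
    hence "894/1000 * s * (19/20) \<le> 894/1000 * s * nm n" using s by (intro mult_left_mono) auto
    ultimately show ?thesis using diff neg Nlo[OF n(1)] D0 by linarith
  qed
  have unit: "s\<^sup>2 / 2 \<le> (F g)\<^sup>2 \<and> (F g)\<^sup>2 \<le> 5 * s\<^sup>2" if g: "nm g = 1" for g
  proof -
    have "D \<le> 2 * s + D / 20"
    proof -
      have "Sup A \<le> 2 * s + D / 20"
      proof (rule cSup_least)
        show "A \<noteq> {}" using g by (auto simp: A_def)
        show "x \<le> 2 * s + D / 20" if "x \<in> A" for x using that step by (auto simp: A_def)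
      qed
      thus ?thesis by (simp add: D_def)
    qed
    hence Ds: "D \<le> 40/19 * s" by simp
    have "F g \<le> 22/10 * s" using D[OF g] Ds s by linarith
    hence "(F g)\<^sup>2 \<le> (22/10 * s)\<^sup>2" using F0 by (rule power_mono)
    also have "\<dots> \<le> 5 * s\<^sup>2" by (simp add: power_mult_distrib power2_eq_square)
    finally have 1: "(F g)\<^sup>2 \<le> 5 * s\<^sup>2" .
    \<comment> \<open>The value 894/1000 times 19/20, minus a twentieth of 40/19, exceeds 72/100,
      whose square exceeds 1/2.\<close>
    have "72/100 * s \<le> F g" using step[OF g] Ds s by linarith
    hence "(72/100 * s)\<^sup>2 \<le> (F g)\<^sup>2" using s by (intro power_mono) auto
    moreover have "s\<^sup>2 / 2 \<le> (72/100 * s)\<^sup>2" by (simp add: power_mult_distrib power2_eq_square)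
    ultimately show ?thesis using 1 by linarith
  qed
  have "M / 2 * (nm g)\<^sup>2 \<le> (F g)\<^sup>2 \<and> (F g)\<^sup>2 \<le> 5 * M * (nm g)\<^sup>2"
  proof (cases "nm g = 0")
    case True thus ?thesis using Fz by simp
  next
    case False
    hence p: "nm g > 0" using nm0[of g] by simp
    have "nm (\<lambda>t. 1 / nm g * g t) = 1" using p nmscale[of "1 / nm g" g] by simp
    from unit[OF this] show ?thesis
      using p unfolding Fscale s by (simp add: power_mult_distrib power_divide field_simps)
  qed
  thus "M / 2 * (\<Sum>t\<in>T. (g t)\<^sup>2) \<le> (\<Sum>r\<in>R. (\<Sum>t\<in>T. g t * z r t)\<^sup>2)"
    and "(\<Sum>r\<in>R. (\<Sum>t\<in>T. g t * z r t)\<^sup>2) \<le> 5 * M * (\<Sum>t\<in>T. (g t)\<^sup>2)"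
    unfolding F2 nm2 by auto
qed

text \<open>Orthonormality makes the columns indexed by \<open>T\<close> independent standard
  Gaussians, so each net point yields a scaled chi-square variable. A union bound over the net fixes
  one event on which the estimate holds for all \<open>g\<close> at once, including later choices of
  \<open>g\<close> that depend on the data.\<close>

lemma gaussian_matrix_singular_values:
  fixes w :: "'t \<Rightarrow> nat \<Rightarrow> real" and m k :: nat
  assumes T: "finite T" "T \<noteq> {}"
    and orth: "\<And>s t. s \<in> T \<Longrightarrow> t \<in> T \<Longrightarrow> (\<Sum>j<k. w s j * w t j) = (if s = t then 1 else 0)"
  shows "\<exists>E \<in> sets (flat_law m k).
    emeasure (flat_law m k) (space (flat_law m k) - E) \<le> ennreal (2 * 2 ^ (402 * card T) * exp (- real m / 200)) \<and>
    (\<forall>\<omega>\<in>E. \<forall>g. real m / 2 * (\<Sum>t\<in>T. (g t)\<^sup>2) \<le> (\<Sum>r<m. (\<Sum>t\<in>T. g t * (\<Sum>j<k. w t j * \<omega> (r, j)))\<^sup>2)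
      \<and> (\<Sum>r<m. (\<Sum>t\<in>T. g t * (\<Sum>j<k. w t j * \<omega> (r, j)))\<^sup>2) \<le> 5 * real m * (\<Sum>t\<in>T. (g t)\<^sup>2))"
proof -
  let ?P = "flat_law m k"
  obtain N :: "('t \<Rightarrow> real) set" where N: "finite N" "card N \<le> 2 ^ (402 * card T)"
    "\<And>g. (\<Sum>t\<in>T. (g t)\<^sup>2) = 1 \<Longrightarrow> \<exists>n\<in>N. (\<Sum>t\<in>T. (n t)\<^sup>2) \<le> 1 \<and> (\<Sum>t\<in>T. (g t - n t)\<^sup>2) \<le> (1/20)\<^sup>2"
    using euclidean_net_exists[OF T] by blast
  define Z where "Z = (\<lambda>g \<omega>. \<Sum>r<m. (\<Sum>t\<in>T. g t * (\<Sum>j<k. w t j * \<omega> (r, j)))\<^sup>2)"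
  define ok where "ok = (\<lambda>n. {\<omega> \<in> space ?P. 4/5 * real m * (\<Sum>t\<in>T. (n t)\<^sup>2) \<le> Z n \<omega> \<and> Z n \<omega> \<le> 4 * real m * (\<Sum>t\<in>T. (n t)\<^sup>2)})"
  have Zm: "Z g \<in> borel_measurable ?P" for g
    unfolding Z_def by measurable
  have okm: "ok n \<in> sets ?P" for n unfolding ok_def using Zm[of n] by measurable
  have bad: "emeasure ?P (space ?P - ok n) \<le> ennreal (2 * exp (- real m / 200))" for n
  proof (cases "(\<Sum>t\<in>T. (n t)\<^sup>2) = 0")
    \<comment> \<open>The net may contain 0, where both inequalities are trivial and there is no
      normalised direction.\<close>
    case True
    hence "\<forall>t\<in>T. n t = 0" using T by (simp add: sum_nonneg_eq_0_iff)
    hence "ok n = space ?P" by (auto simp: ok_def Z_def)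
    thus ?thesis by simp
  next
    case False
    define q where "q = (\<Sum>t\<in>T. (n t)\<^sup>2)"
    have q: "q > 0" using False sum_nonneg[of T "\<lambda>t. (n t)\<^sup>2"] by (auto simp: q_def order.not_eq_order_implies_strict)
    define v where "v = (\<lambda>j. (\<Sum>t\<in>T. n t * w t j) / sqrt q)"
    have "(\<Sum>j<k. (\<Sum>t\<in>T. n t * w t j)\<^sup>2) = (\<Sum>j<k. \<Sum>s\<in>T. \<Sum>t\<in>T. n s * n t * (w s j * w t j))"
      by (simp add: power2_eq_square sum_product mult_ac)
    also have "\<dots> = (\<Sum>s\<in>T. \<Sum>t\<in>T. \<Sum>j<k. n s * n t * (w s j * w t j))"
      by (subst sum.swap) (intro sum.cong refl sum.swap)
    also have "\<dots> = (\<Sum>s\<in>T. \<Sum>t\<in>T. if s = t then n s * n t else 0)"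
      by (intro sum.cong refl) (simp add: sum_distrib_left[symmetric] orth)
    also have "\<dots> = q" using T by (simp add: q_def power2_eq_square)
    finally have v1: "(\<Sum>j<k. (v j)\<^sup>2) = 1"
      using q by (simp add: v_def power_divide sum_divide_distrib[symmetric])
    have lin: "(\<Sum>t\<in>T. n t * (\<Sum>j<k. w t j * \<omega> (r, j))) = sqrt q * (\<Sum>j<k. v j * \<omega> (r, j))" for \<omega> r
    proof -
      have "(\<Sum>t\<in>T. n t * (\<Sum>j<k. w t j * \<omega> (r, j))) = (\<Sum>t\<in>T. \<Sum>j<k. n t * w t j * \<omega> (r, j))"
        by (simp add: sum_distrib_left mult.assoc)
      also have "\<dots> = (\<Sum>j<k. \<Sum>t\<in>T. n t * w t j * \<omega> (r, j))" by (rule sum.swap)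
      also have "\<dots> = sqrt q * (\<Sum>j<k. v j * \<omega> (r, j))"
        using q by (simp add: v_def sum_distrib_left sum_distrib_right[symmetric])
      finally show ?thesis .
    qed
    have Zn: "Z n \<omega> = q * (\<Sum>r<m. (\<Sum>j<k. v j * \<omega> (r, j))\<^sup>2)" for \<omega>
    proof -
      have sc: "(sqrt q * x)\<^sup>2 = q * x\<^sup>2" for x using q by (simp add: power_mult_distrib)
      show ?thesis unfolding Z_def lin sc by (rule sum_distrib_left[symmetric])
    qed
    have "space ?P - ok n = {\<omega> \<in> space ?P. \<not> (4/5 * real m \<le> (\<Sum>r<m. (\<Sum>j<k. v j * \<omega> (r, j))\<^sup>2)
        \<and> (\<Sum>r<m. (\<Sum>j<k. v j * \<omega> (r, j))\<^sup>2) \<le> 4 * real m)}"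
      unfolding ok_def q_def[symmetric] Zn using q by (auto simp: mult.commute[of q] mult_le_cancel_right)
    thus ?thesis using chi_square_tails[OF v1, of m] by simp
  qed
  define E where "E = space ?P \<inter> (\<Inter>n\<in>N. ok n)"
  have Em: "E \<in> sets ?P"
  proof (cases "N = {}")
    case False
    have "(\<Inter>n\<in>N. ok n) \<in> sets ?P" using N(1) False okm by (intro sets.finite_INT) auto
    thus ?thesis unfolding E_def by auto
  qed (simp add: E_def)
  have "emeasure ?P (space ?P - E) \<le> emeasure ?P (\<Union>n\<in>N. space ?P - ok n)"
  proof (rule emeasure_mono)
    show "(\<Union>n\<in>N. space ?P - ok n) \<in> sets ?P"
      using N(1) okm by (intro sets.finite_UN sets.Diff sets.top) auto
  qed (auto simp: E_def)
  also have "\<dots> \<le> (\<Sum>n\<in>N. emeasure ?P (space ?P - ok n))"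
    by (rule emeasure_subadditive_finite) (use okm N(1) in auto)
  also have "\<dots> \<le> (\<Sum>n\<in>N. ennreal (2 * exp (- real m / 200)))"
    by (rule sum_mono) (rule bad)
  also have "\<dots> = ennreal (real (card N) * (2 * exp (- real m / 200)))"
    by (simp add: ennreal_mult' ennreal_of_nat_eq_real_of_nat)
  also have "\<dots> \<le> ennreal (2 * 2 ^ (402 * card T) * exp (- real m / 200))"
  proof (rule ennreal_leI)
    have "real (card N) \<le> real (2 ^ (402 * card T))" using N(2) by (simp only: of_nat_le_iff)
    hence "real (card N) * (2 * exp (- real m / 200)) \<le> 2 ^ (402 * card T) * (2 * exp (- real m / 200))"
      by (intro mult_right_mono) auto
    thus "real (card N) * (2 * exp (- real m / 200)) \<le> 2 * 2 ^ (402 * card T) * exp (- real m / 200)"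
      by (simp add: mult_ac)
  qed
  finally have bound: "emeasure ?P (space ?P - E) \<le> ennreal (2 * 2 ^ (402 * card T) * exp (- real m / 200))" .
  have good: "real m / 2 * (\<Sum>t\<in>T. (g t)\<^sup>2) \<le> Z g \<omega> \<and> Z g \<omega> \<le> 5 * real m * (\<Sum>t\<in>T. (g t)\<^sup>2)" if "\<omega> \<in> E" for \<omega> g
  proof -
    have nb: "4/5 * real m * (\<Sum>t\<in>T. (n t)\<^sup>2) \<le> Z n \<omega> \<and> Z n \<omega> \<le> 4 * real m * (\<Sum>t\<in>T. (n t)\<^sup>2)" if "n \<in> N" for n
      using \<open>\<omega> \<in> E\<close> that by (auto simp: E_def ok_def)
    show ?thesis
      unfolding Z_def
    proof (intro conjI)
      show "real m / 2 * (\<Sum>t\<in>T. (g t)\<^sup>2) \<le> (\<Sum>r<m. (\<Sum>t\<in>T. g t * (\<Sum>j<k. w t j * \<omega> (r, j)))\<^sup>2)"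
        by (rule net_norm_bounds(1)[OF T(1) _ _ N(3)]) (use nb[unfolded Z_def] in simp_all)
      show "(\<Sum>r<m. (\<Sum>t\<in>T. g t * (\<Sum>j<k. w t j * \<omega> (r, j)))\<^sup>2) \<le> 5 * real m * (\<Sum>t\<in>T. (g t)\<^sup>2)"
        by (rule net_norm_bounds(2)[OF T(1) _ _ N(3)]) (use nb[unfolded Z_def] in simp_all)
    qed
  qed
  show ?thesis
    by (rule bexI[OF _ Em], intro conjI bound ballI allI) (use good in \<open>auto simp: Z_def\<close>)
qed

section \<open>Linear systems and least squares\<close>

text \<open>The block on \<open>S\<close> is completed by the identity, so that matrices indexed by
  a set can use determinants and adjugates of the fixed dimension \<open>p\<close>.\<close>

definition pad_mat :: "nat \<Rightarrow> nat set \<Rightarrow> (nat \<Rightarrow> nat \<Rightarrow> real) \<Rightarrow> real mat" where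
  "pad_mat p S A = mat p p (\<lambda>(i, j). if i \<in> S \<and> j \<in> S then A i j else if i = j then 1 else 0)"

text \<open>The adjugate stands in for the inverse because its entries are polynomials in the
  entries of \<open>A\<close>, hence measurable across singular matrices too.\<close>

definition pad_adj :: "nat \<Rightarrow> nat set \<Rightarrow> (nat \<Rightarrow> nat \<Rightarrow> real) \<Rightarrow> nat \<Rightarrow> nat \<Rightarrow> real" where
  "pad_adj p S A i j = adj_mat (pad_mat p S A) $$ (i, j)"

lemma pad_mat_carrier: "pad_mat p S A \<in> carrier_mat p p"
  by (simp add: pad_mat_def)

lemma pad_mat_entry:
  assumes "S \<subseteq> {..<p}" "i \<in> S" "k \<in> S"
  shows "pad_mat p S A $$ (i, k) = A i k"
proof -
  have "i < p" "k < p" using assms by auto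
  thus ?thesis using assms by (simp add: pad_mat_def)
qed

text \<open>The block on \<open>S\<close> of the identity "matrix times adjugate is the
  determinant"; rows in \<open>S\<close> vanish outside \<open>S\<close>, so the sum over all
  columns shrinks to \<open>S\<close>.\<close>

lemma pad_adj_solve:
  assumes S: "S \<subseteq> {..<p}" and i: "i \<in> S" and j: "j \<in> S"
  shows "(\<Sum>k\<in>S. A i k * pad_adj p S A k j) = (if i = j then det (pad_mat p S A) else 0)"
proof -
  let ?M = "pad_mat p S A"
  have ij: "i < p" "j < p" using S i j by auto
  have C: "adj_mat ?M \<in> carrier_mat p p" by (rule adj_mat(1)[OF pad_mat_carrier])
  have "(?M * adj_mat ?M) $$ (i, j) = (\<Sum>k<p. ?M $$ (i, k) * adj_mat ?M $$ (k, j))"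
    using pad_mat_carrier[of p S A] C ij by (simp add: scalar_prod_def lessThan_atLeast0)
  also have "\<dots> = (\<Sum>k\<in>S. ?M $$ (i, k) * adj_mat ?M $$ (k, j))"
    using S i ij by (intro sum.mono_neutral_right) (auto simp: pad_mat_def)
  also have "\<dots> = (\<Sum>k\<in>S. A i k * pad_adj p S A k j)"
    using S i by (intro sum.cong refl) (simp add: pad_mat_entry pad_adj_def)
  finally show ?thesis
    using ij by (cases "i = j") (simp_all add: adj_mat(2)[OF pad_mat_carrier])
qed

text \<open>Rows outside \<open>S\<close> are rows of the identity, so a kernel vector of the padded
  matrix vanishes there and restricts to a kernel vector of the block.\<close>

lemma det_pad_mat_nonzero:
  assumes S: "S \<subseteq> {..<p}"
    and inj: "\<And>u. (\<And>i. i \<in> S \<Longrightarrow> (\<Sum>k\<in>S. A i k * u k) = 0) \<Longrightarrow> (\<forall>i\<in>S. u i = 0)"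
  shows "det (pad_mat p S A) \<noteq> 0"
proof
  let ?M = "pad_mat p S A"
  assume "det ?M = 0"
  then obtain v where v: "v \<in> carrier_vec p" "v \<noteq> 0\<^sub>v p" "?M *\<^sub>v v = 0\<^sub>v p"
    using det_0_iff_vec_prod_zero[OF pad_mat_carrier] by blast
  have row: "(\<Sum>k<p. ?M $$ (i, k) * v $ k) = 0" if "i < p" for i
  proof -
    have "(?M *\<^sub>v v) $ i = (\<Sum>k<p. ?M $$ (i, k) * v $ k)"
      using pad_mat_carrier[of p S A] that v(1) by (simp add: scalar_prod_def lessThan_atLeast0)
    thus ?thesis using v(3) that by simp
  qed
  have out: "v $ i = 0" if "i < p" "i \<notin> S" for i
  proof -
    have "(\<Sum>k<p. ?M $$ (i, k) * v $ k) = (\<Sum>k<p. if k = i then v $ k else 0)"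
      using that by (intro sum.cong refl) (auto simp: pad_mat_def)
    thus ?thesis using row[OF that(1)] that(1) by simp
  qed
  have "(\<Sum>k\<in>S. A i k * v $ k) = 0" if "i \<in> S" for i
  proof -
    have "(\<Sum>k<p. ?M $$ (i, k) * v $ k) = (\<Sum>k\<in>S. ?M $$ (i, k) * v $ k)"
      using S out by (intro sum.mono_neutral_right) auto
    also have "\<dots> = (\<Sum>k\<in>S. A i k * v $ k)"
      using S that by (intro sum.cong refl) (simp add: pad_mat_entry)
    finally show ?thesis using row[of i] that S by auto
  qed
  hence "\<forall>i\<in>S. v $ i = 0" by (rule inj)
  hence "v = 0\<^sub>v p" using out v(1) by (intro eq_vecI) auto
  thus False using v(2) by simp
qed

text \<open>Cramer's rule on the padded matrix. It provides the bias of the population regression on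
  the columns in \<open>S\<close>.\<close>

lemma linear_system_solvable:
  fixes p :: nat and A :: "nat \<Rightarrow> nat \<Rightarrow> real" and r :: "nat \<Rightarrow> real"
  assumes S: "S \<subseteq> {..<p}"
    and inj: "\<And>u. (\<And>i. i \<in> S \<Longrightarrow> (\<Sum>k\<in>S. A i k * u k) = 0) \<Longrightarrow> (\<forall>i\<in>S. u i = (0::real))"
  obtains b where "\<And>i. i \<in> S \<Longrightarrow> (\<Sum>k\<in>S. A i k * b k) = r i"
proof -
  define d where "d = det (pad_mat p S A)"
  have d: "d \<noteq> 0" unfolding d_def by (rule det_pad_mat_nonzero[OF S inj])
  have fS: "finite S" using S by (rule finite_subset) simp
  define b where "b = (\<lambda>k. (\<Sum>j\<in>S. pad_adj p S A k j * r j) / d)"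
  have "(\<Sum>k\<in>S. A i k * b k) = r i" if i: "i \<in> S" for i
  proof -
    have "(\<Sum>k\<in>S. A i k * b k) = (\<Sum>k\<in>S. \<Sum>j\<in>S. A i k * pad_adj p S A k j * r j / d)"
      by (simp add: b_def sum_distrib_left sum_divide_distrib mult.assoc)
    also have "\<dots> = (\<Sum>j\<in>S. (\<Sum>k\<in>S. A i k * pad_adj p S A k j) * r j / d)"
      by (subst sum.swap) (simp add: sum_distrib_right sum_divide_distrib)
    also have "\<dots> = (\<Sum>j\<in>S. if i = j then r j else 0)"
      using d by (intro sum.cong refl) (simp add: pad_adj_solve[OF S i] d_def[symmetric])
    also have "\<dots> = r i" using fS i by simp
    finally show ?thesis .
  qed
  thus ?thesis using that by blast
qed

lemma measurable_det:
  fixes A :: "'a \<Rightarrow> real mat"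
  assumes C: "\<And>x. A x \<in> carrier_mat n n"
    and m: "\<And>i j. i < n \<Longrightarrow> j < n \<Longrightarrow> (\<lambda>x. A x $$ (i, j)) \<in> borel_measurable N"
  shows "(\<lambda>x. det (A x)) \<in> borel_measurable N"
proof -
  have "(\<lambda>x. det (A x)) = (\<lambda>x. \<Sum>\<pi>\<in>{\<pi>. \<pi> permutes {0..<n}}. signof \<pi> * (\<Prod>i = 0..<n. A x $$ (i, \<pi> i)))"
    by (intro ext det_def'[OF C])
  also have "\<dots> \<in> borel_measurable N"
  proof (intro borel_measurable_sum borel_measurable_times borel_measurable_const borel_measurable_prod)
    fix \<pi> i assume "\<pi> \<in> {\<pi>. \<pi> permutes {0..<n}}" "i \<in> {0..<n}"
    hence "\<pi> i < n" "i < n" using permutes_in_image[of \<pi> "{0..<n}" i] by auto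
    thus "(\<lambda>x. A x $$ (i, \<pi> i)) \<in> borel_measurable N" by (intro m)
  qed
  finally show ?thesis .
qed

text \<open>Entries of the adjugate are signed minors, and deleting a row and a column only shifts
  indices.\<close>

lemma measurable_pad_adj:
  fixes A :: "'a \<Rightarrow> nat \<Rightarrow> nat \<Rightarrow> real"
  assumes S: "S \<subseteq> {..<p}" and ij: "i \<in> S" "j \<in> S"
    and m: "\<And>k l. k \<in> S \<Longrightarrow> l \<in> S \<Longrightarrow> (\<lambda>x. A x k l) \<in> borel_measurable N"
  shows "(\<lambda>x. pad_adj p S (A x) i j) \<in> borel_measurable N"
proof -
  have lt: "i < p" "j < p" using S ij by auto
  have entry: "(\<lambda>x. pad_mat p S (A x) $$ (k, l)) \<in> borel_measurable N" if "k < p" "l < p" for k l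
    using that m[of k l] by (cases "k \<in> S \<and> l \<in> S") (auto simp: pad_mat_def)
  have del: "mat_delete (pad_mat p S (A x)) j i \<in> carrier_mat (p - 1) (p - 1)" for x
    by (rule mat_delete_carrier[OF pad_mat_carrier])
  have "(\<lambda>x. det (mat_delete (pad_mat p S (A x)) j i)) \<in> borel_measurable N"
  proof (rule measurable_det[OF del])
    fix k l assume kl: "k < p - 1" "l < p - 1"
    have "mat_delete (pad_mat p S (A x)) j i $$ (k, l)
       = pad_mat p S (A x) $$ (if k < j then k else Suc k, if l < i then l else Suc l)" for x
      using kl by (simp add: mat_delete_def pad_mat_def)
    thus "(\<lambda>x. mat_delete (pad_mat p S (A x)) j i $$ (k, l)) \<in> borel_measurable N"
      using entry[of "if k < j then k else Suc k" "if l < i then l else Suc l"] kl by auto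
  qed
  hence "(\<lambda>x. (-1) ^ (j + i) * det (mat_delete (pad_mat p S (A x)) j i)) \<in> borel_measurable N" by simp
  moreover have "pad_adj p S (A x) i j = (-1) ^ (j + i) * det (mat_delete (pad_mat p S (A x)) j i)" for x
    using lt by (simp add: pad_adj_def adj_mat_def cofactor_def pad_mat_def)
  ultimately show ?thesis by simp
qed

lemma sum_sq_eq_qform:
  fixes X :: "nat \<Rightarrow> nat \<Rightarrow> real"
  shows "(\<Sum>r<m. (\<Sum>i\<in>S. X r i * u i)\<^sup>2) = (\<Sum>i\<in>S. \<Sum>j\<in>S. u i * (\<Sum>r<m. X r i * X r j) * u j)"
proof -
  have "(\<Sum>r<m. (\<Sum>i\<in>S. X r i * u i)\<^sup>2) = (\<Sum>r<m. \<Sum>i\<in>S. \<Sum>j\<in>S. u i * (X r i * X r j) * u j)"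
    by (simp add: power2_eq_square sum_product mult_ac)
  also have "\<dots> = (\<Sum>i\<in>S. \<Sum>r<m. \<Sum>j\<in>S. u i * (X r i * X r j) * u j)" by (rule sum.swap)
  also have "\<dots> = (\<Sum>i\<in>S. \<Sum>j\<in>S. \<Sum>r<m. u i * (X r i * X r j) * u j)" by (intro sum.cong refl sum.swap)
  also have "\<dots> = (\<Sum>i\<in>S. \<Sum>j\<in>S. u i * (\<Sum>r<m. X r i * X r j) * u j)"
    by (intro sum.cong refl) (simp only: sum_distrib_left sum_distrib_right)
  finally show ?thesis .
qed

text \<open>The column $i$ of the adjugate turns the event on the linear functional
  of the noise into a bound on the coordinate $v_i$ of the solution of the normal equations;
  multiplying by the determinant avoids dividing by it before it is known to be nonzero.\<close>

lemma normal_equations_coordinate_bound: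
  fixes X :: "nat \<Rightarrow> nat \<Rightarrow> real" and y v :: "nat \<Rightarrow> real"
  assumes S: "S \<subseteq> {..<p}" and i: "i \<in> S" and K: "K > 0" and s: "s \<ge> 0"
    and low: "\<And>u. K * (\<Sum>i\<in>S. (u i)\<^sup>2) \<le> (\<Sum>r<m. (\<Sum>i\<in>S. X r i * u i)\<^sup>2)"
    and normal: "\<And>j. j \<in> S \<Longrightarrow> (\<Sum>r<m. X r j * (y r - (\<Sum>k\<in>S. X r k * v k))) = 0"
  defines "G \<equiv> (\<lambda>j k. \<Sum>r<m. X r j * X r k)"
  defines "a \<equiv> (\<lambda>r. \<Sum>j\<in>S. pad_adj p S G j i * X r j)"
  assumes noise: "\<bar>\<Sum>r<m. a r * y r\<bar> \<le> s * sqrt (\<Sum>r<m. (a r)\<^sup>2)"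
  shows "\<bar>v i\<bar> \<le> s * sqrt (1 / K)"
proof -
  define d where "d = det (pad_mat p S G)"
  have fS: "finite S" using S by (rule finite_subset) simp
  have Gsym: "G j k = G k j" for j k by (simp add: G_def mult.commute)
  have sq: "(\<Sum>r<m. (\<Sum>i\<in>S. X r i * u i)\<^sup>2) = (\<Sum>i\<in>S. u i * (\<Sum>j\<in>S. G i j * u j))" for u
  proof -
    have "(\<Sum>r<m. (\<Sum>i\<in>S. X r i * u i)\<^sup>2) = (\<Sum>i\<in>S. \<Sum>j\<in>S. u i * G i j * u j)"
      unfolding sum_sq_eq_qform G_def ..
    also have "\<dots> = (\<Sum>i\<in>S. u i * (\<Sum>j\<in>S. G i j * u j))"
      by (intro sum.cong refl) (simp add: sum_distrib_left mult.assoc)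
    finally show ?thesis .
  qed
  have d0: "d \<noteq> 0"
    unfolding d_def
  proof (rule det_pad_mat_nonzero[OF S])
    fix u assume u: "\<And>i. i \<in> S \<Longrightarrow> (\<Sum>k\<in>S. G i k * u k) = 0"
    have "(\<Sum>r<m. (\<Sum>i\<in>S. X r i * u i)\<^sup>2) = 0" unfolding sq using u by simp
    hence "K * (\<Sum>i\<in>S. (u i)\<^sup>2) \<le> 0" using low[of u] by simp
    hence "(\<Sum>i\<in>S. (u i)\<^sup>2) \<le> 0" using K by (simp add: mult_le_0_iff)
    hence "(\<Sum>i\<in>S. (u i)\<^sup>2) = 0" using sum_nonneg[of S "\<lambda>i. (u i)\<^sup>2"] by simp
    thus "\<forall>i\<in>S. u i = 0" using fS by (simp add: sum_nonneg_eq_0_iff)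
  qed
  have solve: "(\<Sum>k\<in>S. G j k * pad_adj p S G k i) = (if j = i then d else 0)" if "j \<in> S" for j
    unfolding d_def by (rule pad_adj_solve[OF S that i])
  have nrm: "(\<Sum>r<m. X r j * y r) = (\<Sum>k\<in>S. G j k * v k)" if "j \<in> S" for j
  proof -
    have "(\<Sum>r<m. X r j * y r) = (\<Sum>r<m. \<Sum>k\<in>S. X r j * X r k * v k)"
      using normal[OF that] by (simp add: right_diff_distrib sum_subtractf sum_distrib_left mult.assoc)
    also have "\<dots> = (\<Sum>k\<in>S. \<Sum>r<m. X r j * X r k * v k)" by (rule sum.swap)
    finally show ?thesis by (simp add: G_def sum_distrib_right)
  qed
  \<comment> \<open>The weights \<open>a\<close> combine the columns of \<open>X\<close> with column
    \<open>i\<close> of the adjugate of the Gram matrix, so the normal equations reduce their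
    pairing with \<open>y\<close> to the determinant times coordinate \<open>i\<close>.\<close>
  have lin: "(\<Sum>r<m. a r * y r) = d * v i"
  proof -
    have "(\<Sum>r<m. a r * y r) = (\<Sum>r<m. \<Sum>j\<in>S. pad_adj p S G j i * (X r j * y r))"
      by (simp add: a_def sum_distrib_right mult.assoc)
    also have "\<dots> = (\<Sum>j\<in>S. pad_adj p S G j i * (\<Sum>r<m. X r j * y r))"
      by (subst sum.swap) (simp add: sum_distrib_left)
    also have "\<dots> = (\<Sum>j\<in>S. \<Sum>k\<in>S. G k j * pad_adj p S G j i * v k)"
    proof (rule sum.cong[OF refl])
      fix j assume "j \<in> S"
      thus "pad_adj p S G j i * (\<Sum>r<m. X r j * y r) = (\<Sum>k\<in>S. G k j * pad_adj p S G j i * v k)"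
        unfolding nrm[OF \<open>j \<in> S\<close>] sum_distrib_left by (intro sum.cong refl) (simp add: Gsym[of j])
    qed
    also have "\<dots> = (\<Sum>k\<in>S. (\<Sum>j\<in>S. G k j * pad_adj p S G j i) * v k)"
      by (subst sum.swap) (simp add: sum_distrib_right)
    also have "\<dots> = (\<Sum>k\<in>S. if k = i then d * v k else 0)"
      by (intro sum.cong refl) (simp add: solve)
    finally show ?thesis using fS i by simp
  qed
  \<comment> \<open>Column \<open>i\<close> of the inverse Gram matrix. The squared norm
    \<open>q\<close> of \<open>X u\<close> is then the diagonal entry \<open>u i\<close> of that
    inverse, and \<open>a\<close> is \<open>d\<close> times \<open>X u\<close>.\<close>
  define u where "u = (\<lambda>j. pad_adj p S G j i / d)"
  define q where "q = (\<Sum>r<m. (\<Sum>j\<in>S. X r j * u j)\<^sup>2)"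
  have aq: "(\<Sum>r<m. (a r)\<^sup>2) = d\<^sup>2 * q"
  proof -
    have ar: "a r = d * (\<Sum>j\<in>S. X r j * u j)" for r
      using d0 by (simp add: a_def u_def sum_distrib_left mult.commute)
    show ?thesis unfolding q_def ar power_mult_distrib by (rule sum_distrib_left[symmetric])
  qed
  have "q = (\<Sum>j\<in>S. u j * (\<Sum>k\<in>S. G j k * u k))" unfolding q_def by (rule sq)
  also have "\<dots> = (\<Sum>j\<in>S. u j * (if j = i then 1 else 0))"
  proof (intro sum.cong refl)
    fix j assume j: "j \<in> S"
    have "(\<Sum>k\<in>S. G j k * u k) = (\<Sum>k\<in>S. G j k * pad_adj p S G k i) / d"
      by (simp add: u_def sum_divide_distrib)
    thus "u j * (\<Sum>k\<in>S. G j k * u k) = u j * (if j = i then 1 else 0)"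
      using d0 by (simp add: solve[OF j])
  qed
  also have "\<dots> = (\<Sum>j\<in>S. if j = i then u j else 0)" by (intro sum.cong) auto
  also have "\<dots> = u i" using fS i by simp
  finally have qu: "q = u i" .
  \<comment> \<open>As \<open>q\<close> is a coordinate of \<open>u\<close>, the lower bound on the
    Gram matrix gives \<open>K q^2 <= K |u|^2 <= q\<close>, hence \<open>q <= 1 / K\<close>.\<close>
  have "K * q\<^sup>2 \<le> K * (\<Sum>j\<in>S. (u j)\<^sup>2)"
    unfolding qu using fS i K by (intro mult_left_mono member_le_sum) auto
  also have "\<dots> \<le> q" unfolding q_def by (rule low)
  finally have Kq: "K * q\<^sup>2 \<le> q" .
  have q0: "q \<ge> 0" unfolding q_def by (intro sum_nonneg) auto
  have "q \<le> 1 / K"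
  proof (cases "q = 0")
    case False
    hence "q > 0" using q0 by simp
    moreover have "K * q * q \<le> 1 * q" using Kq by (simp add: power2_eq_square mult.assoc)
    ultimately have "K * q \<le> 1" by (simp only: mult_le_cancel_right)
    thus ?thesis using K by (simp add: field_simps)
  qed (use K in simp)
  hence sq_le: "sqrt q \<le> sqrt (1 / K)" by simp
  have "\<bar>d\<bar> * \<bar>v i\<bar> \<le> s * (\<bar>d\<bar> * sqrt q)"
    using noise unfolding lin aq by (simp add: abs_mult real_sqrt_mult)
  hence "\<bar>d\<bar> * \<bar>v i\<bar> \<le> \<bar>d\<bar> * (s * sqrt q)" by (simp add: mult_ac)
  hence "\<bar>v i\<bar> \<le> s * sqrt q" using d0 by simp
  also have "\<dots> \<le> s * sqrt (1 / K)" using sq_le s by (rule mult_left_mono)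
  finally show ?thesis .
qed

section \<open>Least squares and sparse approximation\<close>

lemma sum_restrict_support:
  fixes t :: "nat \<Rightarrow> real"
  assumes "S \<subseteq> {..<p}" "\<And>j. j \<notin> S \<Longrightarrow> t j = 0"
  shows "(\<Sum>j<p. X j * t j) = (\<Sum>j\<in>S. X j * t j)"
  using assms by (intro sum.mono_neutral_right) auto

text \<open>Moving a minimiser along a coordinate in \<open>S\<close> keeps its support, so the
  change of the sum of squares is a nonnegative quadratic in the step, whose linear coefficient must
  vanish.\<close>

lemma least_squares_normal_equations:
  assumes S: "S \<subseteq> {..<p}" and ls: "is_ls_S m p S Y X t" and j: "j \<in> S"
  shows "(\<Sum>r<m. X r j * (Y r - (\<Sum>k\<in>S. X r k * t k))) = 0"
proof -
  define res where "res = (\<lambda>r. Y r - (\<Sum>k\<in>S. X r k * t k))"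
  have t0: "t k = 0" if "k \<notin> S" for k using ls that by (auto simp: is_ls_S_def)
  have fS: "finite S" using S by (rule finite_subset) simp
  have R: "RSS m p Y X t' = (\<Sum>r<m. (Y r - (\<Sum>k\<in>S. X r k * t' k))\<^sup>2)" if "\<And>k. k \<notin> S \<Longrightarrow> t' k = 0" for t'
    unfolding RSS_def using sum_restrict_support[OF S that] by simp
  have "(\<Sum>r<m. X r j * res r) = 0"
  proof (rule quadratic_nonneg_imp_linear_zero)
    fix e :: real
    define t' where "t' = (\<lambda>k. t k - e * (if k = j then 1 else 0))"
    have t'0: "t' k = 0" if "k \<notin> S" for k using that j t0 by (auto simp: t'_def)
    have "RSS m p Y X t \<le> RSS m p Y X t'" using ls t'0 by (auto simp: is_ls_S_def)
    moreover have "RSS m p Y X t' = RSS m p Y X t + (2 * e * (\<Sum>r<m. X r j * res r) + e\<^sup>2 * (\<Sum>r<m. (X r j)\<^sup>2))"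
    proof -
      have sk: "(\<Sum>k\<in>S. X r k * t' k) = (\<Sum>k\<in>S. X r k * t k) - e * X r j" for r
      proof -
        have "(\<Sum>k\<in>S. X r k * t' k) = (\<Sum>k\<in>S. X r k * t k - (if k = j then e * X r k else 0))"
          by (intro sum.cong refl) (auto simp: t'_def algebra_simps)
        thus ?thesis using fS j by (simp add: sum_subtractf)
      qed
      have "RSS m p Y X t' = (\<Sum>r<m. (Y r - ((\<Sum>k\<in>S. X r k * t k) - e * X r j))\<^sup>2)"
        using R[of t', OF t'0] unfolding sk .
      also have "\<dots> = (\<Sum>r<m. (res r + e * X r j)\<^sup>2)"
        by (intro sum.cong refl arg_cong[where f = "\<lambda>x. x\<^sup>2"]) (simp add: res_def)
      also have "\<dots> = (\<Sum>r<m. (res r)\<^sup>2 + (2 * e * (X r j * res r) + e\<^sup>2 * (X r j)\<^sup>2))"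
        by (intro sum.cong refl) (simp add: power2_eq_square algebra_simps)
      also have "\<dots> = (\<Sum>r<m. (res r)\<^sup>2) + (2 * e * (\<Sum>r<m. X r j * res r) + e\<^sup>2 * (\<Sum>r<m. (X r j)\<^sup>2))"
        by (simp add: sum.distrib sum_distrib_left)
      also have "(\<Sum>r<m. (res r)\<^sup>2) = RSS m p Y X t" using R[of t, OF t0] by (simp add: res_def)
      finally show ?thesis .
    qed
    ultimately show "0 \<le> 2 * e * (\<Sum>r<m. X r j * res r) + e\<^sup>2 * (\<Sum>r<m. (X r j)\<^sup>2)" by linarith
  qed
  thus ?thesis by (simp add: res_def)
qed

text \<open>Setting \<theta> to zero on \<open>R\<close> leaves at most \<open>k\<close> nonzero
  coordinates and so gives a competitor in the infimum.\<close>

lemma d2_B0_le: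
  assumes R: "R \<subseteq> {i \<in> {..<p}. \<theta> i \<noteq> 0}" and card: "l0 p \<theta> \<le> k + card R"
  shows "(d2_B0 p k \<theta>)\<^sup>2 \<le> (\<Sum>i\<in>R. (\<theta> i)\<^sup>2)"
proof -
  define u where "u = (\<lambda>i. if i \<in> R then 0 else \<theta> i)"
  have fR: "finite R" using R by (rule finite_subset) simp
  have "{i \<in> {..<p}. u i \<noteq> 0} = {i \<in> {..<p}. \<theta> i \<noteq> 0} - R" by (auto simp: u_def)
  hence "l0 p u = l0 p \<theta> - card R" using R fR by (simp add: l0_def card_Diff_subset)
  hence u: "l0 p u \<le> k" using card by simp
  have "(\<Sum>i<p. (\<theta> i - u i)\<^sup>2) = (\<Sum>i\<in>R. (\<theta> i - u i)\<^sup>2)"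
    using R by (intro sum.mono_neutral_right) (auto simp: u_def)
  also have "\<dots> = (\<Sum>i\<in>R. (\<theta> i)\<^sup>2)" by (simp add: u_def)
  finally have dist: "(\<Sum>i<p. (\<theta> i - u i)\<^sup>2) = (\<Sum>i\<in>R. (\<theta> i)\<^sup>2)" .
  let ?D = "{sqrt (\<Sum>i<p. (\<theta> i - u i)\<^sup>2) | u. l0 p u \<le> k}"
  have mem: "sqrt (\<Sum>i\<in>R. (\<theta> i)\<^sup>2) \<in> ?D" using u dist by force
  have nonneg: "0 \<le> x" if "x \<in> ?D" for x using that by (auto intro!: sum_nonneg)
  have "d2_B0 p k \<theta> \<le> sqrt (\<Sum>i\<in>R. (\<theta> i)\<^sup>2)"
    unfolding d2_B0_def by (rule cInf_lower[OF mem]) (use nonneg in \<open>auto intro!: bdd_belowI\<close>)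
  moreover have "0 \<le> d2_B0 p k \<theta>"
    unfolding d2_B0_def by (rule cInf_greatest) (use mem nonneg in blast)+
  ultimately have "(d2_B0 p k \<theta>)\<^sup>2 \<le> (sqrt (\<Sum>i\<in>R. (\<theta> i)\<^sup>2))\<^sup>2" by (intro power_mono)
  thus ?thesis by (simp add: sum_nonneg)
qed

section \<open>Counting discoveries\<close>

lemma card_mult_le_sum_squares:
  fixes b :: "nat \<Rightarrow> real"
  assumes "finite A" "\<And>i. i \<in> A \<Longrightarrow> t \<le> \<bar>b i\<bar>" "t \<ge> 0"
  shows "real (card A) * t\<^sup>2 \<le> (\<Sum>i\<in>A. (b i)\<^sup>2)"
proof -
  have "(\<Sum>i\<in>A. t\<^sup>2) \<le> (\<Sum>i\<in>A. (b i)\<^sup>2)"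
  proof (rule sum_mono)
    fix i assume "i \<in> A"
    hence "t\<^sup>2 \<le> \<bar>b i\<bar>\<^sup>2" using assms by (intro power_mono) auto
    thus "t\<^sup>2 \<le> (b i)\<^sup>2" by simp
  qed
  thus ?thesis by simp
qed

text \<open>In terms of the sample: \<open>b\<close> is the bias of the population regression on the columns
  in \<open>S\<close>, \<open>\<tau>\<close> the residual standard deviation, \<open>sh\<close> its estimate, and
  \<open>l\<close> stands for $\sqrt{\log(4e/\delta)}$.\<close>

locale threshold_estimate =
  fixes p m :: nat and \<theta> th b :: "nat \<Rightarrow> real" and S :: "nat set"
    and \<sigma> \<tau> \<eta> a1 a2 a3 clow l sh lam :: real
  assumes \<eta>: "\<eta> > 1" and \<sigma>: "\<sigma> > 0" and \<tau>: "\<sigma> \<le> \<tau>" and a1: "a1 > 0" and a3: "a3 > 0" and l: "l \<ge> 1"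
    and lam: "lam > 0" and lam_def: "lam = sqrt (ln (real p) / real m)"
    and pS: "propS p m \<theta> \<sigma> a1 a2 a3 S"
    and clow: "clow \<ge> sqrt 2 * a1 + 11 * \<eta>^2 * max a3 1 * l"
    and th0: "\<And>i. i \<notin> S \<Longrightarrow> th i = 0"
    and th: "\<And>i. i \<in> S \<Longrightarrow> \<bar>th i - \<theta> i - b i\<bar> \<le> 2 * \<tau> * sqrt \<eta> * l * lam"
    and b: "(\<Sum>i\<in>S. (b i)\<^sup>2) \<le> \<eta>\<^sup>2 * (\<Sum>i\<in>{..<p} - S. (\<theta> i)\<^sup>2)"
    and \<tau>2: "\<tau>\<^sup>2 \<le> \<sigma>\<^sup>2 + \<eta> * (\<Sum>i\<in>{..<p} - S. (\<theta> i)\<^sup>2)"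
    and sh: "\<tau>\<^sup>2 / 2 \<le> sh\<^sup>2" "sh\<^sup>2 \<le> 5 * \<tau>\<^sup>2" "sh \<ge> 0"
begin

definition "small = {i \<in> {..<p}. 0 < \<bar>\<theta> i / \<sigma>\<bar> \<and> \<bar>\<theta> i / \<sigma>\<bar> \<le> a1 * lam}"
definition "supp = {i \<in> {..<p}. \<theta> i \<noteq> 0}"
definition "found = {i \<in> {..<p}. \<bar>th i / sh\<bar> \<ge> clow * lam}"

lemma card_small: "Mcount p m a1 (\<lambda>i. \<theta> i / \<sigma>) = card small"
  by (simp add: Mcount_def small_def lam_def[symmetric])

lemma card_supp: "l0 p \<theta> = card supp"
  unfolding l0_def supp_def ..

lemma card_found: "Ncount p m clow (\<lambda>i. th i / sh) = card found"
  by (simp add: Ncount_def found_def lam_def[symmetric])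

lemma finite_sets: "finite small" "finite supp" "finite found" "finite S" "S \<subseteq> {..<p}" "small \<subseteq> supp"
  using pS \<sigma> finite_subset[of S "{..<p}"] by (auto simp: small_def supp_def found_def propS_def)

lemma \<tau>_pos: "\<tau> > 0" using \<sigma> \<tau> by simp

lemma sh_pos: "sh > 0"
proof -
  have "sh\<^sup>2 > 0" using sh(1) \<tau>_pos by (intro less_le_trans[OF _ sh(1)]) auto
  thus ?thesis using sh(3) by (simp add: zero_less_power2 order.not_eq_order_implies_strict)
qed

lemma sh_lower: "\<tau> / sqrt 2 \<le> sh"
  by (rule power2_le_imp_le) (use sh in \<open>simp_all add: power_divide\<close>)

text \<open>23/10 is a rational upper bound for \<open>sqrt 5\<close>.\<close>

lemma sh_upper: "sh \<le> 23/10 * \<tau>"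
proof (rule power2_le_imp_le)
  have "sh\<^sup>2 \<le> 5 * \<tau>\<^sup>2" by (rule sh(2))
  also have "\<dots> \<le> (23/10 * \<tau>)\<^sup>2" by (simp add: power_mult_distrib power2_eq_square)
  finally show "sh\<^sup>2 \<le> (23/10 * \<tau>)\<^sup>2" .
qed (use \<tau>_pos in simp)

lemma sqrt_\<eta>: "sqrt \<eta> \<le> \<eta>\<^sup>2" "1 \<le> \<eta>\<^sup>2"
proof -
  show 1: "1 \<le> \<eta>\<^sup>2" using \<eta> by simp
  have "\<eta> * 1 \<le> \<eta> * \<eta>" using \<eta> by (intro mult_left_mono) auto
  moreover have "sqrt \<eta> \<le> \<eta>"
    using \<eta> by (intro real_le_lsqrt) (auto simp: power2_eq_square)
  ultimately show "sqrt \<eta> \<le> \<eta>\<^sup>2" by (simp add: power2_eq_square)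
qed

lemma clow_bounds: "clow \<ge> a1" "clow \<ge> a3" "clow \<ge> 11 * (sqrt \<eta> * l)" "clow > 0"
proof -
  define X where "X = \<eta>\<^sup>2 * max a3 1 * l"
  have "1 * max a3 1 \<le> \<eta>\<^sup>2 * max a3 1" using sqrt_\<eta>(2) by (intro mult_right_mono) auto
  hence "max a3 1 * 1 \<le> X" unfolding X_def using l by (intro mult_mono) auto
  hence X1: "X \<ge> a3" "X \<ge> 1" by auto
  have "\<eta>\<^sup>2 * 1 \<le> \<eta>\<^sup>2 * max a3 1" by (intro mult_left_mono) auto
  hence "sqrt \<eta> \<le> \<eta>\<^sup>2 * max a3 1" using sqrt_\<eta>(1) by simp
  hence X2: "sqrt \<eta> * l \<le> X" unfolding X_def using l by (intro mult_right_mono) auto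
  have "1 * a1 \<le> sqrt 2 * a1" using a1 by (intro mult_right_mono) auto
  moreover have "clow \<ge> sqrt 2 * a1 + 11 * X" using clow by (simp add: X_def mult.assoc)
  ultimately show "clow \<ge> a1" "clow \<ge> a3" "clow \<ge> 11 * (sqrt \<eta> * l)" "clow > 0"
    using X1 X2 a1 a3 by linarith+
qed

lemma rest_le: "(\<Sum>i\<in>{..<p} - S. (\<theta> i)\<^sup>2) \<le> a3\<^sup>2 * \<sigma>\<^sup>2 * real (card small) * lam\<^sup>2"
proof -
  have "ln (real p) / real m > 0" using lam unfolding lam_def by simp
  hence "lam\<^sup>2 = ln (real p) / real m" unfolding lam_def by simp
  thus ?thesis using pS by (simp add: propS_def card_small)
qed

text \<open>Let \<open>X = \<eta>^2 * max a3 1 * l * \<tau> * lam\<close>. Outside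
  \<open>supp - small\<close> the signal is at most \<open>a1 * lam * \<tau>\<close>, while a
  discovery has an estimate of at least \<open>clow * lam * sh\<close>. Since \<open>sh\<close> may
  be as low as \<open>\<tau> / sqrt 2\<close>, this is at least \<open>a1 * lam * \<tau>\<close>
  plus \<open>11 / sqrt 2 >= 7\<close> times \<open>X\<close>; the noise uses at most
  \<open>2 X\<close>, so the bias must supply \<open>5 X\<close>.\<close>

lemma found_subset: "found \<subseteq> (supp - small) \<union> {i \<in> S. \<bar>b i\<bar> \<ge> 5 * \<eta>\<^sup>2 * max a3 1 * l * \<tau> * lam}"
proof
  fix i assume i: "i \<in> found"
  hence ip: "i < p" and big: "clow * lam * sh \<le> \<bar>th i\<bar>"
    using sh_pos by (auto simp: found_def abs_divide field_simps)
  have "clow * lam * sh > 0" using clow_bounds(4) lam sh_pos by simp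
  have iS: "i \<in> S"
  proof (rule ccontr)
    assume "i \<notin> S"
    thus False using th0[of i] big \<open>clow * lam * sh > 0\<close> by simp
  qed
  show "i \<in> (supp - small) \<union> {i \<in> S. \<bar>b i\<bar> \<ge> 5 * \<eta>\<^sup>2 * max a3 1 * l * \<tau> * lam}"
  proof (cases "i \<in> supp - small")
    case False
    define X where "X = \<eta>\<^sup>2 * max a3 1 * l * \<tau> * lam"
    have X0: "X \<ge> 0" using \<tau>_pos lam l by (simp add: X_def)
    have "\<bar>\<theta> i\<bar> \<le> a1 * lam * \<sigma>"
      using False ip \<sigma> a1 lam by (cases "\<theta> i = 0") (auto simp: supp_def small_def abs_divide field_simps)
    also have "\<dots> \<le> a1 * lam * \<tau>" using \<tau> a1 lam by (intro mult_left_mono) auto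
    finally have \<theta>i: "\<bar>\<theta> i\<bar> \<le> a1 * lam * \<tau>" .
    have "(sqrt 2 * a1 + 11 * \<eta>^2 * max a3 1 * l) * lam * (\<tau> / sqrt 2) \<le> clow * lam * sh"
      using clow sh_lower lam \<tau>_pos clow_bounds(4) by (intro mult_mono mult_right_mono) auto
    moreover have "(sqrt 2 * a1 + 11 * \<eta>^2 * max a3 1 * l) * lam * (\<tau> / sqrt 2) = a1 * lam * \<tau> + (11 / sqrt 2) * X"
      by (simp add: X_def field_simps)
    moreover have "7 * X \<le> (11 / sqrt 2) * X"
    proof (rule mult_right_mono[OF _ X0])
      have "sqrt 2 \<le> 11/7" by (intro real_le_lsqrt) (auto simp: power2_eq_square)
      thus "7 \<le> 11 / sqrt 2" by (simp add: field_simps)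
    qed
    moreover have "2 * \<tau> * sqrt \<eta> * l * lam \<le> 2 * X"
    proof -
      have "\<eta>\<^sup>2 * 1 \<le> \<eta>\<^sup>2 * max a3 1" by (intro mult_left_mono) auto
      hence "sqrt \<eta> \<le> \<eta>\<^sup>2 * max a3 1" using sqrt_\<eta>(1) by simp
      hence "sqrt \<eta> * (l * \<tau> * lam) \<le> \<eta>\<^sup>2 * max a3 1 * (l * \<tau> * lam)"
        using l \<tau>_pos lam by (intro mult_right_mono) auto
      thus ?thesis by (simp add: X_def mult_ac)
    qed
    ultimately have "5 * X \<le> \<bar>b i\<bar>" using big \<theta>i th[OF iS] by linarith
    thus ?thesis using iS by (simp add: X_def mult.assoc)
  qed simp
qed

text \<open>Each coordinate with a bias as large as in \<open>found_subset\<close> contributes at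
  least \<open>(\<eta> * a3 * \<sigma> * lam)^2\<close> to the squared norm of \<open>b\<close>,
  which is at most \<open>card small\<close> times that amount. Hence the set \<open>Bs\<close> of
  such coordinates makes up at most for the removal of \<open>small\<close> from the
  support.\<close>

lemma card_found_le: "card found \<le> card supp"
proof -
  define t where "t = 5 * \<eta>\<^sup>2 * max a3 1 * l * \<tau> * lam"
  define Bs where "Bs = {i \<in> S. \<bar>b i\<bar> \<ge> t}"
  have fB: "finite Bs" "Bs \<subseteq> S" using finite_sets by (auto simp: Bs_def)
  define Y where "Y = a3\<^sup>2 * \<sigma>\<^sup>2 * lam\<^sup>2"
  have Y: "Y > 0" using a3 \<sigma> lam by (simp add: Y_def)
  have t: "\<eta> * a3 * \<sigma> * lam \<le> t"
  proof -
    have "\<eta> * 1 \<le> \<eta> * \<eta>" using \<eta> by (intro mult_left_mono) auto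
    hence "\<eta> \<le> 5 * \<eta>\<^sup>2" using \<eta> unfolding power2_eq_square by linarith
    hence "\<eta> * a3 \<le> 5 * \<eta>\<^sup>2 * max a3 1" using \<eta> a3 by (intro mult_mono) auto
    hence "\<eta> * a3 * 1 \<le> 5 * \<eta>\<^sup>2 * max a3 1 * l" by (rule mult_mono) (use l \<eta> a3 in auto)
    hence "\<eta> * a3 * 1 * \<sigma> \<le> 5 * \<eta>\<^sup>2 * max a3 1 * l * \<tau>" by (rule mult_mono) (use \<tau> l \<eta> a3 \<sigma> in auto)
    thus ?thesis unfolding t_def using lam by (intro mult_right_mono) auto
  qed
  have t0: "\<eta> * a3 * \<sigma> * lam \<ge> 0" using \<eta> a3 \<sigma> lam by simp
  have "real (card Bs) * (\<eta> * a3 * \<sigma> * lam)\<^sup>2 \<le> (\<Sum>i\<in>Bs. (b i)\<^sup>2)"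
    using fB t t0 by (intro card_mult_le_sum_squares) (auto simp: Bs_def)
  also have "\<dots> \<le> (\<Sum>i\<in>S. (b i)\<^sup>2)" using finite_sets fB by (intro sum_mono2) auto
  also have "\<dots> \<le> \<eta>\<^sup>2 * (a3\<^sup>2 * \<sigma>\<^sup>2 * real (card small) * lam\<^sup>2)"
    using b rest_le by (meson order_trans mult_left_mono zero_le_power2)
  finally have "\<eta>\<^sup>2 * Y * real (card Bs) \<le> \<eta>\<^sup>2 * Y * real (card small)"
    by (simp add: Y_def power_mult_distrib mult_ac)
  hence "card Bs \<le> card small" using Y \<eta> by (simp add: mult_le_cancel_left)
  moreover have "card found \<le> card (supp - small) + card Bs"
    using found_subset finite_sets fB
    by (intro order_trans[OF card_mono card_Un_le]) (auto simp: Bs_def t_def)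
  moreover have "card (supp - small) = card supp - card small"
    using finite_sets by (intro card_Diff_subset) auto
  moreover have "card small \<le> card supp" using finite_sets by (intro card_mono) auto
  ultimately show ?thesis by linarith
qed

text \<open>The factor 23/10 from \<open>sh_upper\<close> and the 2/11 of the threshold that bounds
  the noise add up to less than 3; squaring \<open>3 x + |b i|\<close> then gives 18 and 2.\<close>

lemma missed_le:
  assumes i: "i \<in> S" "i \<in> {..<p} - found"
  shows "(\<theta> i)\<^sup>2 \<le> 18 * clow\<^sup>2 * \<tau>\<^sup>2 * lam\<^sup>2 + 2 * (b i)\<^sup>2"
proof -
  have "\<bar>th i\<bar> \<le> clow * lam * sh"
    using i sh_pos by (auto simp: found_def abs_divide field_simps)
  also have "\<dots> \<le> clow * lam * (23/10 * \<tau>)"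
    using sh_upper clow_bounds(4) lam by (intro mult_left_mono) auto
  finally have 1: "\<bar>th i\<bar> \<le> 23/10 * (clow * \<tau> * lam)" by (simp add: mult_ac)
  have "11 * (sqrt \<eta> * l) * (\<tau> * lam) \<le> clow * (\<tau> * lam)"
    using clow_bounds(3) \<tau>_pos lam by (intro mult_right_mono) auto
  hence "2 * \<tau> * sqrt \<eta> * l * lam \<le> 2/11 * (clow * \<tau> * lam)" by (simp add: mult_ac)
  moreover have "clow * \<tau> * lam \<ge> 0" using clow_bounds(4) \<tau>_pos lam by simp
  ultimately have "\<bar>\<theta> i\<bar> \<le> 3 * (clow * \<tau> * lam) + \<bar>b i\<bar>"
    using th[OF i(1)] 1 by linarith
  hence "(\<theta> i)\<^sup>2 \<le> (3 * (clow * \<tau> * lam) + \<bar>b i\<bar>)\<^sup>2" by (rule abs_le_square_iff[THEN iffD1, OF order_trans]) simp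
  also have "\<dots> \<le> 2 * (3 * (clow * \<tau> * lam))\<^sup>2 + 2 * \<bar>b i\<bar>\<^sup>2"
    using sum_squares_bound[of "3 * (clow * \<tau> * lam)" "\<bar>b i\<bar>"] by (simp add: power2_sum)
  finally show ?thesis by (simp add: power_mult_distrib mult_ac)
qed

text \<open>Contrapositive of the power statement: too few discoveries force \<theta> close to the
  \<open>k\<close>-sparse vectors, because \<open>card supp - k\<close> coordinates can be removed
  cheaply. The factor containing \<open>a3\<close> comes from \<tau>, since the signal left outside
  \<open>S\<close> inflates the residual variance.\<close>

lemma power_bound:
  assumes k: "k < card supp" "card found \<le> k"
  shows "(d2_B0 p k \<theta>)\<^sup>2 \<le> (18 * \<eta> + 2 * \<eta>\<^sup>2 + 1) * (1 + a3\<^sup>2 * real (card supp) * lam\<^sup>2) * clow\<^sup>2 * \<sigma>\<^sup>2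
      * ((real (card supp) - real k) * lam\<^sup>2)"
proof -
  define K where "K = real (card supp) - real k"
  define W where "W = 1 + a3\<^sup>2 * real (card supp) * lam\<^sup>2"
  define Q where "Q = K * lam\<^sup>2 * (clow\<^sup>2 * \<sigma>\<^sup>2)"
  have K: "K > 0" using k by (simp add: K_def)
  have W: "W \<ge> 1" by (simp add: W_def)
  have Q: "Q \<ge> 0" using K by (simp add: Q_def)
  have goal: "?thesis \<longleftrightarrow> (d2_B0 p k \<theta>)\<^sup>2 \<le> (18 * \<eta> + 2 * \<eta>\<^sup>2 + 1) * W * Q"
    by (simp add: K_def W_def Q_def mult_ac)
  have const: "Q \<le> (18 * \<eta> + 2 * \<eta>\<^sup>2 + 1) * W * Q"
  proof -
    have "1 * 1 \<le> (18 * \<eta> + 2 * \<eta>\<^sup>2 + 1) * W" using W \<eta> by (intro mult_mono) auto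
    thus ?thesis using mult_right_mono[OF _ Q, of 1] by simp
  qed
  show ?thesis
    unfolding goal
  \<comment> \<open>If there are enough small coordinates, those are removed. Otherwise
    \<open>card small\<close> is below \<open>card supp - k\<close>, so the signal outside
    \<open>S\<close> and the bias are themselves of the order of the bound.\<close>
  proof (cases "card small \<ge> card supp - k")
    case True
    then obtain R where R: "R \<subseteq> small" "card R = card supp - k" using obtain_subset_with_card_n by metis
    have "(d2_B0 p k \<theta>)\<^sup>2 \<le> (\<Sum>i\<in>R. (\<theta> i)\<^sup>2)"
      using R finite_sets(6) k by (intro d2_B0_le) (auto simp: card_supp supp_def)
    also have "\<dots> \<le> (\<Sum>i\<in>R. (clow * lam * \<sigma>)\<^sup>2)"
    proof (rule sum_mono)
      fix i assume "i \<in> R"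
      hence "\<bar>\<theta> i\<bar> \<le> a1 * lam * \<sigma>" using R \<sigma> by (auto simp: small_def abs_divide field_simps)
      also have "\<dots> \<le> clow * lam * \<sigma>" using clow_bounds(1) lam \<sigma> by (intro mult_right_mono) auto
      finally show "(\<theta> i)\<^sup>2 \<le> (clow * lam * \<sigma>)\<^sup>2"
        using clow_bounds(4) lam \<sigma> by (simp add: abs_le_square_iff[symmetric] abs_mult)
    qed
    also have "\<dots> = Q" using R(2) k by (simp add: Q_def K_def of_nat_diff power_mult_distrib mult_ac)
    finally show "(d2_B0 p k \<theta>)\<^sup>2 \<le> (18 * \<eta> + 2 * \<eta>\<^sup>2 + 1) * W * Q" using const by simp
  next
    case False
    hence M: "real (card small) \<le> K" by (simp add: K_def)
    have "card (found \<inter> supp) \<le> k" using k(2) card_mono[of found "found \<inter> supp"] finite_sets by auto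
    \<comment> \<open>\<open>T\<close> is kept: it contains all true discoveries and is filled up to
      size \<open>k\<close> with support coordinates, so every removed coordinate was missed by the
      test.\<close>
    then obtain T where T: "found \<inter> supp \<subseteq> T" "T \<subseteq> supp" "card T = k"
      using exists_subset_between[of "found \<inter> supp" k supp] k(1) finite_sets by auto
    define R where "R = supp - T"
    have fR: "finite R" "finite T" using finite_sets T finite_subset by (auto simp: R_def)
    have cR: "card R = card supp - k" unfolding R_def using T fR by (simp add: card_Diff_subset)
    define rest where "rest = (\<Sum>i\<in>{..<p} - S. (\<theta> i)\<^sup>2)"
    have "(d2_B0 p k \<theta>)\<^sup>2 \<le> (\<Sum>i\<in>R. (\<theta> i)\<^sup>2)"
      using k cR by (intro d2_B0_le) (auto simp: card_supp supp_def R_def)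
    also have "\<dots> = (\<Sum>i\<in>R \<inter> S. (\<theta> i)\<^sup>2) + (\<Sum>i\<in>R - S. (\<theta> i)\<^sup>2)"
      using fR by (simp add: sum.Int_Diff)
    also have "(\<Sum>i\<in>R - S. (\<theta> i)\<^sup>2) \<le> rest"
      unfolding rest_def by (rule sum_mono2) (auto simp: R_def supp_def)
    also have "(\<Sum>i\<in>R \<inter> S. (\<theta> i)\<^sup>2) \<le> (\<Sum>i\<in>R \<inter> S. 18 * clow\<^sup>2 * \<tau>\<^sup>2 * lam\<^sup>2 + 2 * (b i)\<^sup>2)"
      by (rule sum_mono, rule missed_le) (use T in \<open>auto simp: R_def supp_def\<close>)
    also have "\<dots> = real (card (R \<inter> S)) * (18 * clow\<^sup>2 * \<tau>\<^sup>2 * lam\<^sup>2) + 2 * (\<Sum>i\<in>R \<inter> S. (b i)\<^sup>2)"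
      by (simp add: sum.distrib sum_distrib_left)
    also have "real (card (R \<inter> S)) * (18 * clow\<^sup>2 * \<tau>\<^sup>2 * lam\<^sup>2) \<le> K * (18 * clow\<^sup>2 * \<tau>\<^sup>2 * lam\<^sup>2)"
    proof (rule mult_right_mono)
      have "card (R \<inter> S) \<le> card R" using fR by (intro card_mono) auto
      thus "real (card (R \<inter> S)) \<le> K" using cR k by (simp add: K_def of_nat_diff)
    qed simp
    also have "(\<Sum>i\<in>R \<inter> S. (b i)\<^sup>2) \<le> \<eta>\<^sup>2 * rest"
      using sum_mono2[of S "R \<inter> S" "\<lambda>i. (b i)\<^sup>2"] finite_sets b by (simp add: rest_def)
    finally have main: "(d2_B0 p k \<theta>)\<^sup>2 \<le> K * (18 * clow\<^sup>2 * \<tau>\<^sup>2 * lam\<^sup>2) + 2 * (\<eta>\<^sup>2 * rest) + rest" by simp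
    have rQ: "rest \<le> Q"
    proof -
      have "rest \<le> a3\<^sup>2 * \<sigma>\<^sup>2 * real (card small) * lam\<^sup>2" unfolding rest_def by (rule rest_le)
      also have "\<dots> \<le> clow\<^sup>2 * \<sigma>\<^sup>2 * K * lam\<^sup>2"
        using clow_bounds(2) a3 M by (intro mult_right_mono mult_mono power_mono) auto
      finally show ?thesis by (simp add: Q_def mult_ac)
    qed
    \<comment> \<open>In the variance \<open>card small\<close> is bounded by the size of the
      support, which yields the factor \<open>W\<close>; the bound by \<open>K\<close> was used for
      \<open>rest\<close> itself.\<close>
    have "\<tau>\<^sup>2 \<le> \<eta> * \<sigma>\<^sup>2 * W"
    proof -
      have "card small \<le> card supp" using finite_sets by (intro card_mono) auto
      hence "rest \<le> a3\<^sup>2 * \<sigma>\<^sup>2 * real (card supp) * lam\<^sup>2"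
        unfolding rest_def by (intro order_trans[OF rest_le] mult_right_mono mult_left_mono) auto
      hence "\<eta> * rest \<le> \<eta> * (a3\<^sup>2 * \<sigma>\<^sup>2 * real (card supp) * lam\<^sup>2)" using \<eta> by (intro mult_left_mono) auto
      moreover have "1 * \<sigma>\<^sup>2 \<le> \<eta> * \<sigma>\<^sup>2" using \<eta> by (intro mult_right_mono) auto
      ultimately have "\<tau>\<^sup>2 \<le> \<eta> * \<sigma>\<^sup>2 + \<eta> * (a3\<^sup>2 * \<sigma>\<^sup>2 * real (card supp) * lam\<^sup>2)"
        using \<tau>2 unfolding rest_def by linarith
      thus ?thesis by (simp add: W_def algebra_simps)
    qed
    hence "18 * K * lam\<^sup>2 * clow\<^sup>2 * \<tau>\<^sup>2 \<le> 18 * K * lam\<^sup>2 * clow\<^sup>2 * (\<eta> * \<sigma>\<^sup>2 * W)"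
      using K by (intro mult_left_mono) auto
    hence "K * (18 * clow\<^sup>2 * \<tau>\<^sup>2 * lam\<^sup>2) \<le> 18 * \<eta> * (W * Q)" by (simp add: Q_def mult_ac)
    moreover have "Q \<le> W * Q" using mult_right_mono[OF W Q] by simp
    moreover have "2 * (\<eta>\<^sup>2 * rest) \<le> 2 * \<eta>\<^sup>2 * (W * Q)"
      using rQ \<open>Q \<le> W * Q\<close> by (simp add: mult_left_mono)
    ultimately have "(d2_B0 p k \<theta>)\<^sup>2 \<le> 18 * \<eta> * (W * Q) + 2 * \<eta>\<^sup>2 * (W * Q) + 1 * (W * Q)"
      using main rQ by linarith
    thus "(d2_B0 p k \<theta>)\<^sup>2 \<le> (18 * \<eta> + 2 * \<eta>\<^sup>2 + 1) * W * Q" by (simp add: algebra_simps)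
  qed
qed

end

section \<open>The sample event\<close>

text \<open>Images of measurable sets need not be measurable, so the event is carried over as a
  preimage under the inverse \<Psi> of \<open>data_map\<close>, which \<open>L'\<close> provides. As
  the two maps are mutually inverse on the underlying spaces, the probability is unchanged and every
  sample outside \<open>A\<close> comes from an array outside \<open>Bad\<close>.\<close>

lemma data_law_transfer:
  assumes law: "gauss_vec p \<Sigma> = distr (PiM {..<p} (\<lambda>_. std_gauss)) (PiM {..<p} (\<lambda>_. borel)) (lmap {..<p} L)"
    and inv: "\<And>x. lmap {..<p} L (lmap {..<p} L' x) = restrict x {..<p}"
      "\<And>x. lmap {..<p} L' (lmap {..<p} L x) = restrict x {..<p}"
    and Bad: "Bad \<in> sets (flat_law m (Suc p))" "emeasure (flat_law m (Suc p)) Bad \<le> ennreal d" and d: "d \<ge> 0"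
  shows "\<exists>A \<in> sets (data_law m p \<Sigma>). measure (data_law m p \<Sigma>) A \<le> d \<and>
    (\<forall>z \<in> space (data_law m p \<Sigma>) - A. \<exists>\<omega> \<in> space (flat_law m (Suc p)) - Bad. z = data_map m p L \<omega>)"
proof -
  let ?P = "flat_law m (Suc p)"
  let ?N = "PiM {..<m} (\<lambda>_. PiM {..<p} (\<lambda>_. borel :: real measure)) \<Otimes>\<^sub>M PiM {..<m} (\<lambda>_. std_gauss)"
  define \<Psi> where "\<Psi> = (\<lambda>z :: (nat \<Rightarrow> nat \<Rightarrow> real) \<times> (nat \<Rightarrow> real).
      \<lambda>i\<in>{..<m} \<times> {..<Suc p}. if snd i < p then lmap {..<p} L' (fst z (fst i)) (snd i) else snd z (fst i))"
  have DL: "data_law m p \<Sigma> = distr ?P ?N (data_map m p L)" by (rule data_law_eq_distr[OF law])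
  have \<Psi>m: "\<Psi> \<in> ?N \<rightarrow>\<^sub>M ?P"
    unfolding \<Psi>_def
  proof (rule measurable_restrict)
    fix i :: "nat \<times> nat" assume i: "i \<in> {..<m} \<times> {..<Suc p}"
    show "(\<lambda>z. if snd i < p then lmap {..<p} L' (fst z (fst i)) (snd i) else snd z (fst i)) \<in> ?N \<rightarrow>\<^sub>M std_gauss"
    proof (cases "snd i < p")
      case True
      have 1: "(\<lambda>G. G (fst i)) \<in> PiM {..<m} (\<lambda>_. PiM {..<p} (\<lambda>_. borel :: real measure)) \<rightarrow>\<^sub>M PiM {..<p} (\<lambda>_. borel)"
        using i by (intro measurable_component_singleton) auto
      have 2: "(\<lambda>x. lmap {..<p} L' x (snd i)) \<in> borel_measurable (PiM {..<p} (\<lambda>_. borel))"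
        unfolding lmap_def using True by simp
      show ?thesis using True measurable_compose[OF measurable_fst measurable_compose[OF 1 2]]
        by (simp add: measurable_cong_sets[OF refl sets_std_gauss])
    next
      case False
      thus ?thesis using i by auto
    qed
  qed
  have D\<Psi>: "data_map m p L (\<Psi> z) = z" if z: "z \<in> space ?N" for z
  proof -
    obtain X e where ze: "z = (X, e)" by (cases z)
    have ext: "X \<in> extensional {..<m}" "\<And>r. r < m \<Longrightarrow> X r \<in> extensional {..<p}" "e \<in> extensional {..<m}"
      using z by (auto simp: ze space_pair_measure space_PiM PiE_iff)
    have "lmap {..<p} L (\<lambda>j. \<Psi> z (r, j)) = X r" if "r < m" for r
    proof -
      have "lmap {..<p} L (\<lambda>j. \<Psi> z (r, j)) = lmap {..<p} L (lmap {..<p} L' (X r))"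
        using that unfolding lmap_def by (intro restrict_ext sum.cong) (auto simp: \<Psi>_def ze lmap_def)
      thus ?thesis using ext(2)[OF that] by (simp add: inv(1) extensional_restrict)
    qed
    moreover have "\<Psi> z (r, p) = e r" if "r < m" for r using that by (simp add: \<Psi>_def ze)
    ultimately show ?thesis using ext(1,3) by (auto simp: data_map_def ze restrict_def extensional_def)
  qed
  have \<Psi>D: "\<Psi> (data_map m p L \<omega>) = \<omega>" if \<omega>: "\<omega> \<in> space ?P" for \<omega>
  proof
    fix i :: "nat \<times> nat"
    obtain r j where rj: "i = (r, j)" by (cases i)
    show "\<Psi> (data_map m p L \<omega>) i = \<omega> i"
    proof (cases "i \<in> {..<m} \<times> {..<Suc p}")
      case True
      have "lmap {..<p} L' (lmap {..<p} L (\<lambda>j. \<omega> (r, j))) j = \<omega> (r, j)" if "j < p"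
        using that by (simp add: inv(2))
      thus ?thesis using True by (auto simp: \<Psi>_def data_map_def rj less_Suc_eq)
    next
      case False
      thus ?thesis using \<omega> by (auto simp: \<Psi>_def rj space_PiM PiE_iff extensional_def)
    qed
  qed
  define A where "A = \<Psi> -` Bad \<inter> space ?N"
  have A: "A \<in> sets ?N" unfolding A_def using measurable_sets[OF \<Psi>m Bad(1)] .
  have sub: "Bad \<subseteq> space ?P" using Bad(1) by (rule sets.sets_into_space)
  have "data_map m p L -` A \<inter> space ?P = Bad"
  proof (intro equalityI subsetI)
    fix \<omega> assume "\<omega> \<in> data_map m p L -` A \<inter> space ?P"
    thus "\<omega> \<in> Bad" using \<Psi>D by (auto simp: A_def)
  next
    fix \<omega> assume \<omega>: "\<omega> \<in> Bad"
    hence s: "\<omega> \<in> space ?P" using sub by auto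
    thus "\<omega> \<in> data_map m p L -` A \<inter> space ?P"
      using \<omega> \<Psi>D[OF s] measurable_space[OF data_map_measurable s] by (simp add: A_def)
  qed
  hence "emeasure (data_law m p \<Sigma>) A = emeasure ?P Bad"
    unfolding DL using emeasure_distr[OF data_map_measurable A] by simp
  hence "emeasure (data_law m p \<Sigma>) A \<le> ennreal d" using Bad(2) by simp
  hence "measure (data_law m p \<Sigma>) A \<le> d" unfolding measure_def using d by (intro enn2real_leI)
  moreover have "A \<in> sets (data_law m p \<Sigma>)" using A by (simp add: DL)
  moreover have "\<exists>\<omega> \<in> space ?P - Bad. z = data_map m p L \<omega>"
    if z: "z \<in> space (data_law m p \<Sigma>) - A" for z
  proof (rule bexI[of _ "\<Psi> z"])
    have zN: "z \<in> space ?N" using z by (simp add: DL)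
    show "\<Psi> z \<in> space ?P - Bad" using zN z measurable_space[OF \<Psi>m zN] by (auto simp: A_def)
    show "z = data_map m p L (\<Psi> z)" using D\<Psi>[OF zN] by simp
  qed
  ultimately show ?thesis by (intro bexI[of _ A] conjI ballI)
qed

text \<open>The coefficients of the population regression of the response on the columns in \<open>S\<close> are
  \<open>\<theta> + b\<close>; the residual has the coefficients \<open>\<gamma>\<close> in the Gaussian coordinates, which vanish
  on \<open>S\<close>, so it is independent of the columns in \<open>S\<close>.\<close>

locale gaussian_design =
  fixes p m :: nat and \<eta> \<sigma> :: real and \<theta> b :: "nat \<Rightarrow> real" and S :: "nat set" and L :: "nat \<Rightarrow> nat \<Rightarrow> real"
  assumes S: "S \<subseteq> {..<p}" and \<eta>: "\<eta> > 1" and \<sigma>: "\<sigma> > 0"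
    and tri: "\<And>i j. i \<in> S \<Longrightarrow> j < p \<Longrightarrow> j \<notin> S \<Longrightarrow> L i j = 0"
    and lower: "\<And>u. (\<Sum>i<p. (u i)\<^sup>2) \<le> \<eta> * (\<Sum>j<p. (\<Sum>i<p. L i j * u i)\<^sup>2)"
    and upper: "\<And>u. (\<Sum>j<p. (\<Sum>i<p. L i j * u i)\<^sup>2) \<le> \<eta> * (\<Sum>i<p. (u i)\<^sup>2)"
    and b: "\<And>j. j \<in> S \<Longrightarrow> (\<Sum>k\<in>S. L k j * b k) = (\<Sum>i\<in>{..<p} - S. L i j * \<theta> i)"
begin

text \<open>Coefficients of the residual in terms of the columns: \<theta> minus the regression
  coefficients \<open>\<theta> + b\<close>, the latter supported on \<open>S\<close>.\<close>

definition "h i = (if i \<in> S then - b i else \<theta> i)"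
text \<open>Index \<open>p\<close> is the noise column of the Gaussian array.\<close>

definition "\<gamma> j = (if j < p then \<Sum>i<p. L i j * h i else \<sigma>)"
definition "\<tau> = sqrt (\<Sum>j<Suc p. (\<gamma> j)\<^sup>2)"
definition "rest = (\<Sum>i\<in>{..<p} - S. (\<theta> i)\<^sup>2)"
text \<open>The columns in \<open>S\<close> written with the Gaussians of \<open>S\<close> alone; by
  \<open>tri\<close> they agree with the true columns, and in this form their independence of
  \<open>y\<close> is visible.\<close>

definition "Xs \<omega> r j = (\<Sum>l\<in>S. L j l * \<omega> (r :: nat, l))" for \<omega> :: "nat \<times> nat \<Rightarrow> real"
definition "y \<omega> r = (\<Sum>j\<in>{..<Suc p} - S. \<gamma> j * \<omega> (r :: nat, j))" for \<omega> :: "nat \<times> nat \<Rightarrow> real"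
text \<open>The vector \<open>a\<close> of \<open>normal_equations_coordinate_bound\<close> for the
  columns in \<open>S\<close>; it is a function of the Gaussians indexed by \<open>S\<close>
  only.\<close>

definition "acol \<omega> i r = (\<Sum>j\<in>S. pad_adj p S (\<lambda>j k. \<Sum>r<m. Xs \<omega> r j * Xs \<omega> r k) j i * Xs \<omega> r j)"
text \<open>The label \<open>p\<close>, which is not in \<open>S\<close>, stands for the normalised
  residual direction; it is orthogonal to the unit vectors of \<open>S\<close> because \<gamma>
  vanishes there.\<close>

definition "basis t = (if t = p then (\<lambda>j. \<gamma> j / \<tau>) else (\<lambda>j. if j = t then 1 else 0))"

lemma finite_S: "finite S" and p_notin: "p \<notin> S"
  using S finite_subset[of S "{..<p}"] by auto

lemma sum_split: "(\<Sum>i<p. f i) = (\<Sum>i\<in>S. f i) + (\<Sum>i\<in>{..<p} - S. f i)" for f :: "nat \<Rightarrow> real"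
  using sum.subset_diff[OF S, of f] by (simp add: add.commute)

lemma Lt_S:
  assumes "\<And>i. i < p \<Longrightarrow> i \<notin> S \<Longrightarrow> u i = 0"
  shows "(\<Sum>i<p. L i j * u i) = (\<Sum>i\<in>S. L i j * u i)"
  unfolding sum_split using assms by simp

lemma energy_S:
  assumes "\<And>i. i < p \<Longrightarrow> i \<notin> S \<Longrightarrow> u i = 0"
  shows "(\<Sum>j<p. (\<Sum>i<p. L i j * u i)\<^sup>2) = (\<Sum>j\<in>S. (\<Sum>i\<in>S. L i j * u i)\<^sup>2)"
proof -
  have "(\<Sum>j<p. (\<Sum>i<p. L i j * u i)\<^sup>2) = (\<Sum>j<p. (\<Sum>i\<in>S. L i j * u i)\<^sup>2)"
    by (intro sum.cong refl arg_cong[where f = "\<lambda>x. x\<^sup>2"] Lt_S assms)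
  also have "\<dots> = (\<Sum>j\<in>S. (\<Sum>i\<in>S. L i j * u i)\<^sup>2)"
    using S tri by (intro sum.mono_neutral_right) auto
  finally show ?thesis .
qed

text \<open>\<open>u\<close> is extended by zero; triangularity confines its image to the
  coordinates in \<open>S\<close>.\<close>

lemma energy_S_lower: "(\<Sum>i\<in>S. (u i)\<^sup>2) \<le> \<eta> * (\<Sum>j\<in>S. (\<Sum>i\<in>S. L i j * u i)\<^sup>2)"
proof -
  define u' where "u' = (\<lambda>i. if i \<in> S then u i else 0)"
  have "(\<Sum>i\<in>S. (u i)\<^sup>2) = (\<Sum>i<p. (u' i)\<^sup>2)" unfolding sum_split by (simp add: u'_def)
  also have "\<dots> \<le> \<eta> * (\<Sum>j<p. (\<Sum>i<p. L i j * u' i)\<^sup>2)" by (rule lower)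
  also have "(\<Sum>j<p. (\<Sum>i<p. L i j * u' i)\<^sup>2) = (\<Sum>j\<in>S. (\<Sum>i\<in>S. L i j * u' i)\<^sup>2)"
    by (rule energy_S) (simp add: u'_def)
  finally show ?thesis by (simp add: u'_def)
qed

text \<open>The population normal equations, for which \<open>b\<close> was chosen.\<close>

lemma \<gamma>_S: "j \<in> S \<Longrightarrow> \<gamma> j = 0"
  using S b[of j] unfolding \<gamma>_def sum_split by (auto simp: h_def sum_negf)

lemma \<gamma>_sum: "(\<Sum>j<Suc p. (\<gamma> j)\<^sup>2) = (\<Sum>j<p. (\<Sum>i<p. L i j * h i)\<^sup>2) + \<sigma>\<^sup>2"
  by (simp add: \<gamma>_def)

lemma \<tau>_sq: "\<tau>\<^sup>2 = (\<Sum>j<p. (\<Sum>i<p. L i j * h i)\<^sup>2) + \<sigma>\<^sup>2"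
  unfolding \<tau>_def \<gamma>_sum by (simp add: sum_nonneg)

lemma \<sigma>_le_\<tau>: "\<sigma> \<le> \<tau>"
  unfolding \<tau>_def \<gamma>_sum by (rule real_le_rsqrt) (simp add: sum_nonneg)

lemma \<tau>_pos: "\<tau> > 0" using \<sigma> \<sigma>_le_\<tau> by simp

lemma \<gamma>_sum_rest: "(\<Sum>j\<in>{..<Suc p} - S. (\<gamma> j)\<^sup>2) = \<tau>\<^sup>2"
proof -
  have "(\<Sum>j\<in>{..<Suc p} - S. (\<gamma> j)\<^sup>2) = (\<Sum>j<Suc p. (\<gamma> j)\<^sup>2)"
    by (rule sum.mono_neutral_left) (auto simp: \<gamma>_S)
  thus ?thesis unfolding \<tau>_sq \<gamma>_sum .
qed

text \<open>Pythagoras: the part of \<theta> outside \<open>S\<close> splits into its regression on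
  the columns in \<open>S\<close>, which has coefficients \<open>b\<close> and Gaussian coordinates
  in \<open>S\<close>, and a residual with coordinates outside \<open>S\<close>. Each piece is
  bounded by the total, which is at most \<open>\<eta> * rest\<close>.\<close>

lemma bias_bounds: "(\<Sum>i\<in>S. (b i)\<^sup>2) \<le> \<eta>\<^sup>2 * rest" "\<tau>\<^sup>2 \<le> \<sigma>\<^sup>2 + \<eta> * rest"
proof -
  define t where "t = (\<lambda>i. if i \<in> S then 0 else \<theta> i)"
  have split: "(\<Sum>i<p. L i j * t i) = (\<Sum>i<p. L i j * h i) + (\<Sum>i\<in>S. L i j * b i)" for j
    unfolding sum_split by (simp add: t_def h_def sum_negf)
  have sq: "(\<Sum>i<p. L i j * t i)\<^sup>2 = (\<Sum>i<p. L i j * h i)\<^sup>2 + (\<Sum>i\<in>S. L i j * b i)\<^sup>2" if j: "j < p" for j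
  proof (cases "j \<in> S")
    case True
    hence "(\<Sum>i<p. L i j * h i) = 0" using \<gamma>_S[OF True] j by (simp add: \<gamma>_def)
    thus ?thesis by (simp add: split)
  next
    case False
    hence "(\<Sum>i\<in>S. L i j * b i) = 0" using tri j by simp
    thus ?thesis by (simp add: split)
  qed
  have "(\<Sum>j<p. (\<Sum>i<p. L i j * t i)\<^sup>2) = (\<Sum>j<p. (\<Sum>i<p. L i j * h i)\<^sup>2) + (\<Sum>j<p. (\<Sum>i\<in>S. L i j * b i)\<^sup>2)"
    using sq by (simp add: sum.distrib[symmetric])
  also have "(\<Sum>j<p. (\<Sum>i\<in>S. L i j * b i)\<^sup>2) = (\<Sum>j\<in>S. (\<Sum>i\<in>S. L i j * b i)\<^sup>2)"
    using S tri by (intro sum.mono_neutral_right) auto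
  finally have eq: "(\<Sum>j<p. (\<Sum>i<p. L i j * t i)\<^sup>2) = (\<Sum>j<p. (\<Sum>i<p. L i j * h i)\<^sup>2) + (\<Sum>j\<in>S. (\<Sum>i\<in>S. L i j * b i)\<^sup>2)" .
  have "(\<Sum>i<p. (t i)\<^sup>2) = rest" unfolding sum_split by (simp add: t_def rest_def)
  hence le: "(\<Sum>j<p. (\<Sum>i<p. L i j * t i)\<^sup>2) \<le> \<eta> * rest" using upper[of t] by simp
  have n1: "(\<Sum>j<p. (\<Sum>i<p. L i j * h i)\<^sup>2) \<ge> 0" and n2: "(\<Sum>j\<in>S. (\<Sum>i\<in>S. L i j * b i)\<^sup>2) \<ge> 0"
    by (auto intro: sum_nonneg)
  show "\<tau>\<^sup>2 \<le> \<sigma>\<^sup>2 + \<eta> * rest" unfolding \<tau>_sq using eq le n2 by linarith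
  have "(\<Sum>i\<in>S. (b i)\<^sup>2) \<le> \<eta> * (\<Sum>j\<in>S. (\<Sum>i\<in>S. L i j * b i)\<^sup>2)" by (rule energy_S_lower)
  also have "\<dots> \<le> \<eta> * (\<eta> * rest)" using eq le n1 \<eta> by (intro mult_left_mono) auto
  finally show "(\<Sum>i\<in>S. (b i)\<^sup>2) \<le> \<eta>\<^sup>2 * rest" by (simp add: power2_eq_square mult.assoc)
qed

lemma basis_orthonormal:
  assumes "s \<in> insert p S" "t \<in> insert p S"
  shows "(\<Sum>j<Suc p. basis s j * basis t j) = (if s = t then 1 else 0)"
proof -
  have pt: "(\<Sum>j<Suc p. f j * (if j = t then 1 else 0)) = f t" if "t \<in> S" for f :: "nat \<Rightarrow> real" and t
  proof -
    have "(\<Sum>j<Suc p. f j * (if j = t then 1 else 0)) = (\<Sum>j<Suc p. if j = t then f j else 0)"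
      by (intro sum.cong) auto
    moreover have "t < Suc p" using that S by auto
    ultimately show ?thesis by (simp del: sum.lessThan_Suc)
  qed
  have pt': "(\<Sum>j<Suc p. (if j = t then 1 else 0) * f j) = f t" if "t \<in> S" for f :: "nat \<Rightarrow> real" and t
    using pt[OF that, of f] by (simp only: mult.commute)
  have pp: "(\<Sum>j<Suc p. \<gamma> j / \<tau> * (\<gamma> j / \<tau>)) = 1"
  proof -
    have "(\<Sum>j<Suc p. \<gamma> j / \<tau> * (\<gamma> j / \<tau>)) = (\<Sum>j<Suc p. (\<gamma> j)\<^sup>2) / \<tau>\<^sup>2"
      unfolding sum_divide_distrib by (intro sum.cong refl) (simp add: power2_eq_square)
    also have "\<dots> = 1" using \<tau>_pos unfolding \<gamma>_sum \<tau>_sq[symmetric] by simp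
    finally show ?thesis .
  qed
  show ?thesis
    using assms p_notin pp unfolding basis_def
    by (auto simp: pt pt' \<gamma>_S simp del: sum.lessThan_Suc times_divide_eq_left times_divide_eq_right)
qed

lemma Xs_lin: "(\<Sum>i\<in>S. Xs \<omega> r i * u i) = (\<Sum>l\<in>S. (\<Sum>i\<in>S. L i l * u i) * \<omega> (r, l))"
proof -
  have "(\<Sum>i\<in>S. Xs \<omega> r i * u i) = (\<Sum>i\<in>S. \<Sum>l\<in>S. L i l * u i * \<omega> (r, l))"
    by (simp add: Xs_def sum_distrib_left sum_distrib_right mult_ac)
  also have "\<dots> = (\<Sum>l\<in>S. \<Sum>i\<in>S. L i l * u i * \<omega> (r, l))" by (rule sum.swap)
  finally show ?thesis by (simp add: sum_distrib_right)
qed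

text \<open>The parameter \<open>e\<close> lets one event serve twice: \<open>e = 1\<close> gives
  residual vectors of the regression, \<open>e = 0\<close> the Gram matrix of the columns.\<close>

lemma basis_comb:
  "(\<Sum>t\<in>insert p S. (if t = p then e * \<tau> else - (\<Sum>i\<in>S. L i t * u i)) * (\<Sum>j<Suc p. basis t j * \<omega> (r, j)))
    = e * y \<omega> r - (\<Sum>i\<in>S. Xs \<omega> r i * u i)"
proof -
  have 1: "(\<Sum>j<Suc p. basis p j * \<omega> (r, j)) = y \<omega> r / \<tau>"
  proof -
    have "(\<Sum>j<Suc p. basis p j * \<omega> (r, j)) = (\<Sum>j<Suc p. \<gamma> j * \<omega> (r, j)) / \<tau>"
      unfolding sum_divide_distrib by (intro sum.cong refl) (simp add: basis_def)
    also have "(\<Sum>j<Suc p. \<gamma> j * \<omega> (r, j)) = y \<omega> r"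
      unfolding y_def by (rule sum.mono_neutral_right) (auto simp: \<gamma>_S)
    finally show ?thesis .
  qed
  have 2: "(\<Sum>j<Suc p. basis t j * \<omega> (r, j)) = \<omega> (r, t)" if "t \<in> S" for t
  proof -
    have "t \<noteq> p" "t < Suc p" using that p_notin S by auto
    have "(\<Sum>j<Suc p. basis t j * \<omega> (r, j)) = (\<Sum>j<Suc p. if j = t then \<omega> (r, j) else 0)"
      using \<open>t \<noteq> p\<close> by (intro sum.cong) (auto simp: basis_def)
    thus ?thesis using \<open>t < Suc p\<close> by (simp del: sum.lessThan_Suc)
  qed
  have "(\<Sum>t\<in>S. (if t = p then e * \<tau> else - (\<Sum>i\<in>S. L i t * u i)) * (\<Sum>j<Suc p. basis t j * \<omega> (r, j)))
     = (\<Sum>t\<in>S. - ((\<Sum>i\<in>S. L i t * u i) * \<omega> (r, t)))"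
    using p_notin by (intro sum.cong refl) (auto simp: 2 simp del: sum.lessThan_Suc)
  thus ?thesis
    unfolding Xs_lin using finite_S p_notin \<tau>_pos by (simp add: 1 sum_negf del: sum.lessThan_Suc)
qed

lemma acol_measurable:
  assumes "i \<in> S" "r < m"
  shows "(\<lambda>\<omega>. acol \<omega> i r) \<in> borel_measurable (PiM ({..<m} \<times> S) (\<lambda>_. borel))"
proof -
  have X: "(\<lambda>\<omega>. Xs \<omega> r j) \<in> borel_measurable (PiM ({..<m} \<times> S) (\<lambda>_. borel))" if "r < m" for r j
    unfolding Xs_def using that by (intro borel_measurable_sum borel_measurable_times) auto
  show ?thesis
    unfolding acol_def
  proof (intro borel_measurable_sum borel_measurable_times X assms)
    fix j assume "j \<in> S"
    show "(\<lambda>\<omega>. pad_adj p S (\<lambda>j k. \<Sum>r<m. Xs \<omega> r j * Xs \<omega> r k) j i)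
       \<in> borel_measurable (PiM ({..<m} \<times> S) (\<lambda>_. borel))"
      by (rule measurable_pad_adj[OF S \<open>j \<in> S\<close> \<open>i \<in> S\<close>])
        (intro borel_measurable_sum borel_measurable_times X, auto)
  qed
qed

text \<open>Puts \<open>acol\<close> into the form of \<open>independent_direction_tail\<close>,
  where independence is expressed by restricting the array to the columns in
  \<open>S\<close>.\<close>

lemma acol_restrict:
  assumes "r < m"
  shows "acol (restrict \<omega> ({..<m} \<times> S)) i r = acol \<omega> i r"
proof -
  have X: "Xs (restrict \<omega> ({..<m} \<times> S)) r j = Xs \<omega> r j" if "r < m" for r j
    unfolding Xs_def using that by (intro sum.cong) auto
  have "(\<lambda>j k. \<Sum>r<m. Xs (restrict \<omega> ({..<m} \<times> S)) r j * Xs (restrict \<omega> ({..<m} \<times> S)) r k)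
     = (\<lambda>j k. \<Sum>r<m. Xs \<omega> r j * Xs \<omega> r k)"
    by (intro ext sum.cong) (auto simp: X)
  thus ?thesis unfolding acol_def by (simp add: X[OF assms])
qed

text \<open>The quadratic bounds hold for all \<open>e\<close> and \<open>u\<close> simultaneously,
  since \<open>u\<close> will be the random least squares error. The noise is controlled only in the
  \<open>card S\<close> directions \<open>acol\<close>, whence the second, linear term of the
  failure probability.\<close>

lemma good_event:
  assumes t: "t \<ge> 0"
  shows "\<exists>Bad \<in> sets (flat_law m (Suc p)).
    emeasure (flat_law m (Suc p)) Bad \<le> ennreal (2 * 2 ^ (402 * (card S + 1)) * exp (- real m / 200)
        + real (card S) * (2 * exp (- t\<^sup>2 / 2))) \<and>
    (\<forall>\<omega> \<in> space (flat_law m (Suc p)) - Bad.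
      (\<forall>e u. real m / 2 * (e\<^sup>2 * \<tau>\<^sup>2 + (\<Sum>j\<in>S. (\<Sum>i\<in>S. L i j * u i)\<^sup>2)) \<le> (\<Sum>r<m. (e * y \<omega> r - (\<Sum>i\<in>S. Xs \<omega> r i * u i))\<^sup>2)
        \<and> (\<Sum>r<m. (e * y \<omega> r - (\<Sum>i\<in>S. Xs \<omega> r i * u i))\<^sup>2) \<le> 5 * real m * (e\<^sup>2 * \<tau>\<^sup>2 + (\<Sum>j\<in>S. (\<Sum>i\<in>S. L i j * u i)\<^sup>2))) \<and>
      (\<forall>i\<in>S. \<bar>\<Sum>r<m. acol \<omega> i r * y \<omega> r\<bar> \<le> t * \<tau> * sqrt (\<Sum>r<m. (acol \<omega> i r)\<^sup>2)))"
proof -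
  let ?P = "flat_law m (Suc p)"
  have "finite (insert p S)" "insert p S \<noteq> {}" using finite_S by auto
  from gaussian_matrix_singular_values[OF this basis_orthonormal, of m] obtain E where E: "E \<in> sets ?P"
    "emeasure ?P (space ?P - E) \<le> ennreal (2 * 2 ^ (402 * card (insert p S)) * exp (- real m / 200))"
    "\<forall>\<omega>\<in>E. \<forall>g. real m / 2 * (\<Sum>t\<in>insert p S. (g t)\<^sup>2)
        \<le> (\<Sum>r<m. (\<Sum>t\<in>insert p S. g t * (\<Sum>j<Suc p. basis t j * \<omega> (r, j)))\<^sup>2)
      \<and> (\<Sum>r<m. (\<Sum>t\<in>insert p S. g t * (\<Sum>j<Suc p. basis t j * \<omega> (r, j)))\<^sup>2)
        \<le> 5 * real m * (\<Sum>t\<in>insert p S. (g t)\<^sup>2)"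
    by blast
  define A where "A = (\<lambda>i. {\<omega> \<in> space ?P. \<bar>\<Sum>r<m. acol (restrict \<omega> ({..<m} \<times> S)) i r * (\<Sum>j\<in>{..<Suc p} - S. \<gamma> j * \<omega> (r, j))\<bar>
       > t * sqrt ((\<Sum>j\<in>{..<Suc p} - S. (\<gamma> j)\<^sup>2) * (\<Sum>r<m. (acol (restrict \<omega> ({..<m} \<times> S)) i r)\<^sup>2))})"
  have SS: "S \<subseteq> {..<Suc p}" using S by auto
  have A: "A i \<in> sets ?P" "emeasure ?P (A i) \<le> ennreal (2 * exp (- t\<^sup>2 / 2))" if "i \<in> S" for i
    unfolding A_def using independent_direction_tail[OF SS t, of m "\<lambda>\<omega> r. acol \<omega> i r" \<gamma>] acol_measurable[OF that] by auto
  define Bad where "Bad = (space ?P - E) \<union> (\<Union>i\<in>S. A i)"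
  show ?thesis
  proof (intro bexI[of _ Bad] conjI ballI allI)
    have UA: "(\<Union>i\<in>S. A i) \<in> sets ?P" using A(1) finite_S by (intro sets.finite_UN) auto
    have cE: "space ?P - E \<in> sets ?P" using E(1) by auto
    show "Bad \<in> sets ?P" unfolding Bad_def using UA cE by (rule sets.Un[rotated])
    have "emeasure ?P (\<Union>i\<in>S. A i) \<le> (\<Sum>i\<in>S. emeasure ?P (A i))"
      by (rule emeasure_subadditive_finite) (use A(1) finite_S in auto)
    also have "\<dots> \<le> (\<Sum>i\<in>S. ennreal (2 * exp (- t\<^sup>2 / 2)))" by (rule sum_mono) (rule A(2))
    also have "\<dots> = ennreal (real (card S) * (2 * exp (- t\<^sup>2 / 2)))"
      by (simp add: ennreal_mult' ennreal_of_nat_eq_real_of_nat)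
    finally have uA: "emeasure ?P (\<Union>i\<in>S. A i) \<le> ennreal (real (card S) * (2 * exp (- t\<^sup>2 / 2)))" .
    have cT: "card (insert p S) = card S + 1" using finite_S p_notin by simp
    have "emeasure ?P Bad \<le> emeasure ?P (space ?P - E) + emeasure ?P (\<Union>i\<in>S. A i)"
      unfolding Bad_def by (rule emeasure_subadditive[OF cE UA])
    also have "\<dots> \<le> ennreal (2 * 2 ^ (402 * (card S + 1)) * exp (- real m / 200)) + ennreal (real (card S) * (2 * exp (- t\<^sup>2 / 2)))"
      by (rule add_mono[OF E(2)[unfolded cT] uA])
    also have "\<dots> = ennreal (2 * 2 ^ (402 * (card S + 1)) * exp (- real m / 200) + real (card S) * (2 * exp (- t\<^sup>2 / 2)))"
      by (rule ennreal_plus[symmetric]) auto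
    finally show "emeasure ?P Bad \<le> ennreal (2 * 2 ^ (402 * (card S + 1)) * exp (- real m / 200)
        + real (card S) * (2 * exp (- t\<^sup>2 / 2)))" .
  next
    fix \<omega> :: "nat \<times> nat \<Rightarrow> real" and e :: real and u :: "nat \<Rightarrow> real"
    assume "\<omega> \<in> space ?P - Bad"
    hence \<omega>E: "\<omega> \<in> E" by (auto simp: Bad_def)
    let ?g = "\<lambda>t. if t = p then e * \<tau> else - (\<Sum>i\<in>S. L i t * u i)"
    have "(\<Sum>t\<in>S. (?g t)\<^sup>2) = (\<Sum>j\<in>S. (\<Sum>i\<in>S. L i j * u i)\<^sup>2)"
      using p_notin by (intro sum.cong) auto
    hence g: "(\<Sum>t\<in>insert p S. (?g t)\<^sup>2) = e\<^sup>2 * \<tau>\<^sup>2 + (\<Sum>j\<in>S. (\<Sum>i\<in>S. L i j * u i)\<^sup>2)"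
      using finite_S p_notin by (simp add: power_mult_distrib)
    show "real m / 2 * (e\<^sup>2 * \<tau>\<^sup>2 + (\<Sum>j\<in>S. (\<Sum>i\<in>S. L i j * u i)\<^sup>2)) \<le> (\<Sum>r<m. (e * y \<omega> r - (\<Sum>i\<in>S. Xs \<omega> r i * u i))\<^sup>2)"
      using E(3)[rule_format, OF \<omega>E, of ?g] unfolding g basis_comb by (rule conjunct1)
    show "(\<Sum>r<m. (e * y \<omega> r - (\<Sum>i\<in>S. Xs \<omega> r i * u i))\<^sup>2) \<le> 5 * real m * (e\<^sup>2 * \<tau>\<^sup>2 + (\<Sum>j\<in>S. (\<Sum>i\<in>S. L i j * u i)\<^sup>2))"
      using E(3)[rule_format, OF \<omega>E, of ?g] unfolding g basis_comb by (rule conjunct2)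
  next
    fix \<omega> :: "nat \<times> nat \<Rightarrow> real" and i
    assume \<omega>: "\<omega> \<in> space ?P - Bad" and i: "i \<in> S"
    hence "\<omega> \<in> space ?P" "\<omega> \<notin> A i" by (auto simp: Bad_def)
    hence "\<bar>\<Sum>r<m. acol (restrict \<omega> ({..<m} \<times> S)) i r * y \<omega> r\<bar>
       \<le> t * sqrt (\<tau>\<^sup>2 * (\<Sum>r<m. (acol (restrict \<omega> ({..<m} \<times> S)) i r)\<^sup>2))"
      unfolding A_def y_def \<gamma>_sum_rest by simp
    moreover have "(\<Sum>r<m. acol (restrict \<omega> ({..<m} \<times> S)) i r * y \<omega> r) = (\<Sum>r<m. acol \<omega> i r * y \<omega> r)"
      by (intro sum.cong refl) (simp add: acol_restrict)
    moreover have "(\<Sum>r<m. (acol (restrict \<omega> ({..<m} \<times> S)) i r)\<^sup>2) = (\<Sum>r<m. (acol \<omega> i r)\<^sup>2)"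
      by (intro sum.cong refl) (simp add: acol_restrict)
    ultimately show "\<bar>\<Sum>r<m. acol \<omega> i r * y \<omega> r\<bar> \<le> t * \<tau> * sqrt (\<Sum>r<m. (acol \<omega> i r)\<^sup>2)"
      using \<tau>_pos by (simp add: real_sqrt_mult mult.assoc)
  qed
qed

lemma regression:
  assumes data: "(X, \<epsilon>) = data_map m p L \<omega>" and r: "r < m"
  shows "i \<in> S \<Longrightarrow> X r i = Xs \<omega> r i"
    and "response p \<theta> \<sigma> X \<epsilon> r = (\<Sum>i\<in>S. Xs \<omega> r i * (\<theta> i + b i)) + y \<omega> r"
proof -
  have X: "X r i = (\<Sum>j<p. L i j * \<omega> (r, j))" if "i < p" for i
    using data r that by (auto simp: data_map_def lmap_def)
  have e: "\<epsilon> r = \<omega> (r, p)" using data r by (auto simp: data_map_def)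
  have XS: "X r i = Xs \<omega> r i" if i: "i \<in> S" for i
  proof -
    have "X r i = (\<Sum>j<p. L i j * \<omega> (r, j))" using X S i by auto
    also have "\<dots> = Xs \<omega> r i"
      unfolding Xs_def using S tri i by (intro sum.mono_neutral_right) auto
    finally show ?thesis .
  qed
  thus "i \<in> S \<Longrightarrow> X r i = Xs \<omega> r i" .
  have "(\<Sum>i<p. X r i * h i) = (\<Sum>i<p. \<Sum>j<p. L i j * h i * \<omega> (r, j))"
    using X by (simp add: sum_distrib_left sum_distrib_right mult_ac)
  also have "\<dots> = (\<Sum>j<p. \<Sum>i<p. L i j * h i * \<omega> (r, j))" by (rule sum.swap)
  also have "\<dots> = (\<Sum>j<p. \<gamma> j * \<omega> (r, j))" by (simp add: \<gamma>_def sum_distrib_right)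
  finally have Xh: "(\<Sum>i<p. X r i * h i) = (\<Sum>j<p. \<gamma> j * \<omega> (r, j))" .
  have "y \<omega> r = (\<Sum>j<Suc p. \<gamma> j * \<omega> (r, j))"
    unfolding y_def by (rule sum.mono_neutral_left) (auto simp: \<gamma>_S)
  hence yr: "y \<omega> r = (\<Sum>i<p. X r i * h i) + \<sigma> * \<epsilon> r" by (simp add: Xh e \<gamma>_def[of p])
  have "(\<Sum>i<p. X r i * h i) = (\<Sum>i<p. X r i * \<theta> i) - (\<Sum>i\<in>S. X r i * (\<theta> i + b i))"
    unfolding sum_split by (simp add: h_def distrib_left sum.distrib sum_negf)
  moreover have "(\<Sum>i\<in>S. X r i * (\<theta> i + b i)) = (\<Sum>i\<in>S. Xs \<omega> r i * (\<theta> i + b i))"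
    by (intro sum.cong refl) (simp add: XS)
  ultimately show "response p \<theta> \<sigma> X \<epsilon> r = (\<Sum>i\<in>S. Xs \<omega> r i * (\<theta> i + b i)) + y \<omega> r"
    using yr by (simp add: response_def)
qed

text \<open>The factor 1 matches the parameter \<open>e\<close> of the good event.\<close>

lemma RSS_eq:
  assumes data: "(X, \<epsilon>) = data_map m p L \<omega>" and t: "\<And>j. j \<notin> S \<Longrightarrow> t j = 0"
  shows "RSS m p (response p \<theta> \<sigma> X \<epsilon>) X t = (\<Sum>r<m. (1 * y \<omega> r - (\<Sum>i\<in>S. Xs \<omega> r i * (t i - \<theta> i - b i)))\<^sup>2)"
  unfolding RSS_def
proof (intro sum.cong refl arg_cong[where f = "\<lambda>x. x\<^sup>2"])
  fix r assume "r \<in> {..<m}"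
  hence r: "r < m" by simp
  have "(\<Sum>j<p. X r j * t j) = (\<Sum>j\<in>S. Xs \<omega> r j * t j)"
  proof -
    have "(\<Sum>j<p. X r j * t j) = (\<Sum>j\<in>S. X r j * t j)" by (rule sum_restrict_support[OF S t])
    also have "\<dots> = (\<Sum>j\<in>S. Xs \<omega> r j * t j)"
      by (intro sum.cong refl) (simp add: regression(1)[OF data r])
    finally show ?thesis .
  qed
  moreover have "(\<Sum>i\<in>S. Xs \<omega> r i * (t i - \<theta> i - b i))
      = (\<Sum>i\<in>S. Xs \<omega> r i * t i) - (\<Sum>i\<in>S. Xs \<omega> r i * (\<theta> i + b i))"
    unfolding sum_subtractf[symmetric] by (intro sum.cong refl) (simp add: algebra_simps)
  ultimately show "response p \<theta> \<sigma> X \<epsilon> r - (\<Sum>j<p. X r j * t j) = 1 * y \<omega> r - (\<Sum>i\<in>S. Xs \<omega> r i * (t i - \<theta> i - b i))"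
    using regression(2)[OF data r] by simp
qed

text \<open>The residual sum of squares is bounded below by the good event at the actual error, and
  above by comparison with the population coefficients, whose residual is \<open>y\<close> itself.
  The coordinates follow from the normal equations for the error, with \<open>y\<close> as the
  noise.\<close>

lemma estimate:
  assumes data: "(X, \<epsilon>) = data_map m p L \<omega>" and m: "m > 0" and t: "t \<ge> 0"
    and ls: "is_ls_S m p S (response p \<theta> \<sigma> X \<epsilon>) X th"
    and good: "\<And>e u. real m / 2 * (e\<^sup>2 * \<tau>\<^sup>2 + (\<Sum>j\<in>S. (\<Sum>i\<in>S. L i j * u i)\<^sup>2)) \<le> (\<Sum>r<m. (e * y \<omega> r - (\<Sum>i\<in>S. Xs \<omega> r i * u i))\<^sup>2)
        \<and> (\<Sum>r<m. (e * y \<omega> r - (\<Sum>i\<in>S. Xs \<omega> r i * u i))\<^sup>2) \<le> 5 * real m * (e\<^sup>2 * \<tau>\<^sup>2 + (\<Sum>j\<in>S. (\<Sum>i\<in>S. L i j * u i)\<^sup>2))"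
    and noise: "\<And>i. i \<in> S \<Longrightarrow> \<bar>\<Sum>r<m. acol \<omega> i r * y \<omega> r\<bar> \<le> t * \<tau> * sqrt (\<Sum>r<m. (acol \<omega> i r)\<^sup>2)"
  shows "\<And>i. i \<in> S \<Longrightarrow> \<bar>th i - \<theta> i - b i\<bar> \<le> t * \<tau> * sqrt (2 * \<eta> / real m)"
    and "\<tau>\<^sup>2 / 2 \<le> RSS m p (response p \<theta> \<sigma> X \<epsilon>) X th / real m"
    and "RSS m p (response p \<theta> \<sigma> X \<epsilon>) X th / real m \<le> 5 * \<tau>\<^sup>2"
proof -
  let ?Y = "response p \<theta> \<sigma> X \<epsilon>"
  define v where "v = (\<lambda>i. th i - \<theta> i - b i)"
  have th0: "th j = 0" if "j \<notin> S" for j using ls that by (auto simp: is_ls_S_def)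
  have R: "RSS m p ?Y X th = (\<Sum>r<m. (1 * y \<omega> r - (\<Sum>i\<in>S. Xs \<omega> r i * v i))\<^sup>2)"
    unfolding v_def by (rule RSS_eq[OF data th0])
  have "real m / 2 * \<tau>\<^sup>2 \<le> real m / 2 * (1\<^sup>2 * \<tau>\<^sup>2 + (\<Sum>j\<in>S. (\<Sum>i\<in>S. L i j * v i)\<^sup>2))"
    by (intro mult_left_mono) (auto intro: sum_nonneg)
  also have "\<dots> \<le> RSS m p ?Y X th" unfolding R using good by blast
  finally show "\<tau>\<^sup>2 / 2 \<le> RSS m p ?Y X th / real m" using m by (simp add: field_simps)
  define t0 where "t0 = (\<lambda>i. if i \<in> S then \<theta> i + b i else 0)"
  have "RSS m p ?Y X th \<le> RSS m p ?Y X t0" using ls by (auto simp: is_ls_S_def t0_def)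
  also have "\<dots> = (\<Sum>r<m. (1 * y \<omega> r - (\<Sum>i\<in>S. Xs \<omega> r i * (t0 i - \<theta> i - b i)))\<^sup>2)"
    by (rule RSS_eq[OF data]) (simp add: t0_def)
  also have "\<dots> \<le> 5 * real m * (1\<^sup>2 * \<tau>\<^sup>2 + (\<Sum>j\<in>S. (\<Sum>i\<in>S. L i j * (t0 i - \<theta> i - b i))\<^sup>2))"
    using good[of 1 "\<lambda>i. t0 i - \<theta> i - b i"] by (rule conjunct2)
  also have "\<dots> = 5 * real m * \<tau>\<^sup>2" by (simp add: t0_def)
  finally show "RSS m p ?Y X th / real m \<le> 5 * \<tau>\<^sup>2" using m by (simp add: field_simps)
  fix i assume i: "i \<in> S"
  have "\<bar>v i\<bar> \<le> t * \<tau> * sqrt (1 / (real m / (2 * \<eta>)))"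
  proof (rule normal_equations_coordinate_bound[where X = "Xs \<omega>" and y = "y \<omega>" and m = m, OF S i])
    \<comment> \<open>In this choice of \<open>K\<close> the 1/2 is the lower singular value bound
      at \<open>e = 0\<close>, and the division by \<eta> comes from
      \<open>energy_S_lower\<close>.\<close>
    show "real m / (2 * \<eta>) > 0" using m \<eta> by simp
    show "t * \<tau> \<ge> 0" using t \<tau>_pos by simp
    show "real m / (2 * \<eta>) * (\<Sum>i\<in>S. (u i)\<^sup>2) \<le> (\<Sum>r<m. (\<Sum>i\<in>S. Xs \<omega> r i * u i)\<^sup>2)" for u
    proof -
      have "real m / (2 * \<eta>) * (\<Sum>i\<in>S. (u i)\<^sup>2) \<le> real m / (2 * \<eta>) * (\<eta> * (\<Sum>j\<in>S. (\<Sum>i\<in>S. L i j * u i)\<^sup>2))"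
        using \<eta> by (intro mult_left_mono energy_S_lower) auto
      also have "\<dots> = real m / 2 * (0\<^sup>2 * \<tau>\<^sup>2 + (\<Sum>j\<in>S. (\<Sum>i\<in>S. L i j * u i)\<^sup>2))" using \<eta> by simp
      also have "\<dots> \<le> (\<Sum>r<m. (0 * y \<omega> r - (\<Sum>i\<in>S. Xs \<omega> r i * u i))\<^sup>2)" using good by blast
      finally show ?thesis by simp
    qed
    show "(\<Sum>r<m. Xs \<omega> r j * (y \<omega> r - (\<Sum>k\<in>S. Xs \<omega> r k * v k))) = 0" if j: "j \<in> S" for j
    proof -
      have "(\<Sum>r<m. Xs \<omega> r j * (y \<omega> r - (\<Sum>k\<in>S. Xs \<omega> r k * v k))) = (\<Sum>r<m. X r j * (?Y r - (\<Sum>k\<in>S. X r k * th k)))"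
      proof (rule sum.cong[OF refl])
        fix r assume "r \<in> {..<m}"
        hence r: "r < m" by simp
        have 1: "(\<Sum>k\<in>S. X r k * th k) = (\<Sum>k\<in>S. Xs \<omega> r k * th k)"
          by (intro sum.cong refl) (simp add: regression(1)[OF data r])
        have 2: "(\<Sum>k\<in>S. Xs \<omega> r k * v k) = (\<Sum>k\<in>S. Xs \<omega> r k * th k) - (\<Sum>k\<in>S. Xs \<omega> r k * (\<theta> k + b k))"
          unfolding sum_subtractf[symmetric] v_def by (intro sum.cong refl) (simp add: algebra_simps)
        show "Xs \<omega> r j * (y \<omega> r - (\<Sum>k\<in>S. Xs \<omega> r k * v k)) = X r j * (?Y r - (\<Sum>k\<in>S. X r k * th k))"
          unfolding 1 2 regression(1)[OF data r j] regression(2)[OF data r] by simp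
      qed
      also have "\<dots> = 0" by (rule least_squares_normal_equations[OF S ls j])
      finally show ?thesis .
    qed
    show "\<bar>\<Sum>r<m. (\<Sum>j\<in>S. pad_adj p S (\<lambda>j k. \<Sum>r<m. Xs \<omega> r j * Xs \<omega> r k) j i * Xs \<omega> r j) * y \<omega> r\<bar>
      \<le> t * \<tau> * sqrt (\<Sum>r<m. (\<Sum>j\<in>S. pad_adj p S (\<lambda>j k. \<Sum>r<m. Xs \<omega> r j * Xs \<omega> r k) j i * Xs \<omega> r j)\<^sup>2)"
      using noise[OF i] unfolding acol_def .
  qed
  thus "\<bar>th i - \<theta> i - b i\<bar> \<le> t * \<tau> * sqrt (2 * \<eta> / real m)" by (simp add: v_def)
qed

end

section \<open>Numerical bounds for the failure probability and the noise level\<close>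

lemma ln_four_div_ge_one:
  assumes "0 < \<delta>" "\<delta> < 1"
  shows "ln (4 / \<delta>) \<ge> (1 :: real)"
proof -
  have "exp 1 \<le> (3 :: real)" by (rule exp_le)
  also have "3 \<le> 4 / \<delta>" using assms by (simp add: field_simps)
  finally show ?thesis using assms by (simp add: ln_ge_iff)
qed

text \<open>Origin of the constant 100000: the exponent \<open>m / 200\<close> is at least
  \<open>500 * (a + ln (4 / \<delta>))\<close>, which exceeds
  \<open>402 * (s + 1) + ln (4 / \<delta>)\<close> because \<open>ln (4 / \<delta>) >= 1\<close>;
  powers of 2 are replaced by powers of e.\<close>

lemma net_failure_bound:
  fixes s m :: nat
  assumes s: "real s \<le> a" and \<delta>: "0 < \<delta>" "\<delta> < 1" and m: "100000 * (a + ln (4 / \<delta>)) \<le> real m"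
  shows "2 * 2 ^ (402 * (s + 1)) * exp (- real m / 200) \<le> \<delta> / 2"
proof -
  have l: "ln (4 / \<delta>) \<ge> 1" by (rule ln_four_div_ge_one[OF \<delta>])
  have "(2::real) \<le> exp 1" using exp_ge_add_one_self[of 1] by simp
  hence "(2::real) ^ (402 * (s + 1)) \<le> exp 1 ^ (402 * (s + 1))" by (intro power_mono) auto
  also have "\<dots> = exp (real (402 * (s + 1)))" by (metis exp_of_nat_mult mult.right_neutral)
  finally have "2 ^ (402 * (s + 1)) * exp (- real m / 200) \<le> exp (real (402 * (s + 1))) * exp (- real m / 200)"
    by (intro mult_right_mono) auto
  also have "\<dots> = exp (real (402 * (s + 1)) - real m / 200)" unfolding exp_add[symmetric] by simp
  also have "\<dots> \<le> exp (- ln (4 / \<delta>))"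
  proof -
    have "real (402 * (s + 1)) = 402 * real s + 402" by simp
    moreover have "500 * (a + ln (4 / \<delta>)) \<le> real m / 200" using m by simp
    ultimately show ?thesis using s l by simp
  qed
  also have "\<dots> = \<delta> / 4" using \<delta> by (simp add: exp_minus)
  finally show ?thesis by simp
qed

text \<open>As \<open>p >= 3\<close> gives \<open>ln p >= 1\<close>, the sum
  \<open>ln p + ln (4 / \<delta>)\<close> is at most the product of \<open>ln p\<close> and
  \<open>1 + ln (4 / \<delta>)\<close>, which is \<open>ln (4 e / \<delta>)\<close>. This explains
  the e in the threshold: the union bound over coordinates and the confidence level become separate
  factors.\<close>

lemma noise_level_bound:
  assumes p: "p \<ge> 3" and \<delta>: "0 < \<delta>" "\<delta> < 1" and \<eta>: "\<eta> > 1"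
  shows "sqrt (2 * ln (4 * real p / \<delta>)) * sqrt (2 * \<eta> / real m)
      \<le> 2 * sqrt \<eta> * sqrt (ln (4 * exp 1 / \<delta>)) * sqrt (ln (real p) / real m)"
proof -
  have l: "ln (4 / \<delta>) \<ge> 1" by (rule ln_four_div_ge_one[OF \<delta>])
  have "exp 1 \<le> (3 :: real)" by (rule exp_le)
  also have "3 \<le> real p" using p by simp
  finally have lp: "ln (real p) \<ge> 1" using p by (simp add: ln_ge_iff)
  have e1: "ln (4 * exp 1 / \<delta>) = 1 + ln (4 / \<delta>)" using \<delta> by (simp add: ln_mult ln_div)
  have e2: "ln (4 * real p / \<delta>) = ln (real p) + ln (4 / \<delta>)" using \<delta> p by (simp add: ln_mult ln_div)
  have "1 * ln (4 / \<delta>) \<le> ln (real p) * ln (4 / \<delta>)" using lp l by (intro mult_right_mono) auto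
  hence "ln (4 * real p / \<delta>) \<le> ln (4 * exp 1 / \<delta>) * ln (real p)" unfolding e1 e2 by (simp add: algebra_simps)
  hence "(2 * ln (4 * real p / \<delta>)) * (2 * \<eta> / real m) \<le> (2 * (ln (4 * exp 1 / \<delta>) * ln (real p))) * (2 * \<eta> / real m)"
    using \<eta> by (intro mult_right_mono mult_left_mono) auto
  also have "\<dots> = 4 * \<eta> * ln (4 * exp 1 / \<delta>) * (ln (real p) / real m)" by simp
  finally have "sqrt ((2 * ln (4 * real p / \<delta>)) * (2 * \<eta> / real m))
     \<le> sqrt (4 * \<eta> * ln (4 * exp 1 / \<delta>) * (ln (real p) / real m))" by (rule real_sqrt_le_mono)
  moreover have "sqrt (4 * \<eta> * ln (4 * exp 1 / \<delta>) * (ln (real p) / real m))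
     = 2 * sqrt \<eta> * sqrt (ln (4 * exp 1 / \<delta>)) * sqrt (ln (real p) / real m)"
    by (simp only: real_sqrt_mult real_sqrt_four)
  ultimately show ?thesis by (simp only: real_sqrt_mult)
qed

text \<open>The event \<open>A\<close> is fixed before \<open>th\<close>, and outside it every
  minimiser is covered, so the way in which an estimator selects one does not matter.\<close>

lemma threshold_estimate_event:
  fixes p m :: nat and \<theta> :: "nat \<Rightarrow> real" and \<Sigma> :: "real mat"
  assumes p: "p \<ge> 3" and \<sigma>: "\<sigma> > 0" and \<eta>: "\<eta> > 1" and cov: "covU p \<eta> \<Sigma>" and \<delta>: "0 < \<delta>" "\<delta> < 1"
    and a1: "a1 > 0" and a3: "a3 > 0"
    and m: "100000 * (a2 * real (l0 p \<theta>) + ln (4 / \<delta>)) \<le> real m"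
    and pS: "propS p m \<theta> \<sigma> a1 a2 a3 S"
    and clow: "clow \<ge> sqrt 2 * a1 + 11 * \<eta>^2 * max a3 1 * sqrt (ln (4 * exp 1 / \<delta>))"
  shows "\<exists>A \<in> sets (data_law m p \<Sigma>). measure (data_law m p \<Sigma>) A \<le> \<delta> \<and>
    (\<forall>(X, \<epsilon>) \<in> space (data_law m p \<Sigma>) - A. \<forall>th. is_ls_S m p S (response p \<theta> \<sigma> X \<epsilon>) X th \<longrightarrow>
      (\<exists>b \<tau>. threshold_estimate p m \<theta> th b S \<sigma> \<tau> \<eta> a1 a2 a3 clow (sqrt (ln (4 * exp 1 / \<delta>)))
        (sqrt (RSS m p (response p \<theta> \<sigma> X \<epsilon>) X th / real m)) (sqrt (ln (real p) / real m))))"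
proof (rule gauss_vec_eq_distr[OF cov \<eta>, where \<rho> = "\<lambda>i. if i \<in> S then 0 else 1"])
  fix L L' :: "nat \<Rightarrow> nat \<Rightarrow> real"
  \<comment> \<open>Rank 0 on \<open>S\<close> and 1 elsewhere: columns in \<open>S\<close> use only
    Gaussians indexed by \<open>S\<close>, and within each class the ranking imposes no
    condition.\<close>
  assume tri0: "\<And>i j. i < p \<Longrightarrow> j < p \<Longrightarrow> (if i \<in> S then 0 else 1 :: nat) < (if j \<in> S then 0 else 1) \<Longrightarrow> L i j = 0"
    and Q: "\<And>u. qform {..<p} (mfun \<Sigma>) u = (\<Sum>j<p. (\<Sum>i<p. L i j * u i)\<^sup>2)"
    and law: "gauss_vec p \<Sigma> = distr (PiM {..<p} (\<lambda>_. std_gauss)) (PiM {..<p} (\<lambda>_. borel)) (lmap {..<p} L)"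
    and inv: "\<And>x. lmap {..<p} L (lmap {..<p} L' x) = restrict x {..<p}"
      "\<And>x. lmap {..<p} L' (lmap {..<p} L x) = restrict x {..<p}"
  have S: "S \<subseteq> {..<p}" using pS by (simp add: propS_def)
  have fS: "finite S" using S by (rule finite_subset) simp
  have l: "ln (4 / \<delta>) \<ge> 1" by (rule ln_four_div_ge_one[OF \<delta>])
  have tri: "L i j = 0" if "i \<in> S" "j < p" "j \<notin> S" for i j using tri0[of i j] that S by auto
  have lower: "(\<Sum>i<p. (u i)\<^sup>2) \<le> \<eta> * (\<Sum>j<p. (\<Sum>i<p. L i j * u i)\<^sup>2)" for u
    using covU_qform_bounds(2)[OF cov \<eta>, of u] unfolding Q .
  have upper: "(\<Sum>j<p. (\<Sum>i<p. L i j * u i)\<^sup>2) \<le> \<eta> * (\<Sum>i<p. (u i)\<^sup>2)" for u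
    using covU_qform_bounds(1)[OF cov \<eta>, of u] unfolding Q .
  \<comment> \<open>The transposed block of \<open>L\<close> on \<open>S\<close> is injective
    because, by triangularity, it alone sees the energy of a vector supported on
    \<open>S\<close>.\<close>
  have inj: "\<forall>i\<in>S. u i = 0" if u: "\<And>j. j \<in> S \<Longrightarrow> (\<Sum>k\<in>S. L k j * u k) = 0" for u
  proof -
    define u' where "u' = (\<lambda>i. if i \<in> S then u i else 0)"
    have "(\<Sum>i<p. L i j * u' i) = 0" if j: "j < p" for j
    proof -
      have "(\<Sum>i<p. L i j * u' i) = (\<Sum>i\<in>S. L i j * u' i)"
        using S by (intro sum.mono_neutral_right) (auto simp: u'_def)
      also have "\<dots> = (\<Sum>i\<in>S. L i j * u i)" by (intro sum.cong) (auto simp: u'_def)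
      also have "\<dots> = 0" using u tri j by (cases "j \<in> S") auto
      finally show ?thesis .
    qed
    hence "(\<Sum>i<p. (u' i)\<^sup>2) \<le> 0" using lower[of u'] by simp
    hence "(\<Sum>i<p. (u' i)\<^sup>2) = 0" using sum_nonneg[of "{..<p}" "\<lambda>i. (u' i)\<^sup>2"] by simp
    hence "u' i = 0" if "i < p" for i using that by (simp add: sum_nonneg_eq_0_iff)
    thus ?thesis using S by (force simp: u'_def)
  qed
  obtain b where b: "\<And>j. j \<in> S \<Longrightarrow> (\<Sum>k\<in>S. L k j * b k) = (\<Sum>i\<in>{..<p} - S. L i j * \<theta> i)"
    using linear_system_solvable[OF S, of "\<lambda>j k. L k j" "\<lambda>j. \<Sum>i\<in>{..<p} - S. L i j * \<theta> i"] inj by blast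
  interpret gaussian_design p m \<eta> \<sigma> \<theta> b S L
    by unfold_locales (use S \<eta> \<sigma> tri lower upper b in auto)
  \<comment> \<open>Chosen so that \<open>2 * exp (- t^2 / 2)\<close> equals
    \<open>\<delta> / (2 p)\<close>, which leaves \<delta> / 2 after the union over at most
    \<open>p\<close> coordinates.\<close>
  define t where "t = sqrt (2 * ln (4 * real p / \<delta>))"
  have lnp: "ln (4 * real p / \<delta>) \<ge> 0"
    using \<delta> p by (intro ln_ge_zero) (simp add: field_simps)
  have t: "t \<ge> 0" "t\<^sup>2 = 2 * ln (4 * real p / \<delta>)" using lnp by (auto simp: t_def)
  have cS: "real (card S) \<le> a2 * real (l0 p \<theta>)" using pS by (simp add: propS_def)
  have m0: "m > 0"
  proof -
    have "0 < 100000 * (a2 * real (l0 p \<theta>) + ln (4 / \<delta>))" using cS l by simp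
    thus ?thesis using m by (intro Nat.gr0I) simp
  qed
  obtain Bad where Bad: "Bad \<in> sets (flat_law m (Suc p))"
    "emeasure (flat_law m (Suc p)) Bad \<le> ennreal (2 * 2 ^ (402 * (card S + 1)) * exp (- real m / 200)
        + real (card S) * (2 * exp (- t\<^sup>2 / 2)))"
    and good: "\<And>\<omega>. \<omega> \<in> space (flat_law m (Suc p)) - Bad \<Longrightarrow>
      (\<forall>e u. real m / 2 * (e\<^sup>2 * \<tau>\<^sup>2 + (\<Sum>j\<in>S. (\<Sum>i\<in>S. L i j * u i)\<^sup>2)) \<le> (\<Sum>r<m. (e * y \<omega> r - (\<Sum>i\<in>S. Xs \<omega> r i * u i))\<^sup>2)
        \<and> (\<Sum>r<m. (e * y \<omega> r - (\<Sum>i\<in>S. Xs \<omega> r i * u i))\<^sup>2) \<le> 5 * real m * (e\<^sup>2 * \<tau>\<^sup>2 + (\<Sum>j\<in>S. (\<Sum>i\<in>S. L i j * u i)\<^sup>2))) \<and>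
      (\<forall>i\<in>S. \<bar>\<Sum>r<m. acol \<omega> i r * y \<omega> r\<bar> \<le> t * \<tau> * sqrt (\<Sum>r<m. (acol \<omega> i r)\<^sup>2))"
    using good_event[OF t(1)] by blast
  have "2 * 2 ^ (402 * (card S + 1)) * exp (- real m / 200) + real (card S) * (2 * exp (- t\<^sup>2 / 2)) \<le> \<delta> / 2 + \<delta> / 2"
  proof (rule add_mono[OF net_failure_bound[OF cS \<delta> m]])
    have "exp (- t\<^sup>2 / 2) = \<delta> / (4 * real p)" unfolding t(2) using \<delta> p by (simp add: exp_minus)
    moreover have "real (card S) \<le> real p" using card_mono[OF _ S] by simp
    hence "real (card S) * (2 * (\<delta> / (4 * real p))) \<le> real p * (2 * (\<delta> / (4 * real p)))"
      using \<delta> by (intro mult_right_mono) auto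
    ultimately show "real (card S) * (2 * exp (- t\<^sup>2 / 2)) \<le> \<delta> / 2" using p by simp
  qed
  hence Bad\<delta>: "emeasure (flat_law m (Suc p)) Bad \<le> ennreal \<delta>"
    by (intro order_trans[OF Bad(2) ennreal_leI]) simp
  obtain A where A: "A \<in> sets (data_law m p \<Sigma>)" "measure (data_law m p \<Sigma>) A \<le> \<delta>"
    and AB: "\<And>z. z \<in> space (data_law m p \<Sigma>) - A \<Longrightarrow> \<exists>\<omega> \<in> space (flat_law m (Suc p)) - Bad. z = data_map m p L \<omega>"
    using data_law_transfer[OF law inv Bad(1) Bad\<delta>] \<delta> by auto
  show ?thesis
  proof (intro bexI[OF _ A(1)] conjI A(2) ballI, clarify)
    fix X \<epsilon> th
    assume z: "(X, \<epsilon>) \<in> space (data_law m p \<Sigma>)" "(X, \<epsilon>) \<notin> A"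
      and ls: "is_ls_S m p S (response p \<theta> \<sigma> X \<epsilon>) X th"
    obtain \<omega> where \<omega>: "\<omega> \<in> space (flat_law m (Suc p)) - Bad" and data: "(X, \<epsilon>) = data_map m p L \<omega>"
      using AB z by blast
    let ?l = "sqrt (ln (4 * exp 1 / \<delta>))" and ?lam = "sqrt (ln (real p) / real m)"
    let ?sh2 = "RSS m p (response p \<theta> \<sigma> X \<epsilon>) X th / real m"
    have est: "\<And>i. i \<in> S \<Longrightarrow> \<bar>th i - \<theta> i - b i\<bar> \<le> t * \<tau> * sqrt (2 * \<eta> / real m)"
      "\<tau>\<^sup>2 / 2 \<le> ?sh2" "?sh2 \<le> 5 * \<tau>\<^sup>2"
      using estimate[OF data m0 t(1) ls] good[OF \<omega>] by auto
    have sh2: "(sqrt ?sh2)\<^sup>2 = ?sh2" using est(2) by (intro real_sqrt_pow2) (simp add: order_trans[OF _ est(2)])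
    have "threshold_estimate p m \<theta> th b S \<sigma> \<tau> \<eta> a1 a2 a3 clow ?l (sqrt ?sh2) ?lam"
    proof
      show "1 \<le> ?l" using l \<delta> by (simp add: ln_mult ln_div)
      show "0 < ?lam" using p m0 by simp
      show "th i = 0" if "i \<notin> S" for i using ls that by (simp add: is_ls_S_def)
      show "\<bar>th i - \<theta> i - b i\<bar> \<le> 2 * \<tau> * sqrt \<eta> * ?l * ?lam" if "i \<in> S" for i
      proof -
        have "\<tau> * (t * sqrt (2 * \<eta> / real m)) \<le> \<tau> * (2 * sqrt \<eta> * ?l * ?lam)"
          unfolding t_def using \<tau>_pos by (intro mult_left_mono noise_level_bound p \<delta> \<eta>) auto
        thus ?thesis using est(1)[OF that] by (simp add: mult_ac)
      qed
      show "(\<Sum>i\<in>S. (b i)\<^sup>2) \<le> \<eta>\<^sup>2 * (\<Sum>i\<in>{..<p} - S. (\<theta> i)\<^sup>2)"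
        using bias_bounds(1) by (simp add: rest_def)
      show "\<tau>\<^sup>2 \<le> \<sigma>\<^sup>2 + \<eta> * (\<Sum>i\<in>{..<p} - S. (\<theta> i)\<^sup>2)"
        using bias_bounds(2) by (simp add: rest_def)
      show "\<tau>\<^sup>2 / 2 \<le> (sqrt ?sh2)\<^sup>2" "(sqrt ?sh2)\<^sup>2 \<le> 5 * \<tau>\<^sup>2" unfolding sh2 by (rule est)+
      have "0 \<le> ?sh2" by (rule order_trans[OF _ est(2)]) simp
      thus "0 \<le> sqrt ?sh2" by (rule real_sqrt_ge_zero)
    qed (use \<eta> \<sigma> \<sigma>_le_\<tau> a1 a3 pS clow in auto)
    thus "\<exists>b \<tau>. threshold_estimate p m \<theta> th b S \<sigma> \<tau> \<eta> a1 a2 a3 clow ?l (sqrt ?sh2) ?lam" by blast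
  qed
qed

section \<open>Both error bounds\<close>

lemma prob_space_data_law:
  assumes "covU p \<eta> \<Sigma>" "\<eta> > 1"
  shows "prob_space (data_law m p \<Sigma>)"
proof (rule gauss_vec_eq_distr[OF assms, where \<rho> = "\<lambda>i. i"])
  fix L :: "nat \<Rightarrow> nat \<Rightarrow> real"
  assume law: "gauss_vec p \<Sigma> = distr (PiM {..<p} (\<lambda>_. std_gauss)) (PiM {..<p} (\<lambda>_. borel)) (lmap {..<p} L)"
  interpret P: prob_space "flat_law m (Suc p)" by (rule prob_space_PiM) (rule prob_space_std_gauss)
  show ?thesis unfolding data_law_eq_distr[OF law] by (rule P.prob_space_distr[OF data_map_measurable])
qed

lemma (in threshold_estimate) test_th_iff:
  assumes "th = est Y X" "sh = sqrt (RSS m p Y X th / real m)"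
  shows "test_th m p k0 clow est Y X \<longleftrightarrow> k0 + 1 \<le> card found"
  unfolding test_th_def Let_def assms(1)[symmetric] assms(2)[symmetric] card_found ..

text \<open>The leading constant exceeds that of \<open>power_bound\<close> by 1, which makes the
  comparison strict because all remaining factors are positive.\<close>

lemma (in threshold_estimate) power_contradiction:
  assumes k: "k < l0 p \<theta>" and x: "x \<ge> 0"
    and sep: "(d2_B0 p k \<theta>)\<^sup>2 \<ge> (18 * \<eta> + 2 * \<eta>\<^sup>2 + 2) * (1 + a3\<^sup>2 * real (l0 p \<theta>) * ln (real p) / real m)
      * (x + clow\<^sup>2) * \<sigma>\<^sup>2 * ((real (l0 p \<theta>) - real k) * ln (real p) / real m)"
  shows "k + 1 \<le> card found"
proof (rule ccontr)
  assume "\<not> k + 1 \<le> card found"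
  hence kf: "card found \<le> k" by simp
  have "ln (real p) / real m > 0" using lam unfolding lam_def by simp
  hence lam2: "ln (real p) / real m = lam\<^sup>2" unfolding lam_def by simp
  define W where "W = 1 + a3\<^sup>2 * real (card supp) * lam\<^sup>2"
  define Z where "Z = \<sigma>\<^sup>2 * ((real (card supp) - real k) * lam\<^sup>2)"
  define C where "C = 18 * \<eta> + 2 * \<eta>\<^sup>2 + 1"
  have W: "W > 0" unfolding W_def by (rule add_pos_nonneg) auto
  have Z: "Z > 0" using k lam \<sigma> by (simp add: Z_def card_supp)
  have C: "C > 0" using \<eta> by (simp add: C_def add_pos_pos)
  have "(d2_B0 p k \<theta>)\<^sup>2 \<le> C * W * clow\<^sup>2 * Z"
    using power_bound[of k] k kf by (simp add: C_def W_def Z_def card_supp mult.assoc)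
  also have "\<dots> < (C + 1) * W * clow\<^sup>2 * Z"
    using W Z clow_bounds(4) by (simp add: algebra_simps)
  also have "\<dots> \<le> (C + 1) * W * (x + clow\<^sup>2) * Z"
    using x W Z C by (intro mult_right_mono mult_left_mono) auto
  also have "\<dots> \<le> (d2_B0 p k \<theta>)\<^sup>2"
    using sep unfolding times_divide_eq_right[symmetric] lam2
    by (simp add: C_def W_def Z_def card_supp mult.assoc add.assoc)
  finally show False by simp
qed

theorem theorem2:
  shows "\<exists>c::real. \<forall>\<eta>::real. \<eta> > 1 \<longrightarrow> (\<exists>c\<eta>::real.
    \<forall>(p::nat) (m::nat) (k0::nat) (\<theta>::nat \<Rightarrow> real) (\<sigma>::real) (\<Sigma>::real mat) (\<delta>::real)
      (a1::real) (a2::real) (a3::real) (S::nat set) (clow::real)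
      (est::(nat \<Rightarrow> real) \<Rightarrow> (nat \<Rightarrow> nat \<Rightarrow> real) \<Rightarrow> (nat \<Rightarrow> real)).
      p \<ge> 3 \<longrightarrow> (\<forall>j\<ge>p. \<theta> j = 0) \<longrightarrow> \<sigma> > 0 \<longrightarrow> covU p \<eta> \<Sigma> \<longrightarrow>
      0 < \<delta> \<longrightarrow> \<delta> < 1 \<longrightarrow> a1 > 0 \<longrightarrow> a2 > 0 \<longrightarrow> a3 > 0 \<longrightarrow>
      c * (a2 * real (l0 p \<theta>) + ln (4 / \<delta>)) \<le> real m \<longrightarrow>
      propS p m \<theta> \<sigma> a1 a2 a3 S \<longrightarrow>
      clow \<ge> sqrt 2 * a1 + 11 * \<eta>^2 * max a3 1 * sqrt (ln (4 * exp 1 / \<delta>)) \<longrightarrow>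
      (\<forall>Y X. is_ls_S m p S Y X (est Y X)) \<longrightarrow>
      ((l0 p \<theta> \<le> k0 \<longrightarrow>
          prob_le (data_law m p \<Sigma>)
            (\<lambda>(X, \<epsilon>). test_th m p k0 clow est (response p \<theta> \<sigma> X \<epsilon>) X) \<delta>) \<and>
       (l0 p \<theta> > k0 \<longrightarrow>
          (d2_B0 p k0 \<theta>)^2 \<ge> c\<eta> * (1 + a3^2 * real (l0 p \<theta>) * ln (real p) / real m)
             * (a3^2 * sqrt (ln (4 / \<delta>)) + clow^2)
             * \<sigma>^2 * ((real (l0 p \<theta>) - real k0) * ln (real p) / real m) \<longrightarrow>
          prob_ge (data_law m p \<Sigma>)
            (\<lambda>(X, \<epsilon>). test_th m p k0 clow est (response p \<theta> \<sigma> X \<epsilon>) X) (1 - \<delta>))))"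
proof (rule exI[of _ "100000 :: real"], rule allI, rule impI,
    rule_tac x = "18 * \<eta> + 2 * \<eta>\<^sup>2 + 2" in exI, intro allI impI)
  \<comment> \<open>Of the two witnesses, 100000 is the constant of
    \<open>net_failure_bound\<close>, and the one depending on \<eta> is that of
    \<open>power_bound\<close> increased by 1.\<close>
  fix \<eta> :: real and p m k0 :: nat and \<theta> :: "nat \<Rightarrow> real" and \<sigma> :: real and \<Sigma> :: "real mat" and \<delta> a1 a2 a3 :: real
    and S :: "nat set" and clow :: real and est :: "(nat \<Rightarrow> real) \<Rightarrow> (nat \<Rightarrow> nat \<Rightarrow> real) \<Rightarrow> (nat \<Rightarrow> real)"
  assume \<eta>: "\<eta> > 1" and p: "p \<ge> 3" and \<sigma>: "\<sigma> > 0" and cov: "covU p \<eta> \<Sigma>" and \<delta>: "0 < \<delta>" "\<delta> < 1"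
    and a: "a1 > 0" "a2 > 0" "a3 > 0"
    and m: "100000 * (a2 * real (l0 p \<theta>) + ln (4 / \<delta>)) \<le> real m"
    and pS: "propS p m \<theta> \<sigma> a1 a2 a3 S"
    and clow: "clow \<ge> sqrt 2 * a1 + 11 * \<eta>^2 * max a3 1 * sqrt (ln (4 * exp 1 / \<delta>))"
    and est: "\<forall>Y X. is_ls_S m p S Y X (est Y X)"
  let ?D = "data_law m p \<Sigma>" and ?test = "\<lambda>(X, \<epsilon>). test_th m p k0 clow est (response p \<theta> \<sigma> X \<epsilon>) X"
  obtain A where A: "A \<in> sets ?D" "measure ?D A \<le> \<delta>"
    and good: "\<forall>(X, \<epsilon>) \<in> space ?D - A. \<forall>th. is_ls_S m p S (response p \<theta> \<sigma> X \<epsilon>) X th \<longrightarrow>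
      (\<exists>b \<tau>. threshold_estimate p m \<theta> th b S \<sigma> \<tau> \<eta> a1 a2 a3 clow (sqrt (ln (4 * exp 1 / \<delta>)))
        (sqrt (RSS m p (response p \<theta> \<sigma> X \<epsilon>) X th / real m)) (sqrt (ln (real p) / real m)))"
    using threshold_estimate_event[OF p \<sigma> \<eta> cov \<delta> a(1,3) m pS clow] by blast
  have te: "\<exists>b \<tau>. threshold_estimate p m \<theta> (est (response p \<theta> \<sigma> X \<epsilon>) X) b S \<sigma> \<tau> \<eta> a1 a2 a3 clow (sqrt (ln (4 * exp 1 / \<delta>)))
        (sqrt (RSS m p (response p \<theta> \<sigma> X \<epsilon>) X (est (response p \<theta> \<sigma> X \<epsilon>) X) / real m)) (sqrt (ln (real p) / real m))"
    if "(X, \<epsilon>) \<in> space ?D" "(X, \<epsilon>) \<notin> A" for X \<epsilon>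
    using good est that by blast
  show "(l0 p \<theta> \<le> k0 \<longrightarrow> prob_le ?D ?test \<delta>) \<and>
     (l0 p \<theta> > k0 \<longrightarrow>
          (d2_B0 p k0 \<theta>)^2 \<ge> (18 * \<eta> + 2 * \<eta>\<^sup>2 + 2) * (1 + a3^2 * real (l0 p \<theta>) * ln (real p) / real m)
             * (a3^2 * sqrt (ln (4 / \<delta>)) + clow^2)
             * \<sigma>^2 * ((real (l0 p \<theta>) - real k0) * ln (real p) / real m) \<longrightarrow>
          prob_ge ?D ?test (1 - \<delta>))"
  proof (intro conjI impI)
    assume k: "l0 p \<theta> \<le> k0"
    have "\<not> test_th m p k0 clow est (response p \<theta> \<sigma> X \<epsilon>) X" if z: "(X, \<epsilon>) \<in> space ?D" "(X, \<epsilon>) \<notin> A" for X \<epsilon>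
    proof -
      obtain b \<tau> where "threshold_estimate p m \<theta> (est (response p \<theta> \<sigma> X \<epsilon>) X) b S \<sigma> \<tau> \<eta> a1 a2 a3 clow (sqrt (ln (4 * exp 1 / \<delta>)))
        (sqrt (RSS m p (response p \<theta> \<sigma> X \<epsilon>) X (est (response p \<theta> \<sigma> X \<epsilon>) X) / real m)) (sqrt (ln (real p) / real m))"
        using te[OF z] by blast
      then interpret threshold_estimate p m \<theta> "est (response p \<theta> \<sigma> X \<epsilon>) X" b S \<sigma> \<tau> \<eta> a1 a2 a3 clow "sqrt (ln (4 * exp 1 / \<delta>))"
        "sqrt (RSS m p (response p \<theta> \<sigma> X \<epsilon>) X (est (response p \<theta> \<sigma> X \<epsilon>) X) / real m)" "sqrt (ln (real p) / real m)" .
      show ?thesis using card_found_le k unfolding test_th_iff[of est "response p \<theta> \<sigma> X \<epsilon>" X, OF refl refl] card_supp by simp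
    qed
    \<comment> \<open>Rejection is confined to the measurable set \<open>A\<close>, which bounds its
      outer probability.\<close>
    hence "{z \<in> space ?D. ?test z} \<subseteq> A" by auto
    thus "prob_le ?D ?test \<delta>" unfolding prob_le_def using A by blast
  next
    assume k: "l0 p \<theta> > k0"
      and sep: "(d2_B0 p k0 \<theta>)^2 \<ge> (18 * \<eta> + 2 * \<eta>\<^sup>2 + 2) * (1 + a3^2 * real (l0 p \<theta>) * ln (real p) / real m)
             * (a3^2 * sqrt (ln (4 / \<delta>)) + clow^2)
             * \<sigma>^2 * ((real (l0 p \<theta>) - real k0) * ln (real p) / real m)"
    have x: "a3\<^sup>2 * sqrt (ln (4 / \<delta>)) \<ge> 0" using ln_four_div_ge_one[OF \<delta>] by simp
    have "test_th m p k0 clow est (response p \<theta> \<sigma> X \<epsilon>) X" if z: "(X, \<epsilon>) \<in> space ?D" "(X, \<epsilon>) \<notin> A" for X \<epsilon>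
    proof -
      obtain b \<tau> where "threshold_estimate p m \<theta> (est (response p \<theta> \<sigma> X \<epsilon>) X) b S \<sigma> \<tau> \<eta> a1 a2 a3 clow (sqrt (ln (4 * exp 1 / \<delta>)))
        (sqrt (RSS m p (response p \<theta> \<sigma> X \<epsilon>) X (est (response p \<theta> \<sigma> X \<epsilon>) X) / real m)) (sqrt (ln (real p) / real m))"
        using te[OF z] by blast
      then interpret threshold_estimate p m \<theta> "est (response p \<theta> \<sigma> X \<epsilon>) X" b S \<sigma> \<tau> \<eta> a1 a2 a3 clow "sqrt (ln (4 * exp 1 / \<delta>))"
        "sqrt (RSS m p (response p \<theta> \<sigma> X \<epsilon>) X (est (response p \<theta> \<sigma> X \<epsilon>) X) / real m)" "sqrt (ln (real p) / real m)" .
      show ?thesis unfolding test_th_iff[of est "response p \<theta> \<sigma> X \<epsilon>" X, OF refl refl] by (rule power_contradiction[OF k x sep])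
    qed
    \<comment> \<open>The complement of \<open>A\<close> is a measurable set inside the rejection
      region, as the inner probability demands.\<close>
    hence sub: "space ?D - A \<subseteq> {z \<in> space ?D. ?test z}" by auto
    interpret D: prob_space ?D by (rule prob_space_data_law[OF cov \<eta>])
    have "measure ?D (space ?D - A) = 1 - measure ?D A" by (rule D.prob_compl[OF A(1)])
    hence "1 - \<delta> \<le> measure ?D (space ?D - A)" using A(2) by simp
    thus "prob_ge ?D ?test (1 - \<delta>)" unfolding prob_ge_def using A(1) sub by blast
  qed
qed


end
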